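(* Let $X^\delta\subset X$ and $Y^\delta\subset Y$ be closed non-trivial subspaces, either both finite dimensional, or $X^\delta=X$ and $Y^\delta=Y$, with $X^\delta\subset Y^\delta$. Let $(\ell,u_0)\in Y'\times H$, let $u\in X$ be the solution of $\mathrm{d}_tu+Au=\ell$, $\gamma_0u=u_0$, and let $(\theta^\delta,u^\delta)\in Y^\delta\times X^\delta$ be the solution of $$N^\delta(\theta^\delta,u^\delta)=\big((E_Y^\delta)'\ell,\,-(E_X^\delta)'(\ell+\gamma_0'u_0)\big).$$ Let $\varrho>0$ be any constant, and suppose that with $$\theta_\delta:=A^{-1}(\ell-\mathrm{d}_tE_X^\delta u^\delta)\in Y$$ it holds that $$\|\theta_\delta-E_Y^\delta\theta^\delta\|_Y\le\varrho\Big(\|\theta^\delta-u^\delta\|_{Y^\delta}+\tfrac{\sqrt{1+L_A^2}}{m_A}\|u_0-\gamma_0E_X^\delta u^\delta\|_H\Big).$$ Then $$\|u-E_X^\delta u^\delta\|_X\le\Big(\tfrac{L_S}{m_S}+L_{N^{-1}}L_A\,\varrho\,\tfrac{2C_1\sqrt{1+L_A^2}}{m_A}\Big)\inf_{\bar u^\delta\in X^\delta}\|u-E_X^\delta\bar u^\delta\|_X,$$ where $L_S:=\max(1,L_A,\tfrac1{m_A})$, $m_S:=\min(1,m_A,\tfrac{m_A}{L_A^2})$, $L_{N^{-1}}:=\tfrac1{m_A}+\max(1,\tfrac1{m_A})\tfrac1{m_S}(1+\tfrac1{m_A})$, and $C_1:=1+\tfrac1{m_S}\big(1+\sqrt{(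1+L_A^2)(1+\tfrac1{m_A^2})}\big)$.
   Context: All linear spaces are over $\mathbb R$. $V\hookrightarrow H\simeq H'\hookrightarrow V'$ is a Gelfand triple of Hilbert spaces, $T>0$, $\Xi:=(0,T)$. Set $Y:=L_2(\Xi;V)$ and $X:=L_2(\Xi;V)\cap H^1(\Xi;V')$. It is known that $X\hookrightarrow C(\overline\Xi;H)$, and $\gamma_t\colon X\to H$ denotes the trace $w\mapsto w(t)$. Define $\mathrm{d}_t\colon X\to Y'$ by $(\mathrm{d}_t w)(v):=\int_\Xi (\tfrac{\mathrm{d}w}{\mathrm{d}t}(t))(v(t))\,\mathrm{d}t$. $X$ is equipped with the norm $\|w\|_X:=\sqrt{\|w\|_Y^2+\|\mathrm{d}_tw\|_{Y'}^2+\|\gamma_Tw\|_H^2}$. For a.e. $t\in\Xi$, $A(t)\colon V\to V'$ is a possibly nonlinear operator, and $A\colon Y\to Y'$ is defined by $(Aw)(v):=\int_\Xi (A(t)w(t))(v(t))\,\mathrm{d}t$. It is assumed that $A\colon Y\to Y'$ is Lipschitz continuous, $\|Aw-Av\|_{Y'}\le L_A\|w-v\|_Y$, and strongly monotone, $(Aw-Av)(w-v)\ge m_A\|w-v\|_Y^2$, for all $w,v\in Y$, with constants $L_A,m_A>0$; hence $A$ is invertible. It is known that then for every $(\ell,u_0)\in Y'\times H$ there is a unique $u\in X$ with $\mathrm{d}_tu+Au=\ell$, $\gamma_0u=u_0$. Primes denote duals/adjoints, and functionals in $Y'$ are viewed in $X'$ by restriction. $E_X^\delta\colon X^\delta\to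 X$ and $E_Y^\delta\colon Y^\delta\to Y$ are the trivial embeddings (so $(E_Y^\delta)'$, $(E_X^\delta)'$ restrict functionals to $Y^\delta$, $X^\delta$). $Y^\delta$ is equipped with $\|\cdot\|_{Y^\delta}:=\|E_Y^\delta\cdot\|_Y$ and $(Y^\delta)'$ with the dual norm. Set $A_Y^\delta:=(E_Y^\delta)'AE_Y^\delta$, $A_X^\delta:=(E_X^\delta)'AE_X^\delta$, $\mathrm{d}_t^\delta:=(E_Y^\delta)'\mathrm{d}_tE_X^\delta$, $\gamma_t^\delta:=\gamma_tE_X^\delta$, and define $N^\delta\colon Y^\delta\times X^\delta\to(Y^\delta)'\times(X^\delta)'$ by $$N^\delta(\theta,u):=\big(A_Y^\delta\theta+\mathrm{d}_t^\delta u,\ (\mathrm{d}_t^\delta)'\theta-(A_X^\delta u+(\gamma_T^\delta)'\gamma_T^\delta u)\big).$$ This operator is invertible. Note that $\theta_\delta$ (lower index) and $\theta^\delta$ (upper index) denote different objects. *)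

theory Defs
  imports "HOL-Analysis.Analysis"
begin

text \<open>
  The library has no quotient spaces modulo null sets, so Bochner spaces are sets of functions
  with their seminorms, and elements of \<open>L\<^sub>2((0,T);V)\<close> are equal when they agree
  almost everywhere (values outside \<open>(0,T)\<close> never matter). A functional on such a space is
  a real-valued function of representatives; only its values on the space matter.

  The library's Bochner integral and Borel measurability are adequate only for second-countable
  targets. Separability of \<open>V\<close> is not assumed here, hence the notion of strong (Bochner)
  measurability below; all integrals that occur are integrals of real functions.
\<close>

definition Xi :: "real \<Rightarrow> real measure" where
  "Xi T = lebesgue_on {0<..<T}"

definition strongly_measurable :: "'a measure \<Rightarrow> ('a \<Rightarrow> 'b::topological_space) \<Rightarrow> bool" where
  "strongly_measurable M f \<longleftrightarrow>
     (\<exists>s. (\<forall>i::nat. simple_function M (s i)) \<and> (AE t in M. (\<lambda>i. s i t) \<longlonglongrightarrow> f t))"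

definition L2 :: "real \<Rightarrow> (real \<Rightarrow> 'b::real_normed_vector) set" where
  "L2 T = {w. strongly_measurable (Xi T) w \<and> integrable (Xi T) (\<lambda>t. (norm (w t))\<^sup>2)}"

definition L2_norm :: "real \<Rightarrow> (real \<Rightarrow> 'b::real_normed_vector) \<Rightarrow> real" where
  "L2_norm T w = sqrt (\<integral>t. (norm (w t))\<^sup>2 \<partial>(Xi T))"

text \<open>
  \<open>dual S N\<close> is the dual of the space \<open>S\<close> with (semi)norm \<open>N\<close>.
\<close>

definition linear_functional_on :: "(real \<Rightarrow> 'b::real_vector) set \<Rightarrow> ((real \<Rightarrow> 'b) \<Rightarrow> real) \<Rightarrow> bool" where
  "linear_functional_on S f \<longleftrightarrow>
     (\<forall>v\<in>S. \<forall>w\<in>S. f (\<lambda>t. v t + w t) = f v + f w) \<and>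
     (\<forall>c. \<forall>v\<in>S. f (\<lambda>t. c *\<^sub>R v t) = c * f v)"

definition dual :: "(real \<Rightarrow> 'b::real_vector) set \<Rightarrow> ((real \<Rightarrow> 'b) \<Rightarrow> real) \<Rightarrow> ((real \<Rightarrow> 'b) \<Rightarrow> real) set" where
  "dual S N = {f. linear_functional_on S f \<and> (\<exists>C. \<forall>v\<in>S. \<bar>f v\<bar> \<le> C * N v)}"

definition dual_norm :: "(real \<Rightarrow> 'b::real_vector) set \<Rightarrow> ((real \<Rightarrow> 'b) \<Rightarrow> real) \<Rightarrow> ((real \<Rightarrow> 'b) \<Rightarrow> real) \<Rightarrow> real" where
  "dual_norm S N f = (SUP v\<in>{v\<in>S. N v \<le> 1}. \<bar>f v\<bar>)"

text \<open>
  A Gelfand triple is given by the dense continuous embedding \<open>j\<close> of \<open>V\<close> into \<open>H\<close>.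
  Identifying \<open>H\<close> with its dual, \<open>h\<close> is the functional \<open>\<lambda>v. h \<bullet> j v\<close> on \<open>V\<close>.
\<close>

definition gelfand_triple ::
    "('v::{real_inner,complete_space} \<Rightarrow> 'h::{real_inner,complete_space}) \<Rightarrow> bool" where
  "gelfand_triple j \<longleftrightarrow> bounded_linear j \<and> inj j \<and> closure (range j) = UNIV"

definition test_function :: "real \<Rightarrow> (real \<Rightarrow> real) \<Rightarrow> bool" where
  "test_function T \<phi> \<longleftrightarrow>
     (\<forall>n t. (deriv ^^ n) \<phi> field_differentiable at t) \<and>
     (\<exists>K. compact K \<and> K \<subseteq> {0<..<T} \<and> (\<forall>t. t \<notin> K \<longrightarrow> \<phi> t = 0))"

text \<open>
  \<open>g\<close> is the weak derivative in \<open>L\<^sub>2((0,T);V')\<close> of \<open>w\<close>, regarded as a \<open>V'\<close>-valued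
  function: the identity is that of the Bochner integrals of \<open>\<phi>' w\<close> and \<open>- \<phi> g\<close> in
  \<open>V'\<close>, evaluated at \<open>v\<close>.
\<close>

definition has_weak_derivative ::
    "('v::{real_inner,complete_space} \<Rightarrow> 'h::{real_inner,complete_space}) \<Rightarrow> real \<Rightarrow>
     (real \<Rightarrow> 'v) \<Rightarrow> (real \<Rightarrow> 'v \<Rightarrow>\<^sub>L real) \<Rightarrow> bool" where
  "has_weak_derivative j T w g \<longleftrightarrow>
     g \<in> L2 T \<and>
     (\<forall>\<phi> v. test_function T \<phi> \<longrightarrow>
        (\<integral>t. deriv \<phi> t * (j (w t) \<bullet> j v) \<partial>(Xi T)) =
        - (\<integral>t. \<phi> t * blinfun_apply (g t) v \<partial>(Xi T)))"

definition X_space ::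
    "('v::{real_inner,complete_space} \<Rightarrow> 'h::{real_inner,complete_space}) \<Rightarrow> real \<Rightarrow> (real \<Rightarrow> 'v) set" where
  "X_space j T = {w \<in> L2 T. \<exists>g. has_weak_derivative j T w g}"

definition weak_derivative ::
    "('v::{real_inner,complete_space} \<Rightarrow> 'h::{real_inner,complete_space}) \<Rightarrow> real \<Rightarrow>
     (real \<Rightarrow> 'v) \<Rightarrow> real \<Rightarrow> 'v \<Rightarrow>\<^sub>L real" where
  "weak_derivative j T w = (SOME g. has_weak_derivative j T w g)"

definition dt ::
    "('v::{real_inner,complete_space} \<Rightarrow> 'h::{real_inner,complete_space}) \<Rightarrow> real \<Rightarrow>
     (real \<Rightarrow> 'v) \<Rightarrow> (real \<Rightarrow> 'v) \<Rightarrow> real" where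
  "dt j T w v = (\<integral>t. blinfun_apply (weak_derivative j T w t) (v t) \<partial>(Xi T))"

text \<open>
  The trace at \<open>t\<close> is the value at \<open>t\<close> of the continuous representative, which exists and is
  unique on \<open>[0,T]\<close> for elements of \<open>X\<close>.
\<close>

definition time_trace ::
    "('v::{real_inner,complete_space} \<Rightarrow> 'h::{real_inner,complete_space}) \<Rightarrow> real \<Rightarrow>
     real \<Rightarrow> (real \<Rightarrow> 'v) \<Rightarrow> 'h" where
  "time_trace j T t w =
     (SOME c. continuous_on {0..T} c \<and> (AE s in Xi T. c s = j (w s))) t"

definition X_norm ::
    "('v::{real_inner,complete_space} \<Rightarrow> 'h::{real_inner,complete_space}) \<Rightarrow> real \<Rightarrow> (real \<Rightarrow> 'v) \<Rightarrow> real" where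
  "X_norm j T w =
     sqrt ((L2_norm T w)\<^sup>2 + (dual_norm (L2 T) (L2_norm T) (dt j T w))\<^sup>2 + (norm (time_trace j T T w))\<^sup>2)"

definition A_op ::
    "real \<Rightarrow> (real \<Rightarrow> 'v \<Rightarrow> 'v::{real_inner,complete_space} \<Rightarrow>\<^sub>L real) \<Rightarrow>
     (real \<Rightarrow> 'v) \<Rightarrow> (real \<Rightarrow> 'v) \<Rightarrow> real" where
  "A_op T A w v = (\<integral>t. blinfun_apply (A t (w t)) (v t) \<partial>(Xi T))"

text \<open>The integrals defining \<open>A\<close> exist, and \<open>A\<close> maps \<open>Y\<close> into its dual.\<close>

definition maps_into_dual ::
    "real \<Rightarrow> (real \<Rightarrow> 'v \<Rightarrow> 'v::{real_inner,complete_space} \<Rightarrow>\<^sub>L real) \<Rightarrow> bool" where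
  "maps_into_dual T A \<longleftrightarrow>
     (\<forall>w\<in>L2 T. (\<forall>v\<in>L2 T. integrable (Xi T) (\<lambda>t. blinfun_apply (A t (w t)) (v t))) \<and>
                A_op T A w \<in> dual (L2 T) (L2_norm T))"

definition lipschitz_into_dual ::
    "real \<Rightarrow> (real \<Rightarrow> 'v \<Rightarrow> 'v::{real_inner,complete_space} \<Rightarrow>\<^sub>L real) \<Rightarrow> real \<Rightarrow> bool" where
  "lipschitz_into_dual T A L \<longleftrightarrow>
     (\<forall>w\<in>L2 T. \<forall>v\<in>L2 T.
        dual_norm (L2 T) (L2_norm T) (\<lambda>z. A_op T A w z - A_op T A v z) \<le> L * L2_norm T (\<lambda>t. w t - v t))"

definition strongly_monotone ::
    "real \<Rightarrow> (real \<Rightarrow> 'v \<Rightarrow> 'v::{real_inner,complete_space} \<Rightarrow>\<^sub>L real) \<Rightarrow> real \<Rightarrow> bool" where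
  "strongly_monotone T A m \<longleftrightarrow>
     (\<forall>w\<in>L2 T. \<forall>v\<in>L2 T.
        A_op T A w (\<lambda>t. w t - v t) - A_op T A v (\<lambda>t. w t - v t) \<ge> m * (L2_norm T (\<lambda>t. w t - v t))\<^sup>2)"

text \<open>
  Closed linear subspaces of the space \<open>Z\<close> with seminorm \<open>N\<close>. Taking \<open>s\<close> constant shows
  that a closed \<open>S\<close> is a union of full equivalence classes modulo \<open>N\<close>.
\<close>

definition closed_subspace ::
    "(real \<Rightarrow> 'b::real_vector) set \<Rightarrow> ((real \<Rightarrow> 'b) \<Rightarrow> real) \<Rightarrow> (real \<Rightarrow> 'b) set \<Rightarrow> bool" where
  "closed_subspace Z N S \<longleftrightarrow>
     S \<subseteq> Z \<and> (\<lambda>_. 0) \<in> S \<and>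
     (\<forall>v\<in>S. \<forall>w\<in>S. (\<lambda>t. v t + w t) \<in> S) \<and>
     (\<forall>c. \<forall>v\<in>S. (\<lambda>t. c *\<^sub>R v t) \<in> S) \<and>
     (\<forall>s w. (\<forall>n::nat. s n \<in> S) \<and> w \<in> Z \<and> (\<lambda>n. N (\<lambda>t. s n t - w t)) \<longlonglongrightarrow> 0 \<longrightarrow> w \<in> S)"

definition nontrivial :: "real \<Rightarrow> (real \<Rightarrow> 'b::real_vector) set \<Rightarrow> bool" where
  "nontrivial T S \<longleftrightarrow> (\<exists>w\<in>S. \<not> (AE t in Xi T. w t = 0))"

definition finite_dimensional :: "real \<Rightarrow> (real \<Rightarrow> 'b::real_vector) set \<Rightarrow> bool" where
  "finite_dimensional T S \<longleftrightarrow>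
     (\<exists>(n::nat) b. (\<forall>i<n. b i \<in> S) \<and>
        (\<forall>w\<in>S. \<exists>c. AE t in Xi T. w t = (\<Sum>i<n. c i *\<^sub>R b i t)))"

text \<open>
  The adjoints of the embeddings of \<open>Yd\<close> and \<open>Xd\<close> restrict functionals; \<^const>\<open>restrict\<close> makes
  equality of the results mean equality as functionals on \<open>Yd\<close> and \<open>Xd\<close>. The adjoint of
  the trace operator is taken with respect to the identification of \<open>H\<close> with its dual.
\<close>

definition N_op ::
    "('v::{real_inner,complete_space} \<Rightarrow> 'h::{real_inner,complete_space}) \<Rightarrow> real \<Rightarrow>
     (real \<Rightarrow> 'v \<Rightarrow> 'v \<Rightarrow>\<^sub>L real) \<Rightarrow> (real \<Rightarrow> 'v) set \<Rightarrow> (real \<Rightarrow> 'v) set \<Rightarrow>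
     (real \<Rightarrow> 'v) \<times> (real \<Rightarrow> 'v) \<Rightarrow> ((real \<Rightarrow> 'v) \<Rightarrow> real) \<times> ((real \<Rightarrow> 'v) \<Rightarrow> real)" where
  "N_op j T A Yd Xd = (\<lambda>(\<theta>, u).
     (restrict (\<lambda>v. A_op T A \<theta> v + dt j T u v) Yd,
      restrict (\<lambda>w. dt j T w \<theta> - (A_op T A u w + time_trace j T T u \<bullet> time_trace j T T w)) Xd))"

definition L_S :: "real \<Rightarrow> real \<Rightarrow> real" where
  "L_S L m = Max {1, L, 1 / m}"

definition m_S :: "real \<Rightarrow> real \<Rightarrow> real" where
  "m_S L m = Min {1, m, m / L\<^sup>2}"

definition L_Ninv :: "real \<Rightarrow> real \<Rightarrow> real" where
  "L_Ninv L m = 1 / m + max 1 (1 / m) * (1 / m_S L m) * (1 + 1 / m)"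

definition C_1 :: "real \<Rightarrow> real \<Rightarrow> real" where
  "C_1 L m = 1 + 1 / m_S L m * (1 + sqrt ((1 + L\<^sup>2) * (1 + 1 / m\<^sup>2)))"

end

theory Submission
  imports Defs
begin

text \<open>Let \<open>e = u - ud\<close>, fix an arbitrary \<open>w \<in> Xd\<close>, and write \<open>x\<close> and \<open>D\<close> for the \<open>X\<close>-norms of
\<open>e\<close> and \<open>u - w\<close>. Two estimates carry the theorem.

The first, \<open>error_inequality\<close>, is a Cea-type argument. Eliminating the first unknown by means of
\<open>\<theta>_exact\<close> turns the mixed system into one equation for \<open>ud\<close>, and the linear form
\<open>B v = dt v (\<theta>_exact - u) + (A u - A ud) v + \<gamma>\<^sub>T e \<bullet> \<gamma>\<^sub>T v\<close> is the difference of the two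
sides of that equation at \<open>u\<close> and at \<open>ud\<close>. Since \<open>dt e = A \<theta>_exact - A u\<close>, monotonicity and
Lipschitz continuity of \<open>A\<close> give \<open>B e \<ge> m\<^sub>S x\<^sup>2\<close> and \<open>B (u - w) \<le> L\<^sub>S x D\<close>. On \<open>Xd\<close> the form would
vanish if \<open>\<theta>d\<close> were \<open>\<theta>_exact\<close>; in fact \<open>B z = dt z (\<theta>_exact - \<theta>d)\<close> there. Splitting
\<open>e = (u - w) - (ud - w)\<close> yields \<open>m\<^sub>S x\<^sup>2 \<le> L\<^sub>S x D + \<eta> (x + D)\<close> with \<open>\<eta> = \<parallel>\<theta>_exact - \<theta>d\<parallel>\<close>, a
quadratic inequality that is solved for \<open>x\<close> in \<open>quadratic_error_bound\<close>.

The second, \<open>estimator_bound\<close>, bounds the quantity that controls \<open>\<eta>\<close> by a multiple of \<open>D\<close>. With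
\<open>z = ud - w\<close> and \<open>y = \<theta>d - w\<close> the two discrete equations, tested with \<open>y\<close> and \<open>z\<close> and added, give
an energy inequality for \<open>y\<close>, \<open>z\<close> and \<open>\<gamma>\<^sub>T z\<close> whose right-hand side contains \<open>\<gamma>\<^sub>0 z\<close>. That trace
is recovered from \<open>\<parallel>\<gamma>\<^sub>0 z\<parallel>\<^sup>2 = \<parallel>\<gamma>\<^sub>T z\<parallel>\<^sup>2 - 2 dt z z\<close>, where the first discrete equation expresses
\<open>dt z\<close> on \<open>Yd\<close> through \<open>y\<close> and the residual of \<open>w\<close>. A weighted sum of the two relations closes the
estimate (\<open>estimator_stability\<close>).

Both estimates rest on the integration by parts formula \<open>dt_integration_by_parts\<close>, which by
polarization follows from \<open>2 dt w w = \<parallel>\<gamma>\<^sub>T w\<parallel>\<^sup>2 - \<parallel>\<gamma>\<^sub>0 w\<parallel>\<^sup>2\<close>, and on the existence of continuous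
representatives. These are proved pointwise. Testing with smoothed trapezoids
shows that \<open>(j (w b) - j (w a)) \<bullet> j d\<close> is the integral of \<open>g t d\<close> over \<open>(a, b]\<close>, where \<open>g\<close> is the
weak derivative, for almost all \<open>a\<close> and \<open>b\<close>. As \<open>w\<close> is a limit of simple functions, countably many
vectors \<open>d\<close> suffice to put the values of \<open>w\<close> for \<open>d\<close>, outside a single null set. Hence
\<open>\<parallel>j (w b)\<parallel>\<^sup>2 - \<parallel>j (w a)\<parallel>\<^sup>2\<close> is the integral of \<open>g t (w a + w b)\<close>, a trapezoidal rule for twice the
integral of \<open>g t (w t)\<close>. Summed over a fine partition with nodes at which \<open>w\<close> is close to a continuous
approximation of itself, the error of this rule tends to zero (\<open>energy_increment\<close>). The same
relations bound the oscillation of \<open>j \<circ> w\<close> off the null set and so produce its continuous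
representative (\<open>continuous_representative\<close>).
\<close>

section \<open>Smooth cut-off functions\<close>

text \<open>Encoded as the differentiability condition of \<^const>\<open>test_function\<close>.
\<close>

definition smooth :: "(real \<Rightarrow> real) \<Rightarrow> bool" where
  "smooth f \<longleftrightarrow> (\<forall>n t. (deriv ^^ n) f field_differentiable at t)"

text \<open>Smoothness is a greatest fixed point: a class of functions that contains a derivative of each of its
members consists of smooth functions. Each smoothness proof below exhibits such a class.
\<close>

lemma smooth_coinduct:
  assumes "f \<in> C"
    and step: "\<And>f. f \<in> C \<Longrightarrow> \<exists>f'\<in>C. \<forall>x. (f has_real_derivative f' x) (at x)"
  shows "smooth f"
proof -
  have deriv_in: "deriv g \<in> C" if g: "g \<in> C" for g
  proof -
    obtain g' where g': "g' \<in> C" "\<forall>x. (g has_real_derivative g' x) (at x)"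
      using step[OF g] by blast
    then have "deriv g = g'" by (auto intro!: ext DERIV_imp_deriv)
    then show ?thesis using g' by simp
  qed
  have "(deriv ^^ n) f \<in> C" for n
    by (induction n) (auto simp: assms(1) deriv_in)
  then show ?thesis
    unfolding smooth_def field_differentiable_def using step by blast
qed

lemma smooth_deriv: "smooth f \<Longrightarrow> smooth (deriv f)"
  unfolding smooth_def by (metis funpow_Suc_right o_apply)

lemma smooth_has_derivative:
  assumes "smooth f" shows "(f has_real_derivative deriv f x) (at x)"
proof -
  have "f field_differentiable at x"
    using assms[unfolded smooth_def, rule_format, of 0] by simp
  then show ?thesis by (simp add: DERIV_deriv_iff_field_differentiable)
qed

lemma smooth_continuous: "smooth f \<Longrightarrow> continuous_on A f"
  by (meson DERIV_isCont continuous_at_imp_continuous_on smooth_has_derivative)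

lemma smooth_antiderivative:
  assumes f: "smooth f" and zero: "\<And>x. x \<le> 0 \<Longrightarrow> f x = 0"
  obtains F where "smooth F" "\<And>x. (F has_real_derivative f x) (at x)" "\<And>x. x \<le> 0 \<Longrightarrow> F x = 0"
proof -
  define F where "F x = integral {-1..x} f" for x
  have F0: "F x = 0" if "x \<le> 0" for x
    unfolding F_def using zero that by (intro integral_unique has_integral_is_0) auto
  have DF: "(F has_real_derivative f x) (at x)" for x
  proof (cases "x < 0")
    case True
    have "((\<lambda>_. 0) has_real_derivative f x) (at x)" using zero True by simp
    moreover have "eventually (\<lambda>y. y < 0) (nhds x)"
      using True by (intro order_tendstoD(2)[OF filterlim_ident]) auto
    then have "eventually (\<lambda>y. F y = 0) (nhds x)" by eventually_elim (simp add: F0)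
    ultimately show ?thesis by (subst DERIV_cong_ev[OF refl _ refl]) auto
  next
    case False
    have "(F has_real_derivative f x) (at x within {-1..x+1})"
      unfolding F_def using False
      by (intro integral_has_real_derivative smooth_continuous f) auto
    moreover have "at x within {-1..x+1} = at x"
      using False by (intro at_within_interior) auto
    ultimately show ?thesis by simp
  qed
  have "smooth F"
  proof (rule smooth_coinduct[where C="insert F {f. smooth f}"])
    show "\<exists>f'\<in>insert F {f. smooth f}. \<forall>x. (g has_real_derivative f' x) (at x)"
      if "g \<in> insert F {f. smooth f}" for g
      using that DF f smooth_deriv smooth_has_derivative by blast
  qed simp
  then show thesis using DF F0 that by blast
qed

text \<open>The derivatives of \<open>exp (- 1 / (x (1 - x)))\<close>, continued by zero outside \<open>(0, 1)\<close>, are all of this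
form, so that this family is a class as required by \<open>smooth_coinduct\<close>.
\<close>

definition bump_term :: "real poly \<Rightarrow> nat \<Rightarrow> real \<Rightarrow> real" where
  "bump_term p k x = (if 0 < x \<and> x < 1 then poly p x / (x * (1 - x)) ^ k * exp (- 1 / (x * (1 - x))) else 0)"

text \<open>At the end points of \<open>(0, 1)\<close> the exponential beats every power of \<open>1 / (x (1 - x))\<close>, hence the
difference quotients tend to zero.
\<close>

lemma bump_term_small:
  assumes "x0 = 0 \<or> x0 = 1"
  shows "((\<lambda>x. bump_term p k x / (x - x0)) \<longlongrightarrow> 0) (at x0)"
proof -
  obtain M where M: "\<And>x. x \<in> {0..1} \<Longrightarrow> norm (poly p x) \<le> M"
    using continuous_on_compact_bound[OF compact_Icc continuous_on_poly[OF continuous_on_id, of "{0..1}" p]]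
    by metis
  have lim0: "((\<lambda>d::real. (1/d) ^ Suc k * exp (- (1/d))) \<longlongrightarrow> 0) (at_right 0)"
  proof -
    have "((\<lambda>y::real. y ^ Suc k / exp y) \<longlongrightarrow> 0) at_top" by (rule tendsto_power_div_exp_0)
    then have "((\<lambda>y::real. y ^ Suc k * exp (-y)) \<longlongrightarrow> 0) at_top"
      by (simp add: exp_minus divide_inverse)
    from filterlim_compose[OF this filterlim_inverse_at_top_right] 
    show ?thesis by (simp add: inverse_eq_divide)
  qed
  define h where "h d = (if d > 0 then (1/d) ^ Suc k * exp (- (1/d)) else 0)" for d :: real
  have h0: "(h \<longlongrightarrow> 0) (at 0)"
  proof (rule filterlim_split_at)
    show "(h \<longlongrightarrow> 0) (at_left 0)"
      by (rule tendsto_eventually, rule eventually_at_leftI[of "-1"]) (auto simp: h_def)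
    show "(h \<longlongrightarrow> 0) (at_right 0)"
      by (rule Lim_transform_eventually[OF lim0], rule eventually_at_rightI[of 0 1]) (auto simp: h_def)
  qed
  have h_cont: "isCont h 0" using h0 by (simp add: isCont_def h_def)
  have "((\<lambda>x. h (x * (1 - x))) \<longlongrightarrow> h (x0 * (1 - x0))) (at x0)"
    by (rule isCont_tendsto_compose[where g=h]) (use assms h_cont in \<open>auto intro!: tendsto_intros\<close>)
  then have lim: "((\<lambda>x. M * h (x * (1 - x))) \<longlongrightarrow> 0) (at x0)"
    using assms by (auto intro: tendsto_mult_right_zero simp: h_def)
  show ?thesis
  proof (rule Lim_null_comparison[OF always_eventually lim], rule allI)
    fix x
    show "norm (bump_term p k x / (x - x0)) \<le> M * h (x * (1 - x))"
    proof (cases "0 < x \<and> x < 1")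
      case True
      define d where "d = x * (1 - x)"
      have d: "d > 0" "d \<le> x" "d \<le> 1 - x" 
        using True by (auto simp: d_def mult_left_le mult_le_cancel_right1)
      have dx: "d \<le> \<bar>x - x0\<bar>" using assms d True by auto
      have M': "\<bar>poly p x\<bar> \<le> M" using M[of x] True by auto
      have "norm (bump_term p k x / (x - x0)) = \<bar>poly p x\<bar> * (1/d)^k * exp (- (1/d)) / \<bar>x - x0\<bar>"
        using True d by (simp add: bump_term_def d_def[symmetric] abs_mult abs_divide power_abs power_one_over)
      also have "\<dots> \<le> M * (1/d)^k * exp (- (1/d)) / d"
        using d dx M' by (intro frac_le mult_right_mono) auto
      also have "\<dots> = M * h (x * (1 - x))" using d by (simp add: h_def d_def[symmetric])
      finally show ?thesis .
    next
      case False
      have "M \<ge> 0" using M[of 0] by (meson atLeastAtMost_iff norm_ge_zero order.trans order_refl zero_le_one)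
      then show ?thesis using False by (auto simp: bump_term_def h_def)
    qed
  qed
qed

lemma bump_term_deriv:
  "\<exists>q. \<forall>x. (bump_term p k has_real_derivative bump_term q (k + 2) x) (at x)"
proof -
  define D :: "real poly" where "D = [:0, 1, -1:]"
  have D: "poly D x = x * (1 - x)" for x by (simp add: D_def algebra_simps)
  \<comment> \<open>the numerator of the derivative over the common denominator \<open>D ^ (k + 2)\<close>\<close>
  define q where "q = pderiv p * D ^ 2 - of_nat k * p * D * pderiv D + p * pderiv D"
  have D': "poly (pderiv D) x = 1 - 2 * x" for x by (simp add: D_def pderiv_pCons algebra_simps)
  have "(bump_term p k has_real_derivative bump_term q (k + 2) x) (at x)" for x
  proof -
    consider "x < 0 \<or> x > 1" | "x = 0 \<or> x = 1" | "0 < x" "x < 1" by linarith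
    then show ?thesis
    proof cases
      case 1
      have "open ({..<0} \<union> {1<..} :: real set)" by auto
      then have "eventually (\<lambda>y. y \<in> {..<0} \<union> {1<..}) (nhds x)"
        using 1 by (intro eventually_nhds_in_open) auto
      then have "eventually (\<lambda>y. bump_term p k y = 0) (nhds x)"
        by eventually_elim (auto simp: bump_term_def)
      then show ?thesis using 1 by (subst DERIV_cong_ev[OF refl _ refl]) (auto simp: bump_term_def)
    next
      case 2
      then have "bump_term p k x = 0" "bump_term q (k+2) x = 0" by (auto simp: bump_term_def)
      then show ?thesis using bump_term_small[OF 2, of p k] by (simp add: has_field_derivative_iff)
    next
      case 3
      have ev: "eventually (\<lambda>y. y \<in> {0<..<1}) (nhds x)"
        using 3 by (intro eventually_nhds_in_open) auto
      have pos: "poly D x > 0" using 3 by (simp add: D)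
      have "((\<lambda>y. poly p y * inverse (poly D y ^ k) * exp (- inverse (poly D y))) has_real_derivative
          poly q x / poly D x ^ (k+2) * exp (- inverse (poly D x))) (at x)"
        using pos
        apply -
        apply (rule derivative_eq_intros poly_DERIV refl | simp)+
        apply (cases k)
         apply (simp_all add: q_def field_simps power2_eq_square)
        done
      then have "((\<lambda>y. poly p y / (y * (1 - y)) ^ k * exp (- 1 / (y * (1 - y)))) has_real_derivative bump_term q (k + 2) x) (at x)"
        using 3 by (simp add: D bump_term_def field_simps inverse_eq_divide)
      then show ?thesis
        by (subst DERIV_cong_ev[OF refl _ refl])
           (use ev in \<open>auto elim!: eventually_mono simp: bump_term_def\<close>)
    qed
  qed
  then show ?thesis by blast
qed

lemma smooth_bump_term: "smooth (bump_term p k)"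
  by (rule smooth_coinduct[where C="{bump_term p k |p k. True}"]) (use bump_term_deriv in blast)+

text \<open>The step is the normalized antiderivative of a bump supported in \<open>[0, 1]\<close>.
\<close>

lemma smooth_step_exists:
  obtains S where "smooth S" "\<And>x. x \<le> 0 \<Longrightarrow> S x = 0" "\<And>x. x \<ge> 1 \<Longrightarrow> S x = 1" "\<And>x. 0 \<le> S x \<and> S x \<le> 1"
proof -
  let ?b = "bump_term 1 0"
  have b0: "?b x \<ge> 0" "x \<le> 0 \<Longrightarrow> ?b x = 0" "x \<ge> 1 \<Longrightarrow> ?b x = 0" for x 
    by (auto simp: bump_term_def)
  obtain F where F: "smooth F" "\<And>x. (F has_real_derivative ?b x) (at x)" "\<And>x. x \<le> 0 \<Longrightarrow> F x = 0"
    using smooth_antiderivative[OF smooth_bump_term[of 1 0] b0(2)] by blast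
  have mono: "F x \<le> F y" if "x \<le> y" for x y
    by (rule DERIV_nonneg_imp_nondecreasing[OF that]) (use F(2) b0(1) in blast)
  have const: "F x = F 1" if "x \<ge> 1" for x
  proof (rule antisym[OF _ mono[OF that]])
    show "F x \<le> F 1"
      using that by (rule DERIV_nonpos_imp_nonincreasing) (use F(2) b0(3) in \<open>metis order.refl\<close>)
  qed
  have pos: "F 1 > 0"
  proof -
    have "F 0 < F 1"
      by (rule DERIV_pos_imp_increasing_open)
         (auto intro!: exI F(2) DERIV_isCont[OF F(2)] DERIV_continuous_on continuous_at_imp_continuous_on simp: bump_term_def)
    then show ?thesis using F(3)[of 0] by simp
  qed
  show thesis
  proof (rule that[of "\<lambda>x. F x / F 1"])
    show "smooth (\<lambda>x. F x / F 1)"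
    proof (rule smooth_coinduct[where C="{\<lambda>x. G x / F 1 |G. smooth G}"])
      fix f assume "f \<in> {\<lambda>x. G x / F 1 |G. smooth G}"
      then obtain G where G: "smooth G" "f = (\<lambda>x. G x / F 1)" by blast
      then show "\<exists>f'\<in>{\<lambda>x. G x / F 1 |G. smooth G}. \<forall>x. (f has_real_derivative f' x) (at x)"
        by (intro bexI[of _ "\<lambda>x. deriv G x / F 1"])
           (auto intro!: DERIV_cdivide smooth_has_derivative smooth_deriv)
    qed (use F(1) in blast)
    show "0 \<le> F x / F 1 \<and> F x / F 1 \<le> 1" for x
      using mono[of x 1] mono[of 0 x] const[of x] F(3)[of x] F(3)[of 0] pos by (cases "x \<le> 0"; cases "x \<ge> 1") auto
    show "F x / F 1 = 0" if "x \<le> 0" for x using F(3)[OF that] by simp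
    show "F x / F 1 = 1" if "x \<ge> 1" for x using const[OF that] pos by simp
  qed
qed

section \<open>Strong measurability and square-integrable functions\<close>

text \<open>The inequality is optimized from \<open>2 \<bar>x y\<bar> \<le> c x\<^sup>2 + y\<^sup>2 / c\<close> over \<open>c > 0\<close>.
\<close>

lemma Cauchy_Schwarz_integral:
  fixes f g :: "'a \<Rightarrow> real"
  assumes [measurable]: "f \<in> borel_measurable M" "g \<in> borel_measurable M"
    and f: "integrable M (\<lambda>t. (f t)\<^sup>2)" and g: "integrable M (\<lambda>t. (g t)\<^sup>2)"
  shows "integrable M (\<lambda>t. f t * g t)"
    and "(\<integral>t. \<bar>f t * g t\<bar> \<partial>M) \<le> sqrt (\<integral>t. (f t)\<^sup>2 \<partial>M) * sqrt (\<integral>t. (g t)\<^sup>2 \<partial>M)"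
proof -
  have am: "\<bar>x * y\<bar> \<le> (c * x\<^sup>2 + y\<^sup>2 / c) / 2" if "c > 0" for x y c :: real
  proof -
    have "0 \<le> (c * \<bar>x\<bar> - \<bar>y\<bar>)\<^sup>2" by simp
    also have "\<dots> = c * (c * x\<^sup>2 + y\<^sup>2 / c - 2 * \<bar>x * y\<bar>)"
      using that by (simp add: power2_eq_square algebra_simps abs_mult)
    finally show ?thesis using that by (simp add: zero_le_mult_iff)
  qed
  show I: "integrable M (\<lambda>t. f t * g t)"
    by (rule Bochner_Integration.integrable_bound[where f="\<lambda>t. ((f t)\<^sup>2 + (g t)\<^sup>2) / 2"])
       (use f g am[of 1] in auto)
  have bd: "(\<integral>t. \<bar>f t * g t\<bar> \<partial>M) \<le> (c * (\<integral>t. (f t)\<^sup>2 \<partial>M) + (\<integral>t. (g t)\<^sup>2 \<partial>M) / c) / 2" if "c > 0" for c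
  proof -
    have "(\<integral>t. \<bar>f t * g t\<bar> \<partial>M) \<le> (\<integral>t. (c * (f t)\<^sup>2 + (g t)\<^sup>2 / c) / 2 \<partial>M)"
      using I f g am[OF that] by (intro integral_mono) auto
    then show ?thesis using f g by simp
  qed
  let ?a = "\<integral>t. (f t)\<^sup>2 \<partial>M" and ?b = "\<integral>t. (g t)\<^sup>2 \<partial>M"
  have nn: "?a \<ge> 0" "?b \<ge> 0" by auto
  show "(\<integral>t. \<bar>f t * g t\<bar> \<partial>M) \<le> sqrt ?a * sqrt ?b"
  proof (cases "?a = 0 \<or> ?b = 0")
    case True
    then have "AE t in M. \<bar>f t * g t\<bar> = 0"
    proof
      assume "?a = 0"
      then have "AE t in M. (f t)\<^sup>2 = 0" using f by (subst (asm) integral_nonneg_eq_0_iff_AE) auto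
      then show ?thesis by eventually_elim simp
    next
      assume "?b = 0"
      then have "AE t in M. (g t)\<^sup>2 = 0" using g by (subst (asm) integral_nonneg_eq_0_iff_AE) auto
      then show ?thesis by eventually_elim simp
    qed
    then have "(\<integral>t. \<bar>f t * g t\<bar> \<partial>M) = 0" by (rule integral_eq_zero_AE)
    then show ?thesis using nn by simp
  next
    case False
    then have p: "sqrt ?a > 0" "sqrt ?b > 0" using nn by (simp_all only: real_sqrt_gt_0_iff less_le) auto
    have "sqrt ?b / sqrt ?a * ?a = sqrt ?a * sqrt ?b" "?b / (sqrt ?b / sqrt ?a) = sqrt ?a * sqrt ?b"
      using p nn real_sqrt_mult_self[of ?a] real_sqrt_mult_self[of ?b]
      by (simp_all add: field_simps) 
    then show ?thesis using bd[of "sqrt ?b / sqrt ?a"] p by simp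
  qed
qed

lemma Xi_simps [simp]: "space (Xi T) = {0<..<T}" 
  by (simp add: Xi_def)

lemma finite_measure_Xi: "finite_measure (Xi T)"
  unfolding Xi_def by (rule finite_measure_lebesgue_on) auto

lemma integrable_const_Xi [simp]: "integrable (Xi T) (\<lambda>_. c :: real)"
  using finite_measure.integrable_const[OF finite_measure_Xi] .

lemma borel_subset_Xi [measurable]: "{s<..t} \<inter> {0<..<T} \<in> sets (Xi T)" 
  unfolding Xi_def by (auto simp: sets_restrict_space)

lemma continuous_measurable_Xi: "continuous_on UNIV f \<Longrightarrow> (f :: real \<Rightarrow> real) \<in> borel_measurable (Xi T)"
  unfolding Xi_def by (intro measurable_restrict_space1 measurable_completion) (simp add: borel_measurable_continuous_onI)

lemma indicator_measurable_Xi [measurable]: "(indicator {s<..t} :: real \<Rightarrow> real) \<in> borel_measurable (Xi T)"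
  unfolding Xi_def by (intro measurable_restrict_space1 measurable_completion) simp

lemma integrable_indicator_Xi:
  "integrable (Xi T) f \<Longrightarrow> integrable (Xi T) (\<lambda>t. indicator {s<..r} t * f t :: real)"
  using integrable_real_mult_indicator[of "{s<..r} \<inter> {0<..<T}" "Xi T" f] borel_subset_Xi
  by (subst Bochner_Integration.integrable_cong[OF refl, where g="\<lambda>t. f t * indicator ({s<..r} \<inter> {0<..<T}) t"]) (auto simp: indicator_def)

text \<open>This is the completeness of Lebesgue measure. It makes almost everywhere limits of simple functions
measurable.
\<close>

lemma AE_Xi_measurable:
  fixes f g :: "real \<Rightarrow> real"
  assumes "f \<in> borel_measurable (Xi T)" "AE t in Xi T. f t = g t"
  shows "g \<in> borel_measurable (Xi T)"
proof -
  have "(\<lambda>x. if x \<in> {0<..<T} then f x else 0) \<in> borel_measurable lebesgue"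
    using assms(1) unfolding Xi_def by (intro borel_measurable_if_I) auto
  moreover have "AE x in lebesgue. (if x \<in> {0<..<T} then f x else 0) = (if x \<in> {0<..<T} then g x else 0)"
    using assms(2) unfolding Xi_def by (subst (asm) AE_restrict_space_iff) auto
  ultimately have "(\<lambda>x. if x \<in> {0<..<T} then g x else 0) \<in> borel_measurable lebesgue"
    by (rule borel_measurable_AE)
  then show ?thesis unfolding Xi_def by (rule borel_measurable_if_D)
qed

lemma strongly_measurable_real:
  fixes f :: "real \<Rightarrow> real"
  assumes "strongly_measurable (Xi T) f"
  shows "f \<in> borel_measurable (Xi T)"
proof -
  obtain s where s: "\<And>i::nat. simple_function (Xi T) (s i)" "AE t in Xi T. (\<lambda>i. s i t) \<longlonglongrightarrow> f t"
    using assms unfolding strongly_measurable_def by blast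
  have [measurable]: "s i \<in> borel_measurable (Xi T)" for i
    using s(1) by (rule borel_measurable_simple_function)
  obtain N where N: "{t \<in> space (Xi T). \<not> (\<lambda>i. s i t) \<longlonglongrightarrow> f t} \<subseteq> N" "N \<in> null_sets (Xi T)"
    using s(2) by (auto elim!: AE_E simp: null_sets_def)
  have [measurable]: "N \<in> sets (Xi T)" using N(2) by auto
  have "(\<lambda>t. if t \<in> N then 0 else f t) \<in> borel_measurable (Xi T)"
    by (rule borel_measurable_LIMSEQ_real[where u="\<lambda>i t. if t \<in> N then 0 else s i t"])
       (use N(1) in auto)
  moreover have "AE t in Xi T. (if t \<in> N then 0 else f t) = f t"
    using AE_not_in[OF N(2)] by eventually_elim simp
  ultimately show ?thesis by (rule AE_Xi_measurable)
qed

lemma strongly_measurable_compose2: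
  fixes f :: "'a \<Rightarrow> 'b::t2_space" and g :: "'a \<Rightarrow> 'c::t2_space" and h :: "'b \<Rightarrow> 'c \<Rightarrow> 'd::t2_space"
  assumes "strongly_measurable M f" "strongly_measurable M g"
    and h: "continuous_on UNIV (\<lambda>p. h (fst p) (snd p))"
  shows "strongly_measurable M (\<lambda>t. h (f t) (g t))"
proof -
  obtain s where s: "\<And>i::nat. simple_function M (s i)" "AE t in M. (\<lambda>i. s i t) \<longlonglongrightarrow> f t"
    using assms unfolding strongly_measurable_def by blast
  obtain r where r: "\<And>i::nat. simple_function M (r i)" "AE t in M. (\<lambda>i. r i t) \<longlonglongrightarrow> g t"
    using assms unfolding strongly_measurable_def by blast
  show ?thesis unfolding strongly_measurable_def
  proof (intro exI[of _ "\<lambda>i t. h (s i t) (r i t)"] conjI allI)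
    show "simple_function M (\<lambda>t. h (s i t) (r i t))" for i
      using s(1) r(1) by (rule simple_function_compose2)
    show "AE t in M. (\<lambda>i. h (s i t) (r i t)) \<longlonglongrightarrow> h (f t) (g t)"
      using s(2) r(2)
    proof eventually_elim
      case (elim t)
      have "isCont (\<lambda>p. h (fst p) (snd p)) (f t, g t)"
        using h by (simp add: continuous_on_eq_continuous_at)
      from isCont_tendsto_compose[OF this tendsto_Pair[OF elim]] show ?case by simp
    qed
  qed
qed

lemma strongly_measurable_const: "strongly_measurable M (\<lambda>_. c)"
  unfolding strongly_measurable_def by (intro exI[of _ "\<lambda>_ _. c"]) auto

lemma strongly_measurable_norm_real:
  fixes f :: "real \<Rightarrow> 'a::real_normed_vector"
  shows "strongly_measurable (Xi T) f \<Longrightarrow> (\<lambda>t. norm (f t)) \<in> borel_measurable (Xi T)"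
  by (rule strongly_measurable_real,
      rule strongly_measurable_compose2[where h="\<lambda>x y. norm x" and g="\<lambda>_. 0::real", OF _ strongly_measurable_const])
     (auto intro!: continuous_intros)

lemma L2_norm_measurable: "w \<in> L2 T \<Longrightarrow> (\<lambda>t. norm (w t)) \<in> borel_measurable (Xi T)"
  by (simp add: L2_def strongly_measurable_norm_real)

lemma L2_integrable: "w \<in> L2 T \<Longrightarrow> integrable (Xi T) (\<lambda>t. (norm (w t))\<^sup>2)"
  by (simp add: L2_def)

lemma L2_norm_nonneg [simp]: "L2_norm T w \<ge> 0" by (simp add: L2_norm_def)

lemma L2_norm_sq: "(L2_norm T w)\<^sup>2 = (\<integral>t. (norm (w t))\<^sup>2 \<partial>Xi T)"
  by (simp add: L2_norm_def)

lemma L2_bound: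
  assumes "strongly_measurable (Xi T) f" and "AE t in Xi T. norm (f t) \<le> h t" and "integrable (Xi T) (\<lambda>t. (h t)\<^sup>2)"
  shows "f \<in> L2 T"
proof -
  have [measurable]: "(\<lambda>t. norm (f t)) \<in> borel_measurable (Xi T)"
    using assms(1) by (rule strongly_measurable_norm_real)
  have "integrable (Xi T) (\<lambda>t. (norm (f t))\<^sup>2)"
  proof (rule Bochner_Integration.integrable_bound[OF assms(3)])
    show "AE t in Xi T. norm ((norm (f t))\<^sup>2) \<le> norm ((h t)\<^sup>2)"
      using assms(2) by eventually_elim (simp add: power_mono)
  qed measurable
  then show ?thesis using assms(1) by (simp add: L2_def)
qed

lemma L2_add:
  assumes w: "w \<in> L2 T" and v: "v \<in> L2 T"
  shows "(\<lambda>t. w t + v t) \<in> L2 T"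
proof (rule L2_bound)
  show "strongly_measurable (Xi T) (\<lambda>t. w t + v t)"
    by (rule strongly_measurable_compose2[where h="\<lambda>x y. x + y"])
       (use w v in \<open>auto simp: L2_def intro!: continuous_intros\<close>)
  note [measurable] = L2_norm_measurable[OF w] L2_norm_measurable[OF v]
  show "integrable (Xi T) (\<lambda>t. (norm (w t) + norm (v t))\<^sup>2)"
    using L2_integrable[OF w] L2_integrable[OF v]
      Cauchy_Schwarz_integral(1)[OF L2_norm_measurable[OF w] L2_norm_measurable[OF v] L2_integrable[OF w] L2_integrable[OF v]]
    by (simp add: power2_sum algebra_simps)
qed (auto intro!: AE_I2 norm_triangle_ineq)

lemma L2_scale:
  assumes w: "w \<in> L2 T"
  shows "(\<lambda>t. c *\<^sub>R w t) \<in> L2 T"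
proof (rule L2_bound)
  show "strongly_measurable (Xi T) (\<lambda>t. c *\<^sub>R w t)"
    by (rule strongly_measurable_compose2[where h="\<lambda>x y. y *\<^sub>R x" and g="\<lambda>_. c", OF _ strongly_measurable_const])
       (use w in \<open>auto simp: L2_def intro!: continuous_intros\<close>)
  show "integrable (Xi T) (\<lambda>t. (\<bar>c\<bar> * norm (w t))\<^sup>2)"
    using L2_integrable[OF w] by (simp add: power_mult_distrib)
qed auto

lemma L2_diff: "w \<in> L2 T \<Longrightarrow> v \<in> L2 T \<Longrightarrow> (\<lambda>t. w t - v t) \<in> L2 T"
  using L2_add[of w T "\<lambda>t. (-1) *\<^sub>R v t", OF _ L2_scale] by simp

lemma L2_const: "(\<lambda>_. c) \<in> L2 T"
  by (simp add: L2_def strongly_measurable_const)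

text \<open>Pairings of square-integrable functions are integrable even though the factors may take values in
nonseparable spaces: strong measurability passes to the real-valued product, where it implies Borel
measurability.
\<close>

lemma L2_bilinear:
  fixes f :: "real \<Rightarrow> 'a::real_normed_vector" and g :: "real \<Rightarrow> 'b::real_normed_vector"
    and h :: "'a \<Rightarrow> 'b \<Rightarrow> real"
  assumes f: "f \<in> L2 T" and g: "g \<in> L2 T" and h: "bounded_bilinear h" and le: "\<And>x y. \<bar>h x y\<bar> \<le> norm x * norm y"
  shows "integrable (Xi T) (\<lambda>t. h (f t) (g t))"
    and "\<bar>\<integral>t. h (f t) (g t) \<partial>Xi T\<bar> \<le> L2_norm T f * L2_norm T g"
proof -
  have "strongly_measurable (Xi T) (\<lambda>t. h (f t) (g t))"
  proof (rule strongly_measurable_compose2[where h=h])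
    show "continuous_on UNIV (\<lambda>p. h (fst p) (snd p))"
      by (intro bounded_bilinear.continuous_on[OF h] continuous_intros)
  qed (use f g in \<open>auto simp: L2_def\<close>)
  then have [measurable]: "(\<lambda>t. h (f t) (g t)) \<in> borel_measurable (Xi T)"
    by (rule strongly_measurable_real)
  note CS = Cauchy_Schwarz_integral[OF L2_norm_measurable[OF f] L2_norm_measurable[OF g] L2_integrable[OF f] L2_integrable[OF g]]
  show I: "integrable (Xi T) (\<lambda>t. h (f t) (g t))"
    by (rule Bochner_Integration.integrable_bound[OF CS(1)]) (use le in \<open>auto simp: abs_mult\<close>)
  have "\<bar>\<integral>t. h (f t) (g t) \<partial>Xi T\<bar> \<le> (\<integral>t. \<bar>h (f t) (g t)\<bar> \<partial>Xi T)" by (rule integral_abs_bound)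
  also have "\<dots> \<le> (\<integral>t. \<bar>norm (f t) * norm (g t)\<bar> \<partial>Xi T)"
    using I CS(1) le by (intro integral_mono integrable_abs) (auto simp: abs_mult)
  also have "\<dots> \<le> L2_norm T f * L2_norm T g" using CS(2) by (simp add: L2_norm_def)
  finally show "\<bar>\<integral>t. h (f t) (g t) \<partial>Xi T\<bar> \<le> L2_norm T f * L2_norm T g" .
qed

lemma L2_norm_triangle:
  assumes w: "w \<in> L2 T" and v: "v \<in> L2 T"
  shows "L2_norm T (\<lambda>t. w t + v t) \<le> L2_norm T w + L2_norm T v"
proof (rule power2_le_imp_le)
  note CS = Cauchy_Schwarz_integral[OF L2_norm_measurable[OF w] L2_norm_measurable[OF v] L2_integrable[OF w] L2_integrable[OF v]]
  have I: "integrable (Xi T) (\<lambda>t. 2 * (norm (w t) * norm (v t)))"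
    using CS(1) by auto
  have "(L2_norm T (\<lambda>t. w t + v t))\<^sup>2 \<le> (\<integral>t. (norm (w t))\<^sup>2 + (norm (v t))\<^sup>2 + 2 * (norm (w t) * norm (v t)) \<partial>Xi T)"
    unfolding L2_norm_sq
  proof (intro integral_mono L2_integrable L2_add w v Bochner_Integration.integrable_add I)
    fix t
    show "(norm (w t + v t))\<^sup>2 \<le> (norm (w t))\<^sup>2 + (norm (v t))\<^sup>2 + 2 * (norm (w t) * norm (v t))"
      using power_mono[OF norm_triangle_ineq[of "w t" "v t"], of 2] by (simp add: power2_sum)
  qed
  also have "\<dots> = (L2_norm T w)\<^sup>2 + (L2_norm T v)\<^sup>2 + 2 * (\<integral>t. norm (w t) * norm (v t) \<partial>Xi T)"
    using L2_integrable[OF w] L2_integrable[OF v] I CS(1) by (simp add: L2_norm_sq)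
  also have "\<dots> \<le> (L2_norm T w)\<^sup>2 + (L2_norm T v)\<^sup>2 + 2 * (L2_norm T w * L2_norm T v)"
    using CS(2) by (simp add: L2_norm_def)
  finally show "(L2_norm T (\<lambda>t. w t + v t))\<^sup>2 \<le> (L2_norm T w + L2_norm T v)\<^sup>2" by (simp add: power2_sum)
qed simp

lemma L2_norm_scale: "L2_norm T (\<lambda>t. c *\<^sub>R w t) = \<bar>c\<bar> * L2_norm T w"
  by (simp add: L2_norm_def power_mult_distrib real_sqrt_mult)

lemma L2_indicator:
  assumes "w \<in> L2 T" shows "(\<lambda>t. indicator {s<..r} t *\<^sub>R w t) \<in> L2 T"
proof (rule L2_bound[OF _ _ L2_integrable[OF assms]])
  have "simple_function (Xi T) (indicator {s<..r} :: real \<Rightarrow> real)"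
    by (rule simple_function_borel_measurable) (auto intro: finite_subset[of _ "{0,1}"] simp: indicator_def)
  then have "strongly_measurable (Xi T) (indicator {s<..r} :: real \<Rightarrow> real)"
    unfolding strongly_measurable_def by (intro exI[of _ "\<lambda>_. indicator {s<..r}"]) auto
  then show "strongly_measurable (Xi T) (\<lambda>t. indicator {s<..r} t *\<^sub>R w t)"
    by (rule strongly_measurable_compose2[where h="\<lambda>x y. x *\<^sub>R y"])
       (use assms in \<open>auto simp: L2_def intro!: continuous_intros\<close>)
qed (auto simp: indicator_def)

section \<open>Weak derivatives as increments\<close>

text \<open>Lebesgue's differentiation theorem for averages over \<open>(x, x + h]\<close>. Half-open intervals make the
integrals over adjacent intervals additive without exceptional points.
\<close>

lemma lebesgue_right_average:
  assumes f: "integrable (Xi T) f"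
  shows "AE x in Xi T. ((\<lambda>h. (\<integral>t. indicator {x<..x+h} t * f t \<partial>Xi T) / h) \<longlongrightarrow> f x) (at_right 0)"
proof -
  define F where "F x = indicator {0<..<T} x * f x" for x
  have F: "integrable lebesgue F"
    using f unfolding Xi_def F_def by (subst (asm) integrable_restrict_space) auto
  have Fon: "integrable (lebesgue_on {a..b}) F" for a b
    using integrable_mult_indicator[OF _ F, of "{a..b}"] by (subst integrable_restrict_space) auto
  have int: "F integrable_on cbox a b" for a b
    using Fon by (simp add: integrable_on_lebesgue_on)
  obtain N where N: "negligible N"
     and lim: "\<And>x e. x \<notin> N \<Longrightarrow> 0 < e \<Longrightarrow>
       \<exists>d>0. \<forall>h. 0 < h \<and> h < d \<longrightarrow> norm (integral (cbox x (x + h *\<^sub>R One)) F /\<^sub>R h ^ DIM(real) - F x) < e"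
    using integrable_ccontinuous_explicit[of F, OF int] by blast
  have eq: "integral (cbox x (x + h *\<^sub>R One)) F = (\<integral>t. indicator {x<..x+h} t * f t \<partial>Xi T)" for x h
  proof -
    have "integral (cbox x (x + h *\<^sub>R One)) F = integral\<^sup>L (lebesgue_on {x..x+h}) F"
      using Fon by (simp add: lebesgue_integral_eq_integral)
    also have "\<dots> = (\<integral>t. indicator {x..x+h} t *\<^sub>R F t \<partial>lebesgue)"
      by (rule integral_restrict_space) auto
    also have "\<dots> = (\<integral>t. indicator {0<..<T} t *\<^sub>R (indicator {x<..x+h} t * f t) \<partial>lebesgue)"
    proof (rule integral_cong_AE)
      have "AE t in lebesgue. t \<notin> {x}" by (rule AE_not_in) simp
      then show "AE t in lebesgue. indicator {x..x+h} t *\<^sub>R F t = indicator {0<..<T} t *\<^sub>R (indicator {x<..x+h} t * f t)"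
        by eventually_elim (auto simp: F_def indicator_def)
      show "(\<lambda>t. indicator {x..x+h} t *\<^sub>R F t) \<in> borel_measurable lebesgue"
        by (rule borel_measurable_integrable[OF integrable_mult_indicator[OF _ F]]) simp
      have "(\<lambda>t. indicator {x<..x+h} t *\<^sub>R F t) \<in> borel_measurable lebesgue"
        by (rule borel_measurable_integrable[OF integrable_mult_indicator[OF _ F]]) simp
      then show "(\<lambda>t. indicator {0<..<T} t *\<^sub>R (indicator {x<..x+h} t * f t)) \<in> borel_measurable lebesgue"
        by (simp add: F_def mult.left_commute)
    qed
    also have "\<dots> = (\<integral>t. indicator {x<..x+h} t * f t \<partial>Xi T)"
      unfolding Xi_def by (rule integral_restrict_space[symmetric]) auto
    finally show ?thesis .
  qed
  have "AE x in Xi T. x \<notin> N"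
    unfolding Xi_def using N by (subst AE_restrict_space_iff) (auto intro: AE_not_in simp: negligible_iff_null_sets elim: eventually_mono[OF AE_not_in])
  moreover have "AE x in Xi T. x \<in> {0<..<T}" using AE_space[of "Xi T"] by simp
  ultimately show ?thesis
  proof eventually_elim
    case (elim x)
    then have Fx: "F x = f x" by (simp add: F_def)
    show ?case
    proof (rule tendstoI)
      fix e :: real assume "e > 0"
      from lim[OF elim(1) this] obtain d where d: "d > 0"
        "\<And>h. 0 < h \<Longrightarrow> h < d \<Longrightarrow> norm ((\<integral>t. indicator {x<..x+h} t * f t \<partial>Xi T) /\<^sub>R h - f x) < e"
        unfolding eq Fx by auto
      then show "eventually (\<lambda>h. dist ((\<integral>t. indicator {x<..x+h} t * f t \<partial>Xi T) / h) (f x) < e) (at_right 0)"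
        by (intro eventually_at_rightI[of 0 d]) (auto simp: dist_norm divide_inverse_commute)
    qed
  qed
qed

text \<open>The difference of two translates of \<open>ramp h\<close> is a trapezoid of height \<open>h\<close>; its derivative is a
difference of indicator functions of intervals of length \<open>h\<close>.
\<close>

definition ramp :: "real \<Rightarrow> real \<Rightarrow> real" where
  "ramp h y = max 0 (min h y)"

text \<open>The approximations are differences \<open>(P (n y) - P (n (y - h))) / n\<close>, where \<open>P\<close> is an antiderivative of
a smooth step. As \<open>P\<close> vanishes on the negative axis and is affine with slope one beyond \<open>1\<close>, they are
constant outside a bounded interval.
\<close>

lemma smooth_ramp_approximation:
  assumes h: "h > 0"
  obtains R where
    "\<And>n. smooth (R n)"
    "\<And>n y. y \<le> 0 \<Longrightarrow> R n y = 0"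
    "\<And>n y. y \<ge> h + 1 / Suc n \<Longrightarrow> R n y = h"
    "\<And>n y. \<bar>R n y\<bar> \<le> h" "\<And>n y. \<bar>deriv (R n) y\<bar> \<le> 1"
    "\<And>y. (\<lambda>n. R n y) \<longlonglongrightarrow> ramp h y"
    "\<And>y. (\<lambda>n. deriv (R n) y) \<longlonglongrightarrow> indicator {0<..h} y"
proof -
  obtain S where S: "smooth S" "\<And>x. x \<le> 0 \<Longrightarrow> S x = 0" "\<And>x. x \<ge> 1 \<Longrightarrow> S x = 1" "\<And>x. 0 \<le> S x \<and> S x \<le> 1"
    using smooth_step_exists by blast
  obtain P where P: "smooth P" "\<And>x. (P has_real_derivative S x) (at x)" "\<And>x. x \<le> 0 \<Longrightarrow> P x = 0"
    using smooth_antiderivative[OF S(1,2)] by blast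
  have mono1: "P x \<le> P y" if "x \<le> y" for x y
    by (rule DERIV_nonneg_imp_nondecreasing[OF that]) (use P(2) S(4) in blast)
  have D2: "((\<lambda>x. x - P x) has_real_derivative 1 - S x) (at x)" for x
    by (intro derivative_intros P(2))
  have mono2: "x - P x \<le> y - P y" if "x \<le> y" for x y
    by (rule DERIV_nonneg_imp_nondecreasing[OF that]) (use D2 S(4) in \<open>metis diff_ge_0_iff_ge\<close>)
  have lin: "x - P x = 1 - P 1" if "x \<ge> 1" for x
  proof (rule antisym[OF _ mono2[OF that]])
    show "x - P x \<le> 1 - P 1"
      by (rule DERIV_nonpos_imp_nonincreasing[OF that]) (use D2 S(3) in \<open>metis diff_self order.refl\<close>)
  qed
  define R where "R n y = (P (real (Suc n) * y) - P (real (Suc n) * (y - h))) / real (Suc n)" for n y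
  have dR: "(R n has_real_derivative S (real (Suc n) * y) - S (real (Suc n) * (y - h))) (at y)" for n y
  proof -
    define k where "k = real (Suc n)"
    have "((\<lambda>y. (P (k * y) - P (k * (y - h))) / k) has_real_derivative (S (k * y) * k - S (k * (y - h)) * k) / k) (at y)"
      by (intro DERIV_cdivide DERIV_diff DERIV_chain2[OF P(2)]) (auto intro!: derivative_eq_intros)
    then show ?thesis
      by (simp add: R_def[abs_def] k_def[symmetric] left_diff_distrib[symmetric]) (simp add: k_def)
  qed
  have dR': "deriv (R n) y = S (real (Suc n) * y) - S (real (Suc n) * (y - h))" for n y
    using dR by (rule DERIV_imp_deriv)
  show thesis
  proof (rule that[of R])
    show "smooth (R n)" for n
    proof (rule smooth_coinduct[where C="{\<lambda>y. c * (G (real (Suc n) * y) - G (real (Suc n) * (y - h))) |c G. smooth G}"])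
      show "R n \<in> {\<lambda>y. c * (G (real (Suc n) * y) - G (real (Suc n) * (y - h))) |c G. smooth G}"
        using P(1) by (auto intro!: exI[of _ "1 / Suc n"] exI[of _ P] simp: R_def fun_eq_iff)
      fix f assume "f \<in> {\<lambda>y. c * (G (real (Suc n) * y) - G (real (Suc n) * (y - h))) |c G. smooth G}"
      then obtain c G where G: "smooth G" "f = (\<lambda>y. c * (G (real (Suc n) * y) - G (real (Suc n) * (y - h))))" by blast
      have "(f has_real_derivative (c * real (Suc n)) * (deriv G (real (Suc n) * y) - deriv G (real (Suc n) * (y - h)))) (at y)" for y
        unfolding G(2)
        by (rule derivative_eq_intros DERIV_chain2[OF smooth_has_derivative[OF G(1)]] refl | simp add: field_simps)+
      then show "\<exists>f'\<in>{\<lambda>y. c * (G (real (Suc n) * y) - G (real (Suc n) * (y - h))) |c G. smooth G}. \<forall>x. (f has_real_derivative f' x) (at x)"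
        using smooth_deriv[OF G(1)]
        by (intro bexI[of _ "\<lambda>y. (c * real (Suc n)) * (deriv G (real (Suc n) * y) - deriv G (real (Suc n) * (y - h)))"]) blast+
    qed
    show "R n y = 0" if "y \<le> 0" for n y
      using that h by (simp add: R_def P(3) mult_nonneg_nonpos)
    show "R n y = h" if "y \<ge> h + 1 / Suc n" for n y
    proof -
      have "real (Suc n) * (y - h) \<ge> 1" using that by (simp add: field_simps)
      moreover from this have "real (Suc n) * y \<ge> 1" using h by (smt (verit) mult_left_mono of_nat_0_le_iff)
      ultimately show ?thesis
        using lin[of "real (Suc n) * y"] lin[of "real (Suc n) * (y - h)"] by (simp add: R_def field_simps)
    qed
    show "\<bar>R n y\<bar> \<le> h" for n y
    proof -
      have "real (Suc n) * (y - h) \<le> real (Suc n) * y" using h by (intro mult_left_mono) auto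
      from mono1[OF this] mono2[OF this] show ?thesis by (simp add: R_def field_simps)
    qed
    show "\<bar>deriv (R n) y\<bar> \<le> 1" for n y
      unfolding dR' using S(4)[of "real (Suc n) * y"] S(4)[of "real (Suc n) * (y - h)"] by linarith
    have ev: "eventually (\<lambda>n. real (Suc n) * y \<ge> 1) sequentially" if "y > 0" for y :: real
    proof -
      have "filterlim (\<lambda>n. y * real (Suc n)) at_top sequentially"
        by (rule filterlim_tendsto_pos_mult_at_top[OF tendsto_const that]) 
           (rule filterlim_compose[OF filterlim_real_sequentially filterlim_Suc])
      then show ?thesis by (simp add: filterlim_at_top mult.commute)
    qed
    have limS: "(\<lambda>n. S (real (Suc n) * y)) \<longlonglongrightarrow> indicator {0<..} y" for y
    proof (cases "y > 0")
      case True
      from ev[OF this] have "eventually (\<lambda>n. S (real (Suc n) * y) = indicator {0<..} y) sequentially"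
        by eventually_elim (use True S(3) in auto)
      then show ?thesis by (rule tendsto_eventually)
    qed (simp add: S(2) mult_nonneg_nonpos)
    show "(\<lambda>n. deriv (R n) y) \<longlonglongrightarrow> indicator {0<..h} y" for y
    proof -
      have "(\<lambda>n. deriv (R n) y) \<longlonglongrightarrow> indicator {0<..} y - indicator {0<..} (y - h)"
        unfolding dR' by (intro tendsto_diff limS)
      then show ?thesis using h by (auto simp: indicator_def split: if_splits)
    qed
    have limP: "(\<lambda>n. P (real (Suc n) * y) / real (Suc n)) \<longlonglongrightarrow> max 0 y" for y
    proof (cases "y > 0")
      case True
      have "(\<lambda>n. y - (1 - P 1) / real (Suc n)) \<longlonglongrightarrow> y - 0"
        by (intro tendsto_diff tendsto_const LIMSEQ_Suc lim_const_over_n)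
      moreover have "eventually (\<lambda>n. y - (1 - P 1) / real (Suc n) = P (real (Suc n) * y) / real (Suc n)) sequentially"
        using ev[OF True]
      proof eventually_elim
        case (elim n)
        have "P (real (Suc n) * y) = real (Suc n) * y - (1 - P 1)" using lin[OF elim] by linarith
        then show ?case by (simp add: diff_divide_distrib)
      qed
      ultimately show ?thesis using True by (auto intro: Lim_transform_eventually)
    qed (simp add: P(3) mult_nonneg_nonpos max_def)
    show "(\<lambda>n. R n y) \<longlonglongrightarrow> ramp h y" for y
    proof -
      have "(\<lambda>n. R n y) \<longlonglongrightarrow> max 0 y - max 0 (y - h)"
        unfolding R_def diff_divide_distrib by (intro tendsto_diff limP)
      moreover have "max 0 y - max 0 (y - h) = ramp h y" using h by (auto simp: ramp_def)
      ultimately show ?thesis by simp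
    qed
  qed
qed

lemma test_function_ramp_difference:
  assumes R: "\<And>n. smooth (R n)" "\<And>n y. y \<le> 0 \<Longrightarrow> R n y = 0" "\<And>n y. y \<ge> h + 1 / Suc n \<Longrightarrow> R n y = h"
    and "0 < a" "a < b" "b + h + 1 / Suc n < T"
  shows "test_function T (\<lambda>t. R n (t - a) - R n (t - b))"
proof -
  have "smooth (\<lambda>t. R n (t - a) - R n (t - b))"
  proof (rule smooth_coinduct[where C="{\<lambda>t. G (t - a) - G (t - b) |G. smooth G}"])
    fix f assume "f \<in> {\<lambda>t. G (t - a) - G (t - b) |G. smooth G}"
    then obtain G where G: "smooth G" "f = (\<lambda>t. G (t - a) - G (t - b))" by blast
    have "(f has_real_derivative deriv G (y - a) - deriv G (y - b)) (at y)" for y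
      unfolding G(2)
      by (rule derivative_eq_intros DERIV_chain2[OF smooth_has_derivative[OF G(1)]] refl | simp)+
    then show "\<exists>f'\<in>{\<lambda>t. G (t - a) - G (t - b) |G. smooth G}. \<forall>x. (f has_real_derivative f' x) (at x)"
      using smooth_deriv[OF G(1)] by (intro bexI[of _ "\<lambda>t. deriv G (t - a) - deriv G (t - b)"]) auto
  qed (use R(1) in blast)
  moreover have "R n (t - a) - R n (t - b) = 0" if "t \<notin> {a..b + h + 1 / Suc n}" for t
  proof (cases "t < a")
    case True then show ?thesis using \<open>a < b\<close> by (simp add: R(2))
  next
    case False then show ?thesis using \<open>a < b\<close> that by (simp add: R(3))
  qed
  ultimately show ?thesis
    unfolding test_function_def smooth_def using assms(4-6)
    by (intro conjI exI[of _ "{a..b + h + 1 / Suc n}"]) auto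
qed

text \<open>The points at which the value of \<open>f\<close> can be read off from its integrals.
\<close>

definition right_average_point :: "real \<Rightarrow> (real \<Rightarrow> real) \<Rightarrow> real \<Rightarrow> bool" where
  "right_average_point T f x \<longleftrightarrow> 0 < x \<and> x < T \<and>
     ((\<lambda>h. (\<integral>t. indicator {x<..x+h} t * f t \<partial>Xi T) / h) \<longlongrightarrow> f x) (at_right 0)"

lemma AE_right_average_point: "integrable (Xi T) f \<Longrightarrow> AE x in Xi T. right_average_point T f x"
  using lebesgue_right_average[of T f] AE_space[of "Xi T"] 
  unfolding right_average_point_def by (auto elim: eventually_elim2)

text \<open>Trapezoids are limits of test functions with bounded derivatives, so the defining identity of the
weak derivative extends to them by dominated convergence.
\<close>

lemma weak_derivative_ramp:
  assumes f: "integrable (Xi T) f" and g: "integrable (Xi T) g"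
    and weak: "\<And>\<phi>. test_function T \<phi> \<Longrightarrow> (\<integral>t. deriv \<phi> t * f t \<partial>Xi T) = - (\<integral>t. \<phi> t * g t \<partial>Xi T)"
    and ab: "0 < a" "a < b" and h: "h > 0" "b + h < T"
  shows "(\<integral>t. indicator {a<..a+h} t * f t \<partial>Xi T) - (\<integral>t. indicator {b<..b+h} t * f t \<partial>Xi T)
    = - (\<integral>t. (ramp h (t - a) - ramp h (t - b)) * g t \<partial>Xi T)"
proof -
  obtain R where R: "\<And>n. smooth (R n)"
    "\<And>n y. y \<le> 0 \<Longrightarrow> R n y = 0"
    "\<And>n y. y \<ge> h + 1 / Suc n \<Longrightarrow> R n y = h"
    "\<And>n y. \<bar>R n y\<bar> \<le> h" "\<And>n y. \<bar>deriv (R n) y\<bar> \<le> 1"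
    "\<And>y. (\<lambda>n. R n y) \<longlonglongrightarrow> ramp h y"
    "\<And>y. (\<lambda>n. deriv (R n) y) \<longlonglongrightarrow> indicator {0<..h} y"
    using smooth_ramp_approximation[OF h(1)] by blast
  note [measurable] = borel_measurable_integrable[OF f] borel_measurable_integrable[OF g]
  define \<phi> where "\<phi> n t = R n (t - a) - R n (t - b)" for n t
  have d\<phi>: "deriv (\<phi> n) t = deriv (R n) (t - a) - deriv (R n) (t - b)" for n t
    unfolding \<phi>_def
    by (rule DERIV_imp_deriv) (rule derivative_eq_intros DERIV_chain2[OF smooth_has_derivative[OF R(1)]] refl | simp)+
  have cont: "continuous_on UNIV (\<lambda>t. F (t - c))" if "smooth F" for F and c :: real
    by (rule continuous_on_compose2[OF smooth_continuous[OF that, of UNIV]]) (auto intro!: continuous_intros)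
  have [measurable]: "\<phi> n \<in> borel_measurable (Xi T)" "deriv (\<phi> n) \<in> borel_measurable (Xi T)" for n
    unfolding \<phi>_def[abs_def] d\<phi>[abs_def, unfolded \<phi>_def[abs_def]]
    by (intro continuous_measurable_Xi continuous_on_diff cont smooth_deriv R(1))+
  have ramp_meas [measurable]: "(\<lambda>t. ramp h (t - c)) \<in> borel_measurable (Xi T)" for c
    unfolding ramp_def by (intro continuous_measurable_Xi continuous_intros)
  have A: "(\<lambda>n. \<integral>t. deriv (\<phi> n) t * f t \<partial>Xi T) \<longlonglongrightarrow> (\<integral>t. (indicator {a<..a+h} t - indicator {b<..b+h} t) * f t \<partial>Xi T)"
  proof (rule integral_dominated_convergence[where w="\<lambda>t. 2 * \<bar>f t\<bar>"])
    have eq: "indicator {0<..h} (t - c) = (indicator {c<..c+h} t :: real)" for t c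
      by (auto simp: indicator_def)
    show "AE t in Xi T. (\<lambda>n. deriv (\<phi> n) t * f t) \<longlonglongrightarrow> (indicator {a<..a+h} t - indicator {b<..b+h} t) * f t"
      unfolding d\<phi> eq[symmetric] by (intro AE_I2 tendsto_intros R(7))
    show "AE t in Xi T. norm (deriv (\<phi> n) t * f t) \<le> 2 * \<bar>f t\<bar>" for n
    proof (rule AE_I2)
      fix t
      have "\<bar>deriv (\<phi> n) t\<bar> \<le> 2" unfolding d\<phi> using R(5)[of n "t - a"] R(5)[of n "t - b"] by linarith
      then show "norm (deriv (\<phi> n) t * f t) \<le> 2 * \<bar>f t\<bar>" by (simp add: abs_mult mult_right_mono)
    qed
  qed (use f in \<open>auto intro!: borel_measurable_times borel_measurable_diff\<close>)
  have B: "(\<lambda>n. \<integral>t. \<phi> n t * g t \<partial>Xi T) \<longlonglongrightarrow> (\<integral>t. (ramp h (t - a) - ramp h (t - b)) * g t \<partial>Xi T)"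
  proof (rule integral_dominated_convergence[where w="\<lambda>t. 2 * h * \<bar>g t\<bar>"])
    show "AE t in Xi T. (\<lambda>n. \<phi> n t * g t) \<longlonglongrightarrow> (ramp h (t - a) - ramp h (t - b)) * g t"
      unfolding \<phi>_def by (intro AE_I2 tendsto_intros R(6))
    show "AE t in Xi T. norm (\<phi> n t * g t) \<le> 2 * h * \<bar>g t\<bar>" for n
    proof (rule AE_I2)
      fix t
      have "\<bar>\<phi> n t\<bar> \<le> 2 * h" unfolding \<phi>_def using R(4)[of n "t - a"] R(4)[of n "t - b"] by linarith
      then show "norm (\<phi> n t * g t) \<le> 2 * h * \<bar>g t\<bar>" by (simp add: abs_mult mult_right_mono)
    qed
  qed (use g in auto)
  have E: "eventually (\<lambda>n. (\<integral>t. deriv (\<phi> n) t * f t \<partial>Xi T) = - (\<integral>t. \<phi> n t * g t \<partial>Xi T)) sequentially"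
  proof -
    have "(\<lambda>n. b + h + 1 / Suc n) \<longlonglongrightarrow> b + h + 0"
      by (intro tendsto_intros LIMSEQ_Suc lim_const_over_n)
    then have "eventually (\<lambda>n. b + h + 1 / Suc n < T) sequentially"
      using h by (auto dest: order_tendstoD(2))
    then show ?thesis
    proof eventually_elim
      case (elim n)
      have "test_function T (\<phi> n)"
        unfolding \<phi>_def by (rule test_function_ramp_difference[where R=R and h=h, OF R(1-3) ab elim])
      then show ?case by (rule weak)
    qed
  qed
  have "(\<integral>t. (indicator {a<..a+h} t - indicator {b<..b+h} t) * f t \<partial>Xi T)
      = - (\<integral>t. (ramp h (t - a) - ramp h (t - b)) * g t \<partial>Xi T)"
    by (rule LIMSEQ_unique[OF Lim_transform_eventually[OF A E] tendsto_minus[OF B]])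
  then show ?thesis
    by (simp add: left_diff_distrib integrable_indicator_Xi f)
qed

text \<open>Dividing the identity for trapezoids by their height \<open>h\<close> and letting \<open>h\<close> tend to zero turns the
trapezoids into the indicator function of \<open>(a, b]\<close> and the averages of \<open>f\<close> into its values.
\<close>

lemma weak_derivative_increment:
  assumes f: "integrable (Xi T) f" and g: "integrable (Xi T) g"
    and weak: "\<And>\<phi>. test_function T \<phi> \<Longrightarrow> (\<integral>t. deriv \<phi> t * f t \<partial>Xi T) = - (\<integral>t. \<phi> t * g t \<partial>Xi T)"
    and a: "right_average_point T f a" and b: "right_average_point T f b" and ab: "a < b"
  shows "f b - f a = (\<integral>t. indicator {a<..b} t * g t \<partial>Xi T)"
proof -
  note [measurable] = borel_measurable_integrable[OF g]
  have ramp_meas [measurable]: "(\<lambda>t. ramp h (t - c)) \<in> borel_measurable (Xi T)" for c h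
    unfolding ramp_def by (intro continuous_measurable_Xi continuous_intros)
  define h where "h n = 1 / real (Suc n)" for n
  have h0: "h \<longlonglongrightarrow> 0" unfolding h_def by (intro LIMSEQ_Suc lim_const_over_n)
  have hpos: "h n > 0" for n by (simp add: h_def)
  have hR: "filterlim h (at_right 0) sequentially"
    using h0 by (rule tendsto_imp_filterlim_at_right) (simp add: hpos)
  have ab': "0 < a" "b < T" using a b by (auto simp: right_average_point_def)
  have lim: "(\<lambda>n. (\<integral>t. indicator {x<..x+h n} t * f t \<partial>Xi T) / h n) \<longlonglongrightarrow> f x" if "right_average_point T f x" for x
    using that filterlim_compose[OF _ hR] unfolding right_average_point_def by blast
  have A: "(\<lambda>n. (\<integral>t. indicator {a<..a+h n} t * f t \<partial>Xi T) / h n - (\<integral>t. indicator {b<..b+h n} t * f t \<partial>Xi T) / h n)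
      \<longlonglongrightarrow> f a - f b"
    by (intro tendsto_diff lim a b)
  have B: "(\<lambda>n. \<integral>t. (ramp (h n) (t - a) / h n - ramp (h n) (t - b) / h n) * g t \<partial>Xi T)
      \<longlonglongrightarrow> (\<integral>t. indicator {a<..b} t * g t \<partial>Xi T)"
  proof (rule integral_dominated_convergence[where w="\<lambda>t. 2 * \<bar>g t\<bar>"])
    have r: "(\<lambda>n. ramp (h n) (t - c) / h n) \<longlonglongrightarrow> indicator {c<..} t" for t c
    proof (cases "t > c")
      case True
      have "eventually (\<lambda>n. h n < t - c) sequentially" using True by (intro order_tendstoD(2)[OF h0]) simp
      then have "eventually (\<lambda>n. ramp (h n) (t - c) / h n = indicator {c<..} t) sequentially"
      proof eventually_elim
        case (elim n)
        then show ?case using True hpos[of n] by (simp add: ramp_def)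
      qed
      then show ?thesis by (rule tendsto_eventually)
    qed (simp add: ramp_def)
    show "AE t in Xi T. (\<lambda>n. (ramp (h n) (t - a) / h n - ramp (h n) (t - b) / h n) * g t) \<longlonglongrightarrow> indicator {a<..b} t * g t"
    proof (rule AE_I2)
      fix t
      have "(\<lambda>n. (ramp (h n) (t - a) / h n - ramp (h n) (t - b) / h n) * g t) \<longlonglongrightarrow> (indicator {a<..} t - indicator {b<..} t) * g t"
        by (intro tendsto_intros r)
      then show "(\<lambda>n. (ramp (h n) (t - a) / h n - ramp (h n) (t - b) / h n) * g t) \<longlonglongrightarrow> indicator {a<..b} t * g t"
        using ab by (auto simp: indicator_def split: if_splits)
    qed
    have rb: "0 \<le> ramp (h n) y / h n \<and> ramp (h n) y / h n \<le> 1" for n y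
      using hpos[of n] by (auto simp: ramp_def)
    show "AE t in Xi T. norm ((ramp (h n) (t - a) / h n - ramp (h n) (t - b) / h n) * g t) \<le> 2 * \<bar>g t\<bar>" for n
    proof (rule AE_I2)
      fix t
      have "\<bar>ramp (h n) (t - a) / h n - ramp (h n) (t - b) / h n\<bar> \<le> 2"
        using rb[of n "t - a"] rb[of n "t - b"] by linarith
      then show "norm ((ramp (h n) (t - a) / h n - ramp (h n) (t - b) / h n) * g t) \<le> 2 * \<bar>g t\<bar>"
        by (simp add: abs_mult mult_right_mono)
    qed
  qed (use g in auto)
  have E: "eventually (\<lambda>n. (\<integral>t. indicator {a<..a+h n} t * f t \<partial>Xi T) / h n - (\<integral>t. indicator {b<..b+h n} t * f t \<partial>Xi T) / h n
      = - (\<integral>t. (ramp (h n) (t - a) / h n - ramp (h n) (t - b) / h n) * g t \<partial>Xi T)) sequentially"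
  proof -
    have "eventually (\<lambda>n. h n < T - b) sequentially" using ab' by (intro order_tendstoD(2)[OF h0]) simp
    then show ?thesis
    proof eventually_elim
      case (elim n)
      have "(\<integral>t. (ramp (h n) (t - a) / h n - ramp (h n) (t - b) / h n) * g t \<partial>Xi T)
          = (\<integral>t. (ramp (h n) (t - a) - ramp (h n) (t - b)) * g t \<partial>Xi T) / h n"
        by (subst Bochner_Integration.integral_divide_zero[symmetric]) (simp add: diff_divide_distrib[symmetric])
      then show ?case
        using weak_derivative_ramp[OF f g weak ab'(1) ab hpos[of n]] elim
        by (simp add: diff_divide_distrib[symmetric])
    qed
  qed
  have "f a - f b = - (\<integral>t. indicator {a<..b} t * g t \<partial>Xi T)"
    by (rule LIMSEQ_unique[OF Lim_transform_eventually[OF A E] tendsto_minus[OF B]])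
  then show ?thesis by simp
qed

section \<open>Weak derivatives in a Gelfand triple\<close>

lemma test_function_integrable:
  assumes \<phi>: "test_function T \<phi>" and f: "integrable (Xi T) f"
  shows "integrable (Xi T) (\<lambda>t. \<phi> t * f t)" and "integrable (Xi T) (\<lambda>t. deriv \<phi> t * f t)"
proof -
  obtain K where K: "compact K" "\<And>t. t \<notin> K \<Longrightarrow> \<phi> t = 0" using \<phi> unfolding test_function_def by blast
  have sm: "smooth \<phi>" using \<phi> by (simp add: test_function_def smooth_def)
  have dK: "deriv \<phi> t = 0" if "t \<notin> K" for t
  proof -
    have "eventually (\<lambda>s. s \<in> - K) (nhds t)"
      using that K(1) by (intro eventually_nhds_in_open) (auto simp: compact_imp_closed open_Compl)
    then have "eventually (\<lambda>s. \<phi> s = 0) (nhds t)" by eventually_elim (simp add: K(2))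
    then have "(\<phi> has_real_derivative 0) (at t)"
      by (subst DERIV_cong_ev[OF refl _ refl, where g="\<lambda>_. 0"]) auto
    then show ?thesis by (rule DERIV_imp_deriv)
  qed
  have gen: "integrable (Xi T) (\<lambda>t. \<psi> t * f t)" if \<psi>: "continuous_on UNIV \<psi>" "\<And>t. t \<notin> K \<Longrightarrow> \<psi> t = 0" for \<psi> :: "real \<Rightarrow> real"
  proof -
    obtain B where B: "B \<ge> 0" "\<And>t. t \<in> K \<Longrightarrow> norm (\<psi> t) \<le> B"
      using continuous_on_compact_bound[OF K(1) continuous_on_subset[OF \<psi>(1)], of thesis] by auto
    note [measurable] = continuous_measurable_Xi[OF \<psi>(1)] borel_measurable_integrable[OF f]
    have b: "\<bar>\<psi> t\<bar> \<le> B" for t by (cases "t \<in> K") (use B \<psi>(2) in auto)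
    show ?thesis
      by (rule Bochner_Integration.integrable_bound[where f="\<lambda>t. B * f t"])
         (use f B(1) b in \<open>auto simp: abs_mult intro!: mult_right_mono\<close>)
  qed
  show "integrable (Xi T) (\<lambda>t. \<phi> t * f t)"
    using smooth_continuous[OF sm] K(2) by (rule gen)
  show "integrable (Xi T) (\<lambda>t. deriv \<phi> t * f t)"
    using smooth_continuous[OF smooth_deriv[OF sm]] dK by (rule gen)
qed

text \<open>Such an \<open>h\<close> is a weak derivative of zero, so its integrals over all intervals vanish, and with them its
averages.
\<close>

lemma null_of_test_functions:
  assumes h: "integrable (Xi T) h" and "\<And>\<phi>. test_function T \<phi> \<Longrightarrow> (\<integral>t. \<phi> t * h t \<partial>Xi T) = 0"
  shows "AE t in Xi T. h t = 0"
proof -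
  have zero: "right_average_point T (\<lambda>_. 0) a" if "0 < a" "a < T" for a
    using that by (simp add: right_average_point_def)
  have int0: "(\<integral>t. indicator {a<..b} t * h t \<partial>Xi T) = 0" if "0 < a" "a < b" "b < T" for a b
    using weak_derivative_increment[OF integrable_zero h _ zero zero, of a b] that assms(2) by simp
  show ?thesis using AE_right_average_point[OF h]
  proof eventually_elim
    case (elim x)
    then have x: "0 < x" "x < T" 
      and lim: "((\<lambda>r. (\<integral>t. indicator {x<..x+r} t * h t \<partial>Xi T) / r) \<longlongrightarrow> h x) (at_right 0)"
      by (auto simp: right_average_point_def)
    have "eventually (\<lambda>r. (\<integral>t. indicator {x<..x+r} t * h t \<partial>Xi T) / r = 0) (at_right 0)"
      using x by (intro eventually_at_rightI[of 0 "T - x"]) (auto simp: int0)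
    then have "((\<lambda>r. (\<integral>t. indicator {x<..x+r} t * h t \<partial>Xi T) / r) \<longlongrightarrow> 0) (at_right 0)"
      by (rule tendsto_eventually)
    with lim show ?case by (rule tendsto_unique[OF trivial_limit_at_right_real])
  qed
qed

lemma blinfun_abs_le:
  fixes f :: "'a::real_normed_vector \<Rightarrow>\<^sub>L real"
  shows "\<bar>blinfun_apply f x\<bar> \<le> norm f * norm x"
  using norm_blinfun[of f x] by simp

lemmas L2_duality = L2_bilinear[OF _ _ bounded_bilinear_blinfun_apply blinfun_abs_le]

lemmas L2_inner = L2_bilinear[OF _ _ bounded_bilinear_inner Cauchy_Schwarz_ineq2]

lemma L2_bounded_linear:
  assumes "bounded_linear j" and w: "w \<in> L2 T"
  shows "(\<lambda>t. j (w t)) \<in> L2 T"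
proof -
  obtain K where K: "\<And>x. norm (j x) \<le> norm x * K" 
    using bounded_linear.bounded[OF assms(1)] by blast
  show ?thesis
  proof (rule L2_bound)
    show "strongly_measurable (Xi T) (\<lambda>t. j (w t))"
      by (rule strongly_measurable_compose2[where h="\<lambda>x y. j x" and g="\<lambda>_. 0::real", OF _ strongly_measurable_const])
         (use w in \<open>auto simp: L2_def intro!: bounded_linear.continuous_on[OF assms(1)] continuous_intros\<close>)
    show "AE t in Xi T. norm (j (w t)) \<le> norm (w t) * K" using K by simp
    show "integrable (Xi T) (\<lambda>t. (norm (w t) * K)\<^sup>2)"
      using L2_integrable[OF w] by (simp add: power_mult_distrib)
  qed
qed

lemma bounded_linear_increment:
  fixes g :: "real \<Rightarrow> 'a::real_normed_vector \<Rightarrow>\<^sub>L real"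
  assumes g: "g \<in> L2 T"
  shows "bounded_linear (\<lambda>d. \<integral>t. indicator {a<..b} t * blinfun_apply (g t) d \<partial>Xi T)"
proof -
  have ig: "integrable (Xi T) (\<lambda>t. indicator {a<..b} t * blinfun_apply (g t) d)" for d
    by (intro integrable_indicator_Xi L2_duality(1)[OF g L2_const])
  show ?thesis
  proof (rule bounded_linear_intro)
    fix d e :: 'a and r :: real
    show "(\<integral>t. indicator {a<..b} t * blinfun_apply (g t) (d + e) \<partial>Xi T) =
      (\<integral>t. indicator {a<..b} t * blinfun_apply (g t) d \<partial>Xi T) + (\<integral>t. indicator {a<..b} t * blinfun_apply (g t) e \<partial>Xi T)"
      by (simp add: blinfun.add_right distrib_left ig)
    show "(\<integral>t. indicator {a<..b} t * blinfun_apply (g t) (r *\<^sub>R d) \<partial>Xi T) = r *\<^sub>R (\<integral>t. indicator {a<..b} t * blinfun_apply (g t) d \<partial>Xi T)"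
      by (simp add: blinfun.scaleR_right mult.left_commute)
    have "\<bar>\<integral>t. blinfun_apply (indicator {a<..b} t *\<^sub>R g t) d \<partial>Xi T\<bar> \<le> L2_norm T (\<lambda>t. indicator {a<..b} t *\<^sub>R g t) * L2_norm T (\<lambda>_. d)"
      by (rule L2_duality(2)[OF L2_indicator[OF g] L2_const])
    moreover have "L2_norm T (\<lambda>_. d) = norm d * L2_norm T (\<lambda>_. 1::real)"
      using L2_norm_scale[of T "norm d" "\<lambda>_. 1::real"] by (simp add: L2_norm_def)
    ultimately show "norm (\<integral>t. indicator {a<..b} t * blinfun_apply (g t) d \<partial>Xi T) \<le> norm d * (L2_norm T (\<lambda>_. 1::real) * L2_norm T (\<lambda>t. indicator {a<..b} t *\<^sub>R g t))"
      by (simp add: blinfun.scaleR_left mult_ac)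
  qed
qed

lemma has_weak_derivative_lincomb:
  assumes j: "bounded_linear j" and w: "w \<in> L2 T" "has_weak_derivative j T w g" and v: "v \<in> L2 T" "has_weak_derivative j T v k"
  shows "has_weak_derivative j T (\<lambda>t. a *\<^sub>R w t + b *\<^sub>R v t) (\<lambda>t. a *\<^sub>R g t + b *\<^sub>R k t)"
  unfolding has_weak_derivative_def
proof (intro conjI allI impI)
  have gk: "g \<in> L2 T" "k \<in> L2 T" using w v by (auto simp: has_weak_derivative_def)
  then show "(\<lambda>t. a *\<^sub>R g t + b *\<^sub>R k t) \<in> L2 T" by (intro L2_add L2_scale)
  fix \<phi> and d :: 'a assume \<phi>: "test_function T \<phi>"
  note I = test_function_integrable[OF \<phi>]
  note i1 = I(1)[OF L2_duality(1)[OF gk(1) L2_const, of d]] I(1)[OF L2_duality(1)[OF gk(2) L2_const, of d]]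
  note i2 = I(2)[OF L2_inner(1)[OF L2_bounded_linear[OF j w(1)] L2_const, of "j d"]]
     I(2)[OF L2_inner(1)[OF L2_bounded_linear[OF j v(1)] L2_const, of "j d"]]
  have e: "(\<integral>t. deriv \<phi> t * (j (w t) \<bullet> j d) \<partial>Xi T) = - (\<integral>t. \<phi> t * blinfun_apply (g t) d \<partial>Xi T)"
     "(\<integral>t. deriv \<phi> t * (j (v t) \<bullet> j d) \<partial>Xi T) = - (\<integral>t. \<phi> t * blinfun_apply (k t) d \<partial>Xi T)"
    using w v \<phi> by (auto simp: has_weak_derivative_def)
  have "(\<integral>t. deriv \<phi> t * (j (a *\<^sub>R w t + b *\<^sub>R v t) \<bullet> j d) \<partial>Xi T)
      = (\<integral>t. a * (deriv \<phi> t * (j (w t) \<bullet> j d)) + b * (deriv \<phi> t * (j (v t) \<bullet> j d)) \<partial>Xi T)"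
    by (intro Bochner_Integration.integral_cong refl) (simp add: linear_simps[OF j] inner_add_left algebra_simps)
  also have "\<dots> = - (\<integral>t. a * (\<phi> t * blinfun_apply (g t) d) + b * (\<phi> t * blinfun_apply (k t) d) \<partial>Xi T)"
    using i1 i2 e by simp
  also have "(\<integral>t. a * (\<phi> t * blinfun_apply (g t) d) + b * (\<phi> t * blinfun_apply (k t) d) \<partial>Xi T) = (\<integral>t. \<phi> t * blinfun_apply (a *\<^sub>R g t + b *\<^sub>R k t) d \<partial>Xi T)"
    by (intro Bochner_Integration.integral_cong refl) (simp add: blinfun.add_left blinfun.scaleR_left algebra_simps)
  finally show "(\<integral>t. deriv \<phi> t * (j (a *\<^sub>R w t + b *\<^sub>R v t) \<bullet> j d) \<partial>Xi T) = - (\<integral>t. \<phi> t * blinfun_apply (a *\<^sub>R g t + b *\<^sub>R k t) d \<partial>Xi T)" .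
qed

text \<open>Strong measurability replaces separability of the target space: almost all values lie in the closure
of one countable set, by which uncountably many null sets are reduced to countably many.
\<close>

lemma strongly_measurable_countable_values:
  assumes "strongly_measurable M v"
  obtains D where "countable D" "AE t in M. \<exists>s. (\<forall>i::nat. s i \<in> D) \<and> s \<longlonglongrightarrow> v t"
proof -
  obtain s where s: "\<And>i::nat. simple_function M (s i)" "AE t in M. (\<lambda>i. s i t) \<longlonglongrightarrow> v t"
    using assms unfolding strongly_measurable_def by blast
  define D where "D = (\<Union>i. s i ` space M)"
  have "countable D" unfolding D_def
    using s(1) by (intro countable_UN countableI_type countable_finite) (simp add: simple_function_def)
  moreover have "AE t in M. \<exists>s. (\<forall>i::nat. s i \<in> D) \<and> s \<longlonglongrightarrow> v t"
    using s(2) AE_space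
  proof eventually_elim
    case (elim t)
    then show ?case by (intro exI[of _ "\<lambda>i. s i t"]) (auto simp: D_def)
  qed
  ultimately show thesis by (rule that)
qed

lemma weak_derivative_unique:
  assumes j: "bounded_linear j" and w: "w \<in> L2 T" "has_weak_derivative j T w g" "has_weak_derivative j T w k"
    and v: "v \<in> L2 T"
  shows "(\<integral>t. blinfun_apply (g t) (v t) \<partial>Xi T) = (\<integral>t. blinfun_apply (k t) (v t) \<partial>Xi T)"
proof -
  have g: "g \<in> L2 T" and k: "k \<in> L2 T" using w by (auto simp: has_weak_derivative_def)
  obtain D where D: "countable D" "AE t in Xi T. \<exists>s. (\<forall>i::nat. s i \<in> D) \<and> s \<longlonglongrightarrow> v t"
    using strongly_measurable_countable_values[of "Xi T" v] v by (auto simp: L2_def)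
  have z: "AE t in Xi T. blinfun_apply (g t) d - blinfun_apply (k t) d = 0" for d
  proof (rule null_of_test_functions)
    note i = L2_duality(1)[OF g L2_const, of d] L2_duality(1)[OF k L2_const, of d]
    show "integrable (Xi T) (\<lambda>t. blinfun_apply (g t) d - blinfun_apply (k t) d)" using i by simp
    fix \<phi> assume \<phi>: "test_function T \<phi>"
    show "(\<integral>t. \<phi> t * (blinfun_apply (g t) d - blinfun_apply (k t) d) \<partial>Xi T) = 0"
      using w(2,3) \<phi> i[THEN test_function_integrable(1)[OF \<phi>]]
      by (simp add: has_weak_derivative_def right_diff_distrib)
  qed
  have "AE t in Xi T. \<forall>d\<in>D. blinfun_apply (g t) d - blinfun_apply (k t) d = 0"
    using D(1) z by (simp add: AE_ball_countable)
  then have "AE t in Xi T. blinfun_apply (g t) (v t) - blinfun_apply (k t) (v t) = 0"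
    using D(2)
  proof eventually_elim
    case (elim t)
    then obtain s where s: "\<And>i::nat. s i \<in> D" "s \<longlonglongrightarrow> v t" by blast
    have "(\<lambda>i. blinfun_apply (g t) (s i) - blinfun_apply (k t) (s i)) \<longlonglongrightarrow> blinfun_apply (g t) (v t) - blinfun_apply (k t) (v t)"
      by (intro tendsto_intros s(2))
    moreover have "(\<lambda>i. blinfun_apply (g t) (s i) - blinfun_apply (k t) (s i)) = (\<lambda>i. 0)"
      using elim(1) s(1) by auto
    ultimately show ?case using LIMSEQ_const_iff by metis
  qed
  then have "(\<integral>t. blinfun_apply (g t) (v t) - blinfun_apply (k t) (v t) \<partial>Xi T) = 0"
    by (rule integral_eq_zero_AE)
  then show ?thesis using L2_duality(1)[OF g v] L2_duality(1)[OF k v] by simp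
qed

lemma X_space_L2: "w \<in> X_space j T \<Longrightarrow> w \<in> L2 T" by (simp add: X_space_def)

lemma weak_derivative_X: "w \<in> X_space j T \<Longrightarrow> has_weak_derivative j T w (weak_derivative j T w)"
  unfolding X_space_def weak_derivative_def by (auto intro: someI[where P="has_weak_derivative j T w"])

lemma weak_derivative_L2: "w \<in> X_space j T \<Longrightarrow> weak_derivative j T w \<in> L2 T"
  using weak_derivative_X by (auto simp: has_weak_derivative_def)

lemma X_space_lincomb:
  assumes "bounded_linear j" "w \<in> X_space j T" "v \<in> X_space j T"
  shows "(\<lambda>t. a *\<^sub>R w t + b *\<^sub>R v t) \<in> X_space j T"
  using has_weak_derivative_lincomb[OF assms(1) X_space_L2[OF assms(2)] weak_derivative_X[OF assms(2)] X_space_L2[OF assms(3)] weak_derivative_X[OF assms(3)]]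
    assms(2,3)
  by (auto simp: X_space_def intro!: L2_add L2_scale)

lemma dt_lincomb:
  assumes "bounded_linear j" "w \<in> X_space j T" "v \<in> X_space j T" "z \<in> L2 T"
  shows "dt j T (\<lambda>t. a *\<^sub>R w t + b *\<^sub>R v t) z = a * dt j T w z + b * dt j T v z"
proof -
  note L = has_weak_derivative_lincomb[OF assms(1) X_space_L2[OF assms(2)] weak_derivative_X[OF assms(2)] X_space_L2[OF assms(3)] weak_derivative_X[OF assms(3)], of a b]
  have X: "(\<lambda>t. a *\<^sub>R w t + b *\<^sub>R v t) \<in> X_space j T" using X_space_lincomb[OF assms(1-3)] .
  show ?thesis
    unfolding dt_def weak_derivative_unique[OF assms(1) X_space_L2[OF X] weak_derivative_X[OF X] L assms(4)]
    using L2_duality(1)[OF weak_derivative_L2[OF assms(2)] assms(4)] L2_duality(1)[OF weak_derivative_L2[OF assms(3)] assms(4)]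
    by (simp add: blinfun.add_left blinfun.scaleR_left)
qed

lemma dt_dual:
  assumes w: "w \<in> X_space j T"
  shows "dt j T w \<in> dual (L2 T) (L2_norm T)"
proof -
  note g = weak_derivative_L2[OF w]
  show ?thesis
    unfolding dual_def linear_functional_on_def dt_def
    using L2_duality[OF g]
    by (auto simp: blinfun.add_right blinfun.scaleR_right)
qed

text \<open>The increment formula for a fixed vector \<open>d\<close> holds off a null set that depends on \<open>d\<close>. For \<open>d\<close> in a
countable set whose closure contains almost all values of \<open>w\<close> the null sets can be united, and
continuity in \<open>d\<close> then admits the vectors \<open>w s\<close> themselves.
\<close>

lemma weak_derivative_increment_at_values:
  assumes j: "bounded_linear j" and w: "w \<in> L2 T" "has_weak_derivative j T w g"
  obtains E where "AE t in Xi T. t \<in> E" "E \<subseteq> {0<..<T}"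
    "\<And>a b s. a \<in> E \<Longrightarrow> b \<in> E \<Longrightarrow> s \<in> E \<Longrightarrow> a < b \<Longrightarrow>
       (j (w b) - j (w a)) \<bullet> j (w s) = (\<integral>t. indicator {a<..b} t * blinfun_apply (g t) (w s) \<partial>Xi T)"
proof -
  have g: "g \<in> L2 T" using w by (auto simp: has_weak_derivative_def)
  obtain D where D: "countable D" "AE t in Xi T. \<exists>s. (\<forall>i::nat. s i \<in> D) \<and> s \<longlonglongrightarrow> w t"
    using strongly_measurable_countable_values[of "Xi T" w] w by (auto simp: L2_def)
  define E where "E = {t \<in> {0<..<T}. (\<forall>d\<in>D. right_average_point T (\<lambda>t. j (w t) \<bullet> j d) t) \<and> (\<exists>s. (\<forall>i::nat. s i \<in> D) \<and> s \<longlonglongrightarrow> w t)}"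
  have f: "integrable (Xi T) (\<lambda>t. j (w t) \<bullet> j d)" for d
    by (rule L2_inner(1)[OF L2_bounded_linear[OF j w(1)] L2_const])
  have inc: "(j (w b) - j (w a)) \<bullet> j d = (\<integral>t. indicator {a<..b} t * blinfun_apply (g t) d \<partial>Xi T)"
    if "a \<in> E" "b \<in> E" "d \<in> D" "a < b" for a b d
    using weak_derivative_increment[OF f[of d] L2_duality(1)[OF g L2_const, of d], of a b] w(2) that
    by (auto simp: has_weak_derivative_def E_def inner_diff_left)
  show thesis
  proof (rule that)
    have "AE t in Xi T. \<forall>d\<in>D. right_average_point T (\<lambda>t. j (w t) \<bullet> j d) t"
      using D(1) AE_right_average_point[OF f] by (simp add: AE_ball_countable)
    then show "AE t in Xi T. t \<in> E"
      using D(2) AE_space[of "Xi T"] by eventually_elim (auto simp: E_def)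
    show "E \<subseteq> {0<..<T}" by (auto simp: E_def)
    fix a b s assume abs: "a \<in> E" "b \<in> E" "s \<in> E" "a < b"
    then obtain r where r: "\<And>i::nat. r i \<in> D" "r \<longlonglongrightarrow> w s" by (auto simp: E_def)
    have "(\<lambda>i. (j (w b) - j (w a)) \<bullet> j (r i)) \<longlonglongrightarrow> (j (w b) - j (w a)) \<bullet> j (w s)"
      by (intro tendsto_intros bounded_linear.tendsto[OF j] r(2))
    moreover have "(\<lambda>i. (j (w b) - j (w a)) \<bullet> j (r i)) \<longlonglongrightarrow> (\<integral>t. indicator {a<..b} t * blinfun_apply (g t) (w s) \<partial>Xi T)"
      using bounded_linear.tendsto[OF bounded_linear_increment[OF g, of a b] r(2)]
      by (simp add: inc[OF abs(1,2) r(1) abs(4)])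
    ultimately show "(j (w b) - j (w a)) \<bullet> j (w s) = (\<integral>t. indicator {a<..b} t * blinfun_apply (g t) (w s) \<partial>Xi T)"
      by (rule LIMSEQ_unique)
  qed
qed

section \<open>Density of continuous functions\<close>

lemma strongly_measurable_borel_real:
  fixes f :: "'a \<Rightarrow> real"
  assumes "f \<in> borel_measurable M"
  shows "strongly_measurable M f"
  using borel_measurable_implies_sequence_metric[OF assms, of 0]
  unfolding strongly_measurable_def by (auto intro!: AE_I2)

lemma L2_norm_cong: "(\<And>t. t \<in> {0<..<T} \<Longrightarrow> f t = g t) \<Longrightarrow> L2_norm T f = L2_norm T g"
  unfolding L2_norm_def by (intro arg_cong[where f=sqrt] Bochner_Integration.integral_cong) auto

lemma L2_norm_limit:
  assumes "\<And>n. f n \<in> L2 T" and "integrable (Xi T) h"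
    and lim: "AE t in Xi T. (\<lambda>n. f n t) \<longlonglongrightarrow> 0" and bd: "\<And>n. AE t in Xi T. (norm (f n t))\<^sup>2 \<le> h t"
  shows "(\<lambda>n. L2_norm T (f n)) \<longlonglongrightarrow> 0"
proof -
  have "(\<lambda>n. \<integral>t. (norm (f n t))\<^sup>2 \<partial>Xi T) \<longlonglongrightarrow> (\<integral>t. 0 \<partial>Xi T)"
  proof (rule integral_dominated_convergence[where w=h])
    show "AE t in Xi T. (\<lambda>n. (norm (f n t))\<^sup>2) \<longlonglongrightarrow> 0"
      using lim
    proof eventually_elim
      case (elim t)
      have "(\<lambda>n. (norm (f n t))\<^sup>2) \<longlonglongrightarrow> (norm (0::'a))\<^sup>2" by (intro tendsto_intros elim)
      then show ?case by simp
    qed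
  qed (use assms(2) bd L2_integrable[OF assms(1)] in auto)
  then have "(\<lambda>n. sqrt (\<integral>t. (norm (f n t))\<^sup>2 \<partial>Xi T)) \<longlonglongrightarrow> sqrt 0" by (intro tendsto_real_sqrt) simp
  then show ?thesis by (simp add: L2_norm_def)
qed

text \<open>The simple functions of the definition of strong measurability are cut off where they exceed
\<open>2 \<parallel>w t\<parallel>\<close>. This keeps them simple and preserves convergence, and it supplies a dominating function.
\<close>

lemma simple_functions_dense_L2:
  assumes w: "w \<in> L2 T" and e: "e > 0"
  obtains s where "simple_function (Xi T) s" "s \<in> L2 T" "L2_norm T (\<lambda>t. w t - s t) < e"
proof -
  obtain s where s: "\<And>i::nat. simple_function (Xi T) (s i)" "AE t in Xi T. (\<lambda>i. s i t) \<longlonglongrightarrow> w t"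
    using w unfolding L2_def strongly_measurable_def by blast
  define r where "r i t = (if norm (s i t) \<le> 2 * norm (w t) then s i t else 0)" for i t
  note [measurable] = L2_norm_measurable[OF w]
  have r: "simple_function (Xi T) (r i)" for i
  proof -
    have [measurable]: "(\<lambda>t. norm (s i t)) \<in> borel_measurable (Xi T)"
      using simple_function_compose1[OF s(1), of norm] by (rule borel_measurable_simple_function)
    have "{t \<in> space (Xi T). norm (s i t) \<le> 2 * norm (w t)} \<in> sets (Xi T)" by measurable
    then show ?thesis unfolding r_def by (rule simple_function_If[OF s(1) simple_function_const])
  qed
  have bound: "norm (r i t) \<le> 2 * norm (w t)" for i t by (simp add: r_def)
  have lim: "AE t in Xi T. (\<lambda>i. r i t) \<longlonglongrightarrow> w t"
    using s(2)
  proof eventually_elim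
    case (elim t)
    show ?case
    proof (cases "w t = 0")
      case True then show ?thesis using bound[of _ t] by simp
    next
      case False
      then have "eventually (\<lambda>i. norm (s i t) < 2 * norm (w t)) sequentially"
        by (intro order_tendstoD(2)[OF tendsto_norm[OF elim]]) simp
      then have "eventually (\<lambda>i. s i t = r i t) sequentially"
        by eventually_elim (simp add: r_def)
      with elim show ?thesis by (rule Lim_transform_eventually)
    qed
  qed
  have rL: "r i \<in> L2 T" for i
  proof (rule L2_bound)
    show "strongly_measurable (Xi T) (r i)"
      unfolding strongly_measurable_def by (intro exI[of _ "\<lambda>_. r i"]) (auto simp: r)
    show "integrable (Xi T) (\<lambda>t. (2 * norm (w t))\<^sup>2)"
      using L2_integrable[OF w] by (simp add: power_mult_distrib)
  qed (simp add: bound)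
  have "(\<lambda>i. L2_norm T (\<lambda>t. w t - r i t)) \<longlonglongrightarrow> 0"
  proof (rule L2_norm_limit)
    show "(\<lambda>t. w t - r i t) \<in> L2 T" for i by (rule L2_diff[OF w rL])
    show "integrable (Xi T) (\<lambda>t. 9 * (norm (w t))\<^sup>2)" using L2_integrable[OF w] by simp
    show "AE t in Xi T. (\<lambda>n. w t - r n t) \<longlonglongrightarrow> 0"
      using lim
    proof eventually_elim
      case (elim t)
      from tendsto_diff[OF tendsto_const[of "w t"] this] show ?case by simp
    qed
    show "AE t in Xi T. (norm (w t - r n t))\<^sup>2 \<le> 9 * (norm (w t))\<^sup>2" for n
    proof (rule AE_I2)
      fix t
      have "norm (w t - r n t) \<le> 3 * norm (w t)" using bound[of n t] norm_triangle_ineq4[of "w t" "r n t"] by linarith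
      from power_mono[OF this, of 2] show "(norm (w t - r n t))\<^sup>2 \<le> 9 * (norm (w t))\<^sup>2"
        by (simp add: power_mult_distrib)
    qed
  qed
  then have "eventually (\<lambda>i. L2_norm T (\<lambda>t. w t - r i t) < e) sequentially"
    using e by (rule order_tendstoD(2))
  then obtain i where "L2_norm T (\<lambda>t. w t - r i t) < e" by (auto simp: eventually_sequentially)
  then show thesis using r rL that by blast
qed

definition continuously_approximable :: "real \<Rightarrow> (real \<Rightarrow> 'b::real_normed_vector) \<Rightarrow> bool" where
  "continuously_approximable T w \<longleftrightarrow>
     (\<forall>e>0. \<exists>\<sigma>. continuous_on UNIV \<sigma> \<and> \<sigma> \<in> L2 T \<and> L2_norm T (\<lambda>t. w t - \<sigma> t) < e)"

text \<open>A measurable indicator function is an almost everywhere limit of continuous functions, which may be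
clipped to \<open>[0, 1]\<close>.
\<close>

lemma continuously_approximable_indicator:
  assumes A: "A \<in> sets (Xi T)"
  shows "continuously_approximable T (\<lambda>t. indicator A t *\<^sub>R v)"
proof -
  have A': "A \<in> sets lebesgue" using A by (auto simp: Xi_def sets_restrict_space)
  have "(indicator A :: real \<Rightarrow> real) \<in> borel_measurable lebesgue" using A' by simp
  then have "(indicator A :: real \<Rightarrow> real) measurable_on UNIV"
    by (rule lebesgue_measurable_imp_measurable_on) (use sets.top[of "lebesgue :: real measure"] in simp)
  then obtain N g where N: "negligible N" and g: "\<And>n. continuous_on UNIV (g n)"
    "\<And>x. x \<notin> N \<Longrightarrow> (\<lambda>n. g n x) \<longlonglongrightarrow> (indicator A x :: real)"
    unfolding measurable_on_def by auto
  define c where "c n x = max 0 (min 1 (g n x))" for n x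
  have c: "continuous_on UNIV (c n)" for n unfolding c_def by (intro continuous_intros g)
  have cb: "0 \<le> c n x \<and> c n x \<le> 1" for n x by (simp add: c_def)
  have clim: "(\<lambda>n. c n x) \<longlonglongrightarrow> indicator A x" if "x \<notin> N" for x
  proof -
    have "(\<lambda>n. c n x) \<longlonglongrightarrow> max 0 (min 1 (indicator A x))"
      unfolding c_def by (intro tendsto_intros g that)
    then show ?thesis by (simp add: indicator_def split: if_splits)
  qed
  have bounded_L2: "(\<lambda>t. f t *\<^sub>R v) \<in> L2 T" if "f \<in> borel_measurable (Xi T)" "\<And>t. \<bar>f t\<bar> \<le> 1" for f :: "real \<Rightarrow> real"
  proof (rule L2_bound)
    show "strongly_measurable (Xi T) (\<lambda>t. f t *\<^sub>R v)"
      by (rule strongly_measurable_compose2[where h="\<lambda>x y. x *\<^sub>R y", OF strongly_measurable_borel_real[OF that(1)] strongly_measurable_const])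
         (auto intro!: continuous_intros)
    show "integrable (Xi T) (\<lambda>t. (norm v)\<^sup>2)" by simp
    show "AE t in Xi T. norm (f t *\<^sub>R v) \<le> norm v"
      using that(2) by (auto intro!: AE_I2 mult_left_le_one_le)
  qed
  have AE: "AE t in Xi T. t \<notin> N"
    unfolding Xi_def using N by (subst AE_restrict_space_iff) (auto simp: negligible_iff_null_sets elim: eventually_mono[OF AE_not_in])
  have indL: "(\<lambda>t. indicator A t *\<^sub>R v) \<in> L2 T"
    by (rule bounded_L2) (use A in \<open>auto simp: indicator_def\<close>)
  have cL: "(\<lambda>t. c n t *\<^sub>R v) \<in> L2 T" for n
    by (rule bounded_L2[OF continuous_measurable_Xi[OF c]]) (use cb in \<open>simp add: abs_le_iff\<close>)
  have "(\<lambda>n. L2_norm T (\<lambda>t. indicator A t *\<^sub>R v - c n t *\<^sub>R v)) \<longlonglongrightarrow> 0"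
  proof (rule L2_norm_limit)
    show "integrable (Xi T) (\<lambda>t. (norm v)\<^sup>2)" by simp
    show "AE t in Xi T. (\<lambda>n. indicator A t *\<^sub>R v - c n t *\<^sub>R v) \<longlonglongrightarrow> 0"
      using AE
    proof eventually_elim
      case (elim t)
      have "(\<lambda>n. indicator A t *\<^sub>R v - c n t *\<^sub>R v) \<longlonglongrightarrow> indicator A t *\<^sub>R v - indicator A t *\<^sub>R v"
        by (intro tendsto_intros clim elim)
      then show ?case by simp
    qed
    show "AE t in Xi T. (norm (indicator A t *\<^sub>R v - c n t *\<^sub>R v))\<^sup>2 \<le> (norm v)\<^sup>2" for n
    proof (intro AE_I2 power_mono)
      fix t
      have "\<bar>indicator A t - c n t\<bar> \<le> 1" using cb[of n t] by (auto simp: indicator_def)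
      then show "norm (indicator A t *\<^sub>R v - c n t *\<^sub>R v) \<le> norm v"
        by (simp add: scaleR_diff_left[symmetric] mult_left_le_one_le)
    qed simp
  qed (rule L2_diff[OF indL cL])
  then show ?thesis
    unfolding continuously_approximable_def
  proof (intro allI impI)
    fix e :: real assume "e > 0"
    with \<open>_ \<longlonglongrightarrow> 0\<close> have "eventually (\<lambda>n. L2_norm T (\<lambda>t. indicator A t *\<^sub>R v - c n t *\<^sub>R v) < e) sequentially"
      by (rule order_tendstoD(2))
    then obtain n where "L2_norm T (\<lambda>t. indicator A t *\<^sub>R v - c n t *\<^sub>R v) < e" by (auto simp: eventually_sequentially)
    then show "\<exists>\<sigma>. continuous_on UNIV \<sigma> \<and> \<sigma> \<in> L2 T \<and> L2_norm T (\<lambda>t. indicator A t *\<^sub>R v - \<sigma> t) < e"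
      using cL[of n] by (intro exI[of _ "\<lambda>t. c n t *\<^sub>R v"]) (auto intro!: continuous_intros c)
  qed
qed

lemma continuously_approximable_near:
  assumes "w \<in> L2 T" and near: "\<And>e. e > 0 \<Longrightarrow> \<exists>s. continuously_approximable T s \<and> s \<in> L2 T \<and> L2_norm T (\<lambda>t. w t - s t) < e"
  shows "continuously_approximable T w"
  unfolding continuously_approximable_def
proof (intro allI impI)
  fix e :: real assume e: "e > 0"
  obtain s where s: "continuously_approximable T s" "s \<in> L2 T" "L2_norm T (\<lambda>t. w t - s t) < e / 2"
    using near[of "e/2"] e by auto
  obtain \<sigma> where \<sigma>: "continuous_on UNIV \<sigma>" "\<sigma> \<in> L2 T" "L2_norm T (\<lambda>t. s t - \<sigma> t) < e / 2"
    using s(1) e unfolding continuously_approximable_def by (meson half_gt_zero)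
  have "L2_norm T (\<lambda>t. w t - \<sigma> t) \<le> L2_norm T (\<lambda>t. w t - s t) + L2_norm T (\<lambda>t. s t - \<sigma> t)"
    using L2_norm_triangle[OF L2_diff[OF assms(1) s(2)] L2_diff[OF s(2) \<sigma>(2)]] by simp
  then show "\<exists>\<sigma>. continuous_on UNIV \<sigma> \<and> \<sigma> \<in> L2 T \<and> L2_norm T (\<lambda>t. w t - \<sigma> t) < e"
    using s(3) \<sigma> by (intro exI[of _ \<sigma>]) auto
qed

lemma continuously_approximable_add:
  assumes "w \<in> L2 T" "v \<in> L2 T" "continuously_approximable T w" "continuously_approximable T v"
  shows "continuously_approximable T (\<lambda>t. w t + v t)"
  unfolding continuously_approximable_def
proof (intro allI impI)
  fix e :: real assume e: "e > 0"
  obtain \<sigma> where \<sigma>: "continuous_on UNIV \<sigma>" "\<sigma> \<in> L2 T" "L2_norm T (\<lambda>t. w t - \<sigma> t) < e / 2"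
    using assms(3) e unfolding continuously_approximable_def by (meson half_gt_zero)
  obtain \<tau> where \<tau>: "continuous_on UNIV \<tau>" "\<tau> \<in> L2 T" "L2_norm T (\<lambda>t. v t - \<tau> t) < e / 2"
    using assms(4) e unfolding continuously_approximable_def by (meson half_gt_zero)
  have "L2_norm T (\<lambda>t. w t + v t - (\<sigma> t + \<tau> t)) \<le> L2_norm T (\<lambda>t. w t - \<sigma> t) + L2_norm T (\<lambda>t. v t - \<tau> t)"
    using L2_norm_triangle[OF L2_diff[OF assms(1) \<sigma>(2)] L2_diff[OF assms(2) \<tau>(2)]] by (simp add: algebra_simps)
  then show "\<exists>\<sigma>. continuous_on UNIV \<sigma> \<and> \<sigma> \<in> L2 T \<and> L2_norm T (\<lambda>t. w t + v t - \<sigma> t) < e"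
    using \<sigma> \<tau> by (intro exI[of _ "\<lambda>t. \<sigma> t + \<tau> t"]) (auto intro!: continuous_intros L2_add)
qed

text \<open>On \<open>(0, T)\<close> a simple function is a finite sum of vectors times indicator functions of its level sets.
\<close>

lemma continuous_dense_L2:
  fixes w :: "real \<Rightarrow> 'b::real_normed_vector"
  assumes w: "w \<in> L2 T"
  shows "continuously_approximable T w"
proof (rule continuously_approximable_near[OF w])
  fix e :: real assume "e > 0"
  then obtain s where s: "simple_function (Xi T) s" "s \<in> L2 T" "L2_norm T (\<lambda>t. w t - s t) < e"
    using simple_functions_dense_L2[OF w] by blast
  define r where "r F t = (\<Sum>y\<in>F. indicator (s -` {y} \<inter> {0<..<T}) t *\<^sub>R y)" for F t
  have sets: "s -` {y} \<inter> {0<..<T} \<in> sets (Xi T)" for y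
    using simple_functionD(2)[OF s(1), of "{y}"] by simp
  have indL: "(\<lambda>t. indicator (s -` {y} \<inter> {0<..<T}) t *\<^sub>R y) \<in> L2 T" for y
  proof (rule L2_bound)
    have "(indicator (s -` {y} \<inter> {0<..<T}) :: real \<Rightarrow> real) \<in> borel_measurable (Xi T)" using sets by simp
    from strongly_measurable_borel_real[OF this]
    show "strongly_measurable (Xi T) (\<lambda>t. indicator (s -` {y} \<inter> {0<..<T}) t *\<^sub>R y)"
      by (rule strongly_measurable_compose2[where h="\<lambda>x y. x *\<^sub>R y", OF _ strongly_measurable_const])
         (auto intro!: continuous_intros)
    show "integrable (Xi T) (\<lambda>t. (norm y)\<^sup>2)" by simp
  qed (auto simp: indicator_def)
  have r: "continuously_approximable T (r F) \<and> r F \<in> L2 T" if "finite F" for F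
    using that
  proof (induction F rule: finite_induct)
    case empty
    show ?case unfolding r_def
      by (auto simp: continuously_approximable_def L2_const L2_norm_def intro!: exI[of _ "\<lambda>_. 0"])
  next
    case (insert y F)
    have "r (insert y F) = (\<lambda>t. indicator (s -` {y} \<inter> {0<..<T}) t *\<^sub>R y + r F t)"
      using insert.hyps by (intro ext) (unfold r_def, rule sum.insert)
    then show ?case
      using insert.IH continuously_approximable_add[OF indL _ continuously_approximable_indicator[OF sets]] L2_add[OF indL] by simp
  qed
  have fin: "finite (s ` {0<..<T})" using simple_functionD(1)[OF s(1)] by simp
  have "r (s ` {0<..<T}) t = s t" if "t \<in> {0<..<T}" for t
  proof -
    have "r (s ` {0<..<T}) t = (\<Sum>y\<in>s ` {0<..<T}. if y = s t then y else 0)"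
      unfolding r_def using that by (intro sum.cong) (auto simp: indicator_def)
    also have "\<dots> = s t" using fin that by (simp add: sum.delta')
    finally show ?thesis .
  qed
  then have "L2_norm T (\<lambda>t. w t - r (s ` {0<..<T}) t) = L2_norm T (\<lambda>t. w t - s t)"
    by (intro L2_norm_cong) simp
  then show "\<exists>s. continuously_approximable T s \<and> s \<in> L2 T \<and> L2_norm T (\<lambda>t. w t - s t) < e"
    using r[OF fin] s(3) by (intro exI[of _ "r (s ` {0<..<T})"]) auto
qed

section \<open>The energy identity between good points\<close>

text \<open>A null set contains no interval.
\<close>

lemma AE_Xi_dense:
  assumes P: "AE t in Xi T. P t" and pq: "0 \<le> p" "p < q" "q \<le> T"
  obtains t where "p < t" "t < q" "P t"
proof -
  obtain N where N: "{t \<in> {0<..<T}. \<not> P t} \<subseteq> N" "N \<in> null_sets (Xi T)"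
    using P by (auto elim!: AE_E simp: null_sets_def)
  have N0: "N \<in> null_sets lebesgue"
    using N(2) unfolding Xi_def by (subst (asm) null_sets_restrict_space) auto
  have "\<not> {p<..<q} \<subseteq> N"
  proof
    assume "{p<..<q} \<subseteq> N"
    then have "{p<..<q} \<in> null_sets lebesgue" using N0 by (rule completion.complete2)
    then show False using pq by (simp add: null_sets_def)
  qed
  then obtain t where t: "t \<in> {p<..<q}" "t \<notin> N" by blast
  have "t \<in> {0<..<T}" using t(1) pq by simp
  then have "P t" using N(1) t(2) by blast
  then show thesis using t that by auto
qed

lemma AE_Xi_neq: "AE t in Xi T. t \<noteq> x"
proof -
  have "AE t in lebesgue. t \<notin> {x}" by (rule AE_not_in) simp
  then show ?thesis unfolding Xi_def by (subst AE_restrict_space_iff) (auto elim: eventually_mono)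
qed

lemma integral_interval_split:
  fixes f :: "real \<Rightarrow> real"
  assumes f: "integrable (Xi T) f" and "p \<le> q" "q \<le> r"
  shows "(\<integral>t. indicator {p<..r} t * f t \<partial>Xi T) = (\<integral>t. indicator {p<..q} t * f t \<partial>Xi T) + (\<integral>t. indicator {q<..r} t * f t \<partial>Xi T)"
proof -
  have "(\<integral>t. indicator {p<..r} t * f t \<partial>Xi T) = (\<integral>t. indicator {p<..q} t * f t + indicator {q<..r} t * f t \<partial>Xi T)"
    using assms(2,3) by (intro Bochner_Integration.integral_cong) (auto simp: indicator_def)
  then show ?thesis using integrable_indicator_Xi[OF f] by simp
qed

lemma continuous_indefinite_integral:
  fixes f :: "real \<Rightarrow> real"
  assumes f: "integrable (Xi T) f"
  shows "continuous_on UNIV (\<lambda>x. \<integral>t. indicator {0<..x} t * f t \<partial>Xi T)"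
proof -
  note [measurable] = borel_measurable_integrable[OF f]
  have "isCont (\<lambda>x. \<integral>t. indicator {0<..x} t * f t \<partial>Xi T) x" for x
    unfolding continuous_at_sequentially comp_def
  proof (intro allI impI)
    fix y assume y: "y \<longlonglongrightarrow> x"
    show "(\<lambda>n. \<integral>t. indicator {0<..y n} t * f t \<partial>Xi T) \<longlonglongrightarrow> (\<integral>t. indicator {0<..x} t * f t \<partial>Xi T)"
    proof (rule integral_dominated_convergence[where w="\<lambda>t. \<bar>f t\<bar>"])
      show "AE t in Xi T. (\<lambda>n. indicator {0<..y n} t * f t) \<longlonglongrightarrow> indicator {0<..x} t * f t"
        using AE_Xi_neq[of x T]
      proof eventually_elim
        case (elim t)
        have "eventually (\<lambda>n. indicator {0<..y n} t * f t = indicator {0<..x} t * f t) sequentially"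
        proof (cases "t < x")
          case True
          from order_tendstoD(1)[OF y this] show ?thesis
            by eventually_elim (use True in \<open>auto simp: indicator_def\<close>)
        next
          case False
          then have "x < t" using elim by simp
          from order_tendstoD(2)[OF y this] show ?thesis
            by eventually_elim (use False elim in \<open>auto simp: indicator_def\<close>)
        qed
        then show ?case by (rule tendsto_eventually)
      qed
      show "AE t in Xi T. norm (indicator {0<..y n} t * f t) \<le> \<bar>f t\<bar>" for n
        by (auto simp: indicator_def)
    qed (use f in auto)
  qed
  then show ?thesis by (simp add: continuous_on_eq_continuous_at)
qed

lemma measure_interval_Xi:
  assumes pq: "0 \<le> p" "p \<le> q" "q \<le> T"
  shows "(\<integral>t. indicator {p<..q} t * 1 \<partial>Xi T) = q - p"
proof -
  have "(\<integral>t. indicator {p<..q} t * (1::real) \<partial>Xi T) = (\<integral>t. indicator {0<..<T} t *\<^sub>R indicator {p<..q} t \<partial>lebesgue)"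
    unfolding Xi_def by (subst integral_restrict_space) auto
  also have "\<dots> = (\<integral>t. (indicator ({0<..<T} \<inter> {p<..q}) t :: real) \<partial>lebesgue)"
    by (simp add: indicator_inter_arith)
  also have "\<dots> = measure lebesgue ({0<..<T} \<inter> {p<..q})" by simp
  also have "\<dots> = measure lebesgue {p<..<q}"
  proof (rule measure_eq_AE)
    have "AE t in lebesgue. t \<noteq> q" using AE_not_in[of "{q}" lebesgue] by simp
    then show "AE t in lebesgue. t \<in> {0<..<T} \<inter> {p<..q} \<longleftrightarrow> t \<in> {p<..<q}"
      by eventually_elim (use pq in auto)
  qed auto
  finally show ?thesis using pq by simp
qed

text \<open>This selects the nodes of the partitions below. If \<open>f\<close> exceeded its average at almost every point of
the interval, the integral of the difference, which is zero, would be positive.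
\<close>

lemma point_below_average:
  fixes f :: "real \<Rightarrow> real"
  assumes P: "AE t in Xi T. P t" and f: "integrable (Xi T) f" and pq: "0 \<le> p" "p < q" "q \<le> T"
  obtains x where "p < x" "x < q" "P x" "(q - p) * f x \<le> (\<integral>t. indicator {p<..q} t * f t \<partial>Xi T)"
proof -
  define c where "c = (\<integral>t. indicator {p<..q} t * f t \<partial>Xi T)"
  define h where "h t = indicator {p<..q} t * ((q - p) * f t - c)" for t
  have hI: "integrable (Xi T) h"
    unfolding h_def by (intro integrable_indicator_Xi Bochner_Integration.integrable_diff) (use f in auto)
  have one: "(\<integral>t. indicator {p<..q} t * 1 \<partial>Xi T) = q - p"
    by (rule measure_interval_Xi) (use pq in auto)
  have "(\<integral>t. h t \<partial>Xi T) = (\<integral>t. (q - p) * (indicator {p<..q} t * f t) - c * (indicator {p<..q} t * 1) \<partial>Xi T)"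
    by (intro Bochner_Integration.integral_cong) (auto simp: h_def algebra_simps)
  also have "\<dots> = (q - p) * c - c * (q - p)"
    using integrable_indicator_Xi[OF f, of p q] integrable_indicator_Xi[OF integrable_const_Xi[of T 1], of p q] one
    by (simp add: c_def)
  finally have h0: "(\<integral>t. h t \<partial>Xi T) = 0" by simp
  have "\<exists>x. p < x \<and> x < q \<and> P x \<and> (q - p) * f x \<le> c"
  proof (rule ccontr)
    assume neg: "\<not> ?thesis"
    have "AE t in Xi T. 0 \<le> h t"
      using P AE_Xi_neq[of q T] by eventually_elim (use neg in \<open>force simp: h_def indicator_def\<close>)
    with h0 hI have "AE t in Xi T. h t = 0" by (simp add: integral_nonneg_eq_0_iff_AE)
    with P have "AE t in Xi T. P t \<and> h t = 0" by eventually_elim simp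
    then obtain t where "p < t" "t < q" "P t \<and> h t = 0" by (rule AE_Xi_dense[OF _ pq])
    then show False using neg by (auto simp: h_def)
  qed
  then show thesis using that by (auto simp: c_def)
qed

text \<open>Let \<open>\<Phi>\<close> be the difference between \<open>\<parallel>j (w t)\<parallel>\<^sup>2\<close> and twice the integral of \<open>g r (w r)\<close> over \<open>(0, t]\<close>. Its
increment over a short interval is the error of a trapezoidal rule and involves only the differences
of \<open>w\<close> inside the interval to \<open>w\<close> at the two ends. These are small when \<open>w\<close> is close to a uniformly
continuous function at the nodes and in the mean in between.
\<close>

lemma energy_increment:
  assumes j: "bounded_linear j" and w: "w \<in> L2 T" and g: "g \<in> L2 T"
    and E: "AE t in Xi T. t \<in> E" "E \<subseteq> {0<..<T}"
    and inc: "\<And>a b s. a \<in> E \<Longrightarrow> b \<in> E \<Longrightarrow> s \<in> E \<Longrightarrow> a < b \<Longrightarrow>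
       (j (w b) - j (w a)) \<bullet> j (w s) = (\<integral>t. indicator {a<..b} t * blinfun_apply (g t) (w s) \<partial>Xi T)"
    and ab: "a \<in> E" "b \<in> E" "a < b"
  shows "(norm (j (w b)))\<^sup>2 - (norm (j (w a)))\<^sup>2 = 2 * (\<integral>t. indicator {a<..b} t * blinfun_apply (g t) (w t) \<partial>Xi T)"
proof -
  define \<Phi> where "\<Phi> t = (norm (j (w t)))\<^sup>2 - 2 * (\<integral>r. indicator {0<..t} r * blinfun_apply (g r) (w r) \<partial>Xi T)" for t
  have gw: "integrable (Xi T) (\<lambda>r. blinfun_apply (g r) (w r))" by (rule L2_duality(1)[OF g w])
  have gc: "integrable (Xi T) (\<lambda>r. blinfun_apply (g r) c)" for c by (rule L2_duality(1)[OF g L2_const])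
  have Epos: "0 < x" "x < T" if "x \<in> E" for x using E(2) that by auto
  \<comment> \<open>the factor \<open>j (w y) + j (w x)\<close> of the difference of squares is a sum of values of \<open>j \<circ> w\<close>, to which \<open>inc\<close> applies\<close>
  have loc: "\<Phi> y - \<Phi> x = (\<integral>t. indicator {x<..y} t * (blinfun_apply (g t) (w y - w t) + blinfun_apply (g t) (w x - w t)) \<partial>Xi T)"
    if "x \<in> E" "y \<in> E" "x < y" for x y
  proof -
    have "(norm (j (w y)))\<^sup>2 - (norm (j (w x)))\<^sup>2 = (j (w y) - j (w x)) \<bullet> j (w y) + (j (w y) - j (w x)) \<bullet> j (w x)"
      by (simp add: power2_norm_eq_inner inner_diff_left inner_diff_right inner_commute)
    also have "\<dots> = (\<integral>t. indicator {x<..y} t * blinfun_apply (g t) (w y) \<partial>Xi T) + (\<integral>t. indicator {x<..y} t * blinfun_apply (g t) (w x) \<partial>Xi T)"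
      using inc that by simp
    finally have 1: "(norm (j (w y)))\<^sup>2 - (norm (j (w x)))\<^sup>2 = \<dots>" .
    have 2: "(\<integral>r. indicator {0<..y} r * blinfun_apply (g r) (w r) \<partial>Xi T) - (\<integral>r. indicator {0<..x} r * blinfun_apply (g r) (w r) \<partial>Xi T)
       = (\<integral>r. indicator {x<..y} r * blinfun_apply (g r) (w r) \<partial>Xi T)"
      using integral_interval_split[OF gw, of 0 x y] that Epos[OF that(1)] by simp
    have "(\<integral>t. indicator {x<..y} t * (blinfun_apply (g t) (w y - w t) + blinfun_apply (g t) (w x - w t)) \<partial>Xi T)
      = (\<integral>t. indicator {x<..y} t * blinfun_apply (g t) (w y) + indicator {x<..y} t * blinfun_apply (g t) (w x) - 2 * (indicator {x<..y} t * blinfun_apply (g t) (w t)) \<partial>Xi T)"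
      by (intro Bochner_Integration.integral_cong) (auto simp: blinfun.diff_right algebra_simps)
    also have "\<dots> = (\<integral>t. indicator {x<..y} t * blinfun_apply (g t) (w y) \<partial>Xi T) + (\<integral>t. indicator {x<..y} t * blinfun_apply (g t) (w x) \<partial>Xi T) - 2 * (\<integral>t. indicator {x<..y} t * blinfun_apply (g t) (w t) \<partial>Xi T)"
      using integrable_indicator_Xi[OF gw] integrable_indicator_Xi[OF gc] by simp
    finally show ?thesis using 1 2 by (simp add: \<Phi>_def)
  qed
  define K where "K = (\<integral>t. (norm (g t))\<^sup>2 \<partial>Xi T)"
  define B where "B = (\<integral>t. (1::real) \<partial>Xi T)"
  have small: "\<bar>\<Phi> b - \<Phi> a\<bar> \<le> \<eta> * (5 + 3 * K + B)" if \<eta>: "\<eta> > 0" for \<eta>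
  proof -
    obtain \<sigma> where \<sigma>: "continuous_on UNIV \<sigma>" "\<sigma> \<in> L2 T" "L2_norm T (\<lambda>t. w t - \<sigma> t) < \<eta>"
      using continuous_dense_L2[OF w] \<eta> unfolding continuously_approximable_def by blast
    define e where "e t = (norm (w t - \<sigma> t))\<^sup>2" for t
    have e0: "e t \<ge> 0" for t by (simp add: e_def)
    have eI: "integrable (Xi T) e" unfolding e_def by (intro L2_integrable L2_diff w \<sigma>(2))
    have e\<eta>: "(\<integral>t. e t \<partial>Xi T) \<le> \<eta>\<^sup>2"
      using power_mono[OF less_imp_le[OF \<sigma>(3)], of 2] by (simp add: L2_norm_sq e_def)
    have "uniformly_continuous_on {0..T} \<sigma>"
      using \<sigma>(1) by (intro compact_uniformly_continuous) (auto intro: continuous_on_subset)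
    then obtain \<delta> where \<delta>: "\<delta> > 0" "\<And>x y. x \<in> {0..T} \<Longrightarrow> y \<in> {0..T} \<Longrightarrow> dist x y < \<delta> \<Longrightarrow> dist (\<sigma> x) (\<sigma> y) < \<eta>"
      using \<eta> unfolding uniformly_continuous_on_def by metis
    \<comment> \<open>The weights in the arithmetic-geometric mean inequality make every error term at most of order \<open>\<eta>\<close>.\<close>
    define m where "m t = 3 * \<eta> * (norm (g t))\<^sup>2 + \<eta> + e t / \<eta>" for t
    have mI: "integrable (Xi T) m" unfolding m_def using L2_integrable[OF g] eI by simp
    have m0: "m t \<ge> 0" for t using \<eta> e0 by (simp add: m_def)
    have step: "\<bar>\<Phi> y - \<Phi> x\<bar> \<le> (y - x) * (e x + e y) / (2 * \<eta>) + (\<integral>t. indicator {x<..y} t * m t \<partial>Xi T)"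
      if xy: "x \<in> E" "y \<in> E" "x < y" "y - x < \<delta>" for x y
    proof -
      define c where "c = (e x + e y) / (2 * \<eta>)"
      have amgm: "u * v \<le> v\<^sup>2 / (2 * \<eta>) + \<eta> * u\<^sup>2 / 2" for u v :: real
      proof -
        have "0 \<le> (v - \<eta> * u)\<^sup>2 / (2 * \<eta>)" using \<eta> by simp
        also have "\<dots> = v\<^sup>2 / (2 * \<eta>) + \<eta> * u\<^sup>2 / 2 - u * v"
          using \<eta> by (simp add: power2_diff power2_eq_square field_simps)
        finally show ?thesis by simp
      qed
      have integrand: "\<bar>blinfun_apply (g t) (w z - w t)\<bar> \<le> e z / (2 * \<eta>) + (\<eta> / 2 + 3 * \<eta> / 2 * (norm (g t))\<^sup>2 + e t / (2 * \<eta>))"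
        if t: "t \<in> {x<..y}" and z: "z \<in> {x, y}" for t z
      proof -
        have "dist (\<sigma> z) (\<sigma> t) < \<eta>"
          using t z xy Epos[OF xy(1)] Epos[OF xy(2)] by (intro \<delta>(2)) (auto simp: dist_real_def)
        then have "norm (w z - w t) \<le> norm (w z - \<sigma> z) + \<eta> + norm (w t - \<sigma> t)"
          using norm_triangle_ineq[of "w z - \<sigma> z" "\<sigma> z - w t"] norm_triangle_ineq[of "\<sigma> z - \<sigma> t" "\<sigma> t - w t"]
          by (simp add: dist_norm norm_minus_commute)
        then have "\<bar>blinfun_apply (g t) (w z - w t)\<bar> \<le> norm (g t) * (norm (w z - \<sigma> z) + \<eta> + norm (w t - \<sigma> t))"
          by (rule order_trans[OF blinfun_abs_le mult_left_mono]) simp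
        also have "\<dots> = norm (g t) * norm (w z - \<sigma> z) + norm (g t) * \<eta> + norm (g t) * norm (w t - \<sigma> t)"
          by (simp add: algebra_simps)
        also have "\<dots> \<le> (e z / (2 * \<eta>) + \<eta> * (norm (g t))\<^sup>2 / 2) + (\<eta>\<^sup>2 / (2 * \<eta>) + \<eta> * (norm (g t))\<^sup>2 / 2) + (e t / (2 * \<eta>) + \<eta> * (norm (g t))\<^sup>2 / 2)"
          unfolding e_def by (intro add_mono amgm)
        also have "\<dots> = e z / (2 * \<eta>) + (\<eta> / 2 + 3 * \<eta> / 2 * (norm (g t))\<^sup>2 + e t / (2 * \<eta>))"
          using \<eta> by (simp add: power2_eq_square field_simps)
        finally show ?thesis .
      qed
      have "\<bar>\<Phi> y - \<Phi> x\<bar> \<le> (\<integral>t. \<bar>indicator {x<..y} t * (blinfun_apply (g t) (w y - w t) + blinfun_apply (g t) (w x - w t))\<bar> \<partial>Xi T)"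
        unfolding loc[OF xy(1-3)] by (rule integral_abs_bound)
      also have "\<dots> \<le> (\<integral>t. c * (indicator {x<..y} t * 1) + indicator {x<..y} t * m t \<partial>Xi T)"
      proof (rule integral_mono)
        show "integrable (Xi T) (\<lambda>t. \<bar>indicator {x<..y} t * (blinfun_apply (g t) (w y - w t) + blinfun_apply (g t) (w x - w t))\<bar>)"
          by (intro integrable_abs integrable_indicator_Xi Bochner_Integration.integrable_add L2_duality(1) g L2_diff L2_const w)
        show "integrable (Xi T) (\<lambda>t. c * (indicator {x<..y} t * 1) + indicator {x<..y} t * m t)"
          by (intro Bochner_Integration.integrable_add integrable_mult_right integrable_indicator_Xi mI) simp
        show "\<bar>indicator {x<..y} t * (blinfun_apply (g t) (w y - w t) + blinfun_apply (g t) (w x - w t))\<bar> \<le> c * (indicator {x<..y} t * 1) + indicator {x<..y} t * m t" for t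
        proof (cases "t \<in> {x<..y}")
          case True
          have "c + m t = e y / (2 * \<eta>) + (\<eta> / 2 + 3 * \<eta> / 2 * (norm (g t))\<^sup>2 + e t / (2 * \<eta>)) + (e x / (2 * \<eta>) + (\<eta> / 2 + 3 * \<eta> / 2 * (norm (g t))\<^sup>2 + e t / (2 * \<eta>)))"
            using \<eta> by (simp add: c_def m_def field_simps)
          then show ?thesis using integrand[OF True, of y] integrand[OF True, of x] True by simp
        qed simp
      qed
      also have "\<dots> = c * (\<integral>t. indicator {x<..y} t * 1 \<partial>Xi T) + (\<integral>t. indicator {x<..y} t * m t \<partial>Xi T)"
        using integrable_indicator_Xi[OF mI] integrable_indicator_Xi[OF integrable_const_Xi[of T 1]] by simp
      also have "(\<integral>t. indicator {x<..y} t * 1 \<partial>Xi T) = y - x"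
        using Epos xy by (intro measure_interval_Xi) (auto simp: less_imp_le)
      finally show ?thesis by (simp add: c_def mult.commute)
    qed
    \<comment> \<open>The last condition on the mesh makes the end points \<open>a\<close> and \<open>b\<close> harmless, where \<open>w\<close> need not be close to \<open>\<sigma>\<close>.\<close>
    obtain n :: nat where n: "n > 0" "(b - a) / n < \<delta> / 2" "(b - a) / n * (e a + e b) \<le> \<eta>\<^sup>2"
    proof -
      have "(\<lambda>n. (b - a) / real n) \<longlonglongrightarrow> 0" by (rule lim_const_over_n)
      then have "eventually (\<lambda>n. (b - a) / real n < \<delta> / 2) sequentially" using \<delta>(1) by (intro order_tendstoD(2)) auto
      moreover have "(\<lambda>n. (b - a) / real n * (e a + e b)) \<longlonglongrightarrow> 0 * (e a + e b)" by (intro tendsto_intros lim_const_over_n)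
      then have "eventually (\<lambda>n. (b - a) / real n * (e a + e b) < \<eta>\<^sup>2) sequentially" using \<eta> by (intro order_tendstoD(2)) auto
      ultimately have "eventually (\<lambda>n. n > 0 \<and> (b - a) / real n < \<delta> / 2 \<and> (b - a) / real n * (e a + e b) < \<eta>\<^sup>2) sequentially"
        using eventually_gt_at_top[of "0::nat"] by eventually_elim simp
      then show thesis using that by (auto simp: eventually_sequentially intro: less_imp_le)
    qed
    define h where "h = (b - a) / n"
    have h: "h > 0" using ab n by (simp add: h_def)
    \<comment> \<open>One node is chosen in each cell of the uniform grid \<open>G\<close>, and \<open>a\<close> and \<open>b\<close> are added as first and last nodes.\<close>
    define G where "G i = a + real i * h" for i :: nat
    have G0: "G 0 = a" "G n = b" using n by (simp_all add: G_def h_def)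
    have Gs: "G (Suc i) = G i + h" for i by (simp add: G_def algebra_simps)
    have Gmono: "G i \<le> G k" if "i \<le> k" for i k using that h by (simp add: G_def)
    have "\<exists>x. G i < x \<and> x < G (Suc i) \<and> x \<in> E \<and> h * e x \<le> (\<integral>t. indicator {G i<..G (Suc i)} t * e t \<partial>Xi T)" if "i < n" for i
    proof -
      have "0 \<le> G i" "G i < G (Suc i)" "G (Suc i) \<le> T"
        using Gmono[of 0 i] Gmono[of "Suc i" n] that G0 h Epos[OF ab(1)] Epos[OF ab(2)] by (auto simp: Gs)
      from point_below_average[OF E(1) eI this] show ?thesis by (auto simp: Gs)
    qed
    then obtain x where x: "\<And>i. i < n \<Longrightarrow> G i < x i" "\<And>i. i < n \<Longrightarrow> x i < G (Suc i)" "\<And>i. i < n \<Longrightarrow> x i \<in> E"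
      "\<And>i. i < n \<Longrightarrow> h * e (x i) \<le> (\<integral>t. indicator {G i<..G (Suc i)} t * e t \<partial>Xi T)"
      by metis
    define y where "y i = (if i = 0 then a else if i \<le> n then x (i - 1) else b)" for i
    have yE: "y i \<in> E" for i using ab x(3)[of "i - 1"] by (auto simp: y_def)
    have ylow: "G (i - 1) \<le> y i" if "i \<le> Suc n" for i
      using that x(1)[of "i - 1"] G0 by (auto simp: y_def not_le le_Suc_eq intro: less_imp_le)
    have ylt: "y i < y (Suc i)" if "i \<le> n" for i
    proof (cases "i = 0")
      case True then show ?thesis using x(1)[of 0] n G0 by (simp add: y_def)
    next
      case False
      then have "y i < G i" using that x(2)[of "i - 1"] by (simp add: y_def)
      moreover have "G i \<le> y (Suc i)" using ylow[of "Suc i"] that by simp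
      ultimately show ?thesis by simp
    qed
    have ygap: "y (Suc i) - y i \<le> 2 * h" if "i \<le> n" for i
    proof -
      have "y (Suc i) \<le> G (Suc i)"
        using that x(2)[of i] G0 h by (auto simp: y_def Gs less_imp_le le_less)
      moreover have "G i - h \<le> y i"
        using ylow[of i] that h Gs[of "i - 1"] by (cases i) (auto simp: y_def G0)
      ultimately show ?thesis by (simp add: Gs)
    qed
    have split: "(\<Sum>i<k. \<integral>t. indicator {z i<..z (Suc i)} t * f t \<partial>Xi T) = (\<integral>t. indicator {z 0<..z k} t * f t \<partial>Xi T)"
      if "integrable (Xi T) f" "\<And>i. i < k \<Longrightarrow> z i \<le> z (Suc i)" for f :: "real \<Rightarrow> real" and z and k :: nat
      using that(2)
    proof (induction k)
      case (Suc k)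
      have "z 0 \<le> z i" if "i \<le> k" for i
        using that
      proof (induction i)
        case (Suc i)
        then show ?case using Suc.prems \<open>\<And>i. i < Suc k \<Longrightarrow> z i \<le> z (Suc i)\<close>[of i] by simp
      qed simp
      then have mono: "z 0 \<le> z k" by simp
      show ?case using Suc integral_interval_split[OF that(1) mono, of "z (Suc k)"] by simp
    qed simp
    have sume: "(\<Sum>i<n. h * e (x i)) \<le> \<eta>\<^sup>2"
    proof -
      have "(\<Sum>i<n. h * e (x i)) \<le> (\<Sum>i<n. \<integral>t. indicator {G i<..G (Suc i)} t * e t \<partial>Xi T)"
        by (intro sum_mono x(4)) simp
      also have "\<dots> = (\<integral>t. indicator {a<..b} t * e t \<partial>Xi T)"
        using split[OF eI, of n G] Gmono G0 by simp
      also have "\<dots> \<le> (\<integral>t. e t \<partial>Xi T)"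
        by (intro integral_mono integrable_indicator_Xi eI) (auto simp: indicator_def e0)
      finally show ?thesis using e\<eta> by simp
    qed
    have "\<bar>\<Phi> b - \<Phi> a\<bar> = \<bar>\<Sum>i<Suc n. \<Phi> (y (Suc i)) - \<Phi> (y i)\<bar>"
    proof -
      have "y 0 = a" "y (Suc n) = b" by (simp_all add: y_def)
      then show ?thesis using sum_lessThan_telescope[of "\<lambda>i. \<Phi> (y i)" "Suc n"] by (simp only:)
    qed
    also have "\<dots> \<le> (\<Sum>i<Suc n. \<bar>\<Phi> (y (Suc i)) - \<Phi> (y i)\<bar>)" by (rule sum_abs)
    also have "\<dots> \<le> (\<Sum>i<Suc n. h / \<eta> * (e (y i) + e (y (Suc i))) + (\<integral>t. indicator {y i<..y (Suc i)} t * m t \<partial>Xi T))"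
    proof (rule sum_mono)
      fix i assume "i \<in> {..<Suc n}"
      then have i: "i \<le> n" by simp
      have "\<bar>\<Phi> (y (Suc i)) - \<Phi> (y i)\<bar> \<le> (y (Suc i) - y i) * (e (y i) + e (y (Suc i))) / (2 * \<eta>) + (\<integral>t. indicator {y i<..y (Suc i)} t * m t \<partial>Xi T)"
      proof (intro step yE ylt i)
        have "h < \<delta> / 2" using n(2) by (simp add: h_def)
        then show "y (Suc i) - y i < \<delta>" using ygap[OF i] by linarith
      qed
      also have "(y (Suc i) - y i) * (e (y i) + e (y (Suc i))) / (2 * \<eta>) \<le> (2 * h) * (e (y i) + e (y (Suc i))) / (2 * \<eta>)"
        using ygap[OF i] e0 \<eta> by (intro divide_right_mono mult_right_mono) (auto intro: add_nonneg_nonneg)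
      finally show "\<bar>\<Phi> (y (Suc i)) - \<Phi> (y i)\<bar> \<le> h / \<eta> * (e (y i) + e (y (Suc i))) + (\<integral>t. indicator {y i<..y (Suc i)} t * m t \<partial>Xi T)"
        by simp
    qed
    also have "\<dots> = h / \<eta> * (\<Sum>i<Suc n. e (y i) + e (y (Suc i))) + (\<integral>t. indicator {a<..b} t * m t \<partial>Xi T)"
    proof -
      have "(\<Sum>i<Suc n. \<integral>t. indicator {y i<..y (Suc i)} t * m t \<partial>Xi T) = (\<integral>t. indicator {y 0<..y (Suc n)} t * m t \<partial>Xi T)"
        by (rule split[OF mI]) (simp add: ylt less_imp_le)
      also have "y 0 = a" by (simp add: y_def)
      also have "y (Suc n) = b" by (simp add: y_def)
      finally show ?thesis by (subst sum.distrib, subst sum_distrib_left) (simp only:)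
    qed
    also have "(\<integral>t. indicator {a<..b} t * m t \<partial>Xi T) \<le> (\<integral>t. m t \<partial>Xi T)"
      by (intro integral_mono integrable_indicator_Xi mI) (auto simp: indicator_def m0)
    also have "(\<integral>t. m t \<partial>Xi T) = 3 * \<eta> * K + \<eta> * B + (\<integral>t. e t \<partial>Xi T) / \<eta>"
      using L2_integrable[OF g] eI by (simp add: m_def K_def B_def)
    also have "(\<integral>t. e t \<partial>Xi T) / \<eta> \<le> \<eta>"
      using e\<eta> \<eta> by (simp add: field_simps power2_eq_square)
    also have "(\<Sum>i<Suc n. e (y i) + e (y (Suc i))) = e a + e b + 2 * (\<Sum>i<n. e (x i))"
    proof -
      have "(\<Sum>i<Suc n. e (y i)) = e a + (\<Sum>i<n. e (x i))"
        unfolding sum.lessThan_Suc_shift by (simp add: y_def)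
      moreover have "(\<Sum>i<Suc n. e (y (Suc i))) = (\<Sum>i<n. e (x i)) + e b"
        by (simp add: y_def)
      ultimately show ?thesis by (simp add: sum.distrib del: sum.lessThan_Suc)
    qed
    also have "h / \<eta> * (e a + e b + 2 * (\<Sum>i<n. e (x i))) = (h * (e a + e b) + 2 * (\<Sum>i<n. h * e (x i))) / \<eta>"
      by (simp add: sum_distrib_left[symmetric] field_simps)
    also have "\<dots> \<le> (\<eta>\<^sup>2 + 2 * \<eta>\<^sup>2) / \<eta>"
      using \<eta> sume n(3) by (intro divide_right_mono add_mono mult_left_mono) (auto simp: h_def)
    also have "\<dots> = 3 * \<eta>" using \<eta> by (simp add: power2_eq_square)
    finally show ?thesis using \<eta> by (simp add: algebra_simps)
  qed
  have "\<Phi> b - \<Phi> a = 0"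
  proof (rule ccontr)
    assume "\<not> ?thesis"
    then have pos: "\<bar>\<Phi> b - \<Phi> a\<bar> > 0" by simp
    have C: "5 + 3 * K + B > 0" by (simp add: K_def B_def add_pos_nonneg)
    define D where "D = 5 + 3 * K + B"
    have "\<bar>\<Phi> b - \<Phi> a\<bar> \<le> \<bar>\<Phi> b - \<Phi> a\<bar> / (2 * D) * D"
      using small[of "\<bar>\<Phi> b - \<Phi> a\<bar> / (2 * D)"] pos C by (simp add: D_def)
    also have "\<dots> = \<bar>\<Phi> b - \<Phi> a\<bar> / 2"
    proof -
      have "D > 0" using C by (simp add: D_def)
      then show ?thesis by simp
    qed
    finally show False using pos by simp
  qed
  then show ?thesis
    using integral_interval_split[OF gw, of 0 a b] ab Epos[OF ab(1)] by (simp add: \<Phi>_def)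
qed

section \<open>Continuous representatives and integration by parts\<close>

text \<open>The square of the increment can be expanded about either end point \<open>c\<close>; it then equals, up to sign,
twice the integral of \<open>g t (w t - w c)\<close>. The freedom to choose \<open>c\<close> allows expansion about the point at
which \<open>w\<close> is small.
\<close>

lemma square_increment_bound:
  fixes j :: "'v::{real_inner,complete_space} \<Rightarrow> 'h::{real_inner,complete_space}"
  assumes w: "w \<in> L2 T" and g: "g \<in> L2 T" and E: "E \<subseteq> {0<..<T}"
    and inc: "\<And>a b s. a \<in> E \<Longrightarrow> b \<in> E \<Longrightarrow> s \<in> E \<Longrightarrow> a < b \<Longrightarrow>
       (j (w b) - j (w a)) \<bullet> j (w s) = (\<integral>t. indicator {a<..b} t * blinfun_apply (g t) (w s) \<partial>Xi T)"
    and energy: "\<And>a b. a \<in> E \<Longrightarrow> b \<in> E \<Longrightarrow> a < b \<Longrightarrow>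
      (norm (j (w b)))\<^sup>2 - (norm (j (w a)))\<^sup>2 = 2 * (\<integral>t. indicator {a<..b} t * blinfun_apply (g t) (w t) \<partial>Xi T)"
    and ab: "a \<in> E" "b \<in> E" "a < b" and c: "c \<in> {a, b}"
  shows "(norm (j (w b) - j (w a)))\<^sup>2 \<le>
      (\<integral>t. indicator {a<..b} t * (2 * (norm (g t))\<^sup>2 + (norm (w t))\<^sup>2) \<partial>Xi T) + (b - a) * (norm (w c))\<^sup>2"
proof -
  have cE: "c \<in> E" using c ab by auto
  note gw = L2_duality(1)[OF g w] and gc = L2_duality(1)[OF g L2_const, of "w c"]
  have pos: "0 < a" "b < T" using ab E by auto
  \<comment> \<open>the sign of the expansion about the left or the right end point\<close>
  define \<epsilon> :: real where "\<epsilon> = (if c = a then 1 else - 1)"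
  have "(norm (j (w b) - j (w a)))\<^sup>2 = \<epsilon> * (((norm (j (w b)))\<^sup>2 - (norm (j (w a)))\<^sup>2) - 2 * ((j (w b) - j (w a)) \<bullet> j (w c)))"
    using c ab(3) by (auto simp: \<epsilon>_def power2_norm_eq_inner inner_diff_left inner_diff_right inner_commute algebra_simps)
  also have "\<dots> = \<epsilon> * (2 * (\<integral>t. indicator {a<..b} t * blinfun_apply (g t) (w t) \<partial>Xi T) - 2 * (\<integral>t. indicator {a<..b} t * blinfun_apply (g t) (w c) \<partial>Xi T))"
    using energy[OF ab] inc[OF ab(1,2) cE ab(3)] by simp
  also have "\<dots> = (\<integral>t. \<epsilon> * (2 * (indicator {a<..b} t * blinfun_apply (g t) (w t)) - 2 * (indicator {a<..b} t * blinfun_apply (g t) (w c))) \<partial>Xi T)"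
    using integrable_indicator_Xi[OF gw] integrable_indicator_Xi[OF gc] by simp
  also have "\<dots> \<le> (\<integral>t. indicator {a<..b} t * (2 * (norm (g t))\<^sup>2 + (norm (w t))\<^sup>2) + (norm (w c))\<^sup>2 * (indicator {a<..b} t * 1) \<partial>Xi T)"
  proof (rule integral_mono)
    show "integrable (Xi T) (\<lambda>t. \<epsilon> * (2 * (indicator {a<..b} t * blinfun_apply (g t) (w t)) - 2 * (indicator {a<..b} t * blinfun_apply (g t) (w c))))"
      using integrable_indicator_Xi[OF gw] integrable_indicator_Xi[OF gc] by simp
    show "integrable (Xi T) (\<lambda>t. indicator {a<..b} t * (2 * (norm (g t))\<^sup>2 + (norm (w t))\<^sup>2) + (norm (w c))\<^sup>2 * (indicator {a<..b} t * 1))"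
      using L2_integrable[OF g] L2_integrable[OF w]
      by (intro Bochner_Integration.integrable_add integrable_mult_right integrable_indicator_Xi) auto
    fix t
    have am: "2 * (norm (g t) * x) \<le> (norm (g t))\<^sup>2 + x\<^sup>2" for x
      using sum_squares_bound[of "norm (g t)" x] by simp
    have "\<epsilon> * (2 * blinfun_apply (g t) (w t) - 2 * blinfun_apply (g t) (w c)) \<le> 2 * \<bar>blinfun_apply (g t) (w t)\<bar> + 2 * \<bar>blinfun_apply (g t) (w c)\<bar>"
      by (auto simp: \<epsilon>_def)
    also have "\<dots> \<le> 2 * (norm (g t) * norm (w t)) + 2 * (norm (g t) * norm (w c))"
      by (intro add_mono mult_left_mono blinfun_abs_le) auto
    also have "\<dots> \<le> 2 * (norm (g t))\<^sup>2 + (norm (w t))\<^sup>2 + (norm (w c))\<^sup>2"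
      using am[of "norm (w t)"] am[of "norm (w c)"] by linarith
    finally show "\<epsilon> * (2 * (indicator {a<..b} t * blinfun_apply (g t) (w t)) - 2 * (indicator {a<..b} t * blinfun_apply (g t) (w c)))
       \<le> indicator {a<..b} t * (2 * (norm (g t))\<^sup>2 + (norm (w t))\<^sup>2) + (norm (w c))\<^sup>2 * (indicator {a<..b} t * 1)"
      by (simp add: indicator_def)
  qed
  also have "\<dots> = (\<integral>t. indicator {a<..b} t * (2 * (norm (g t))\<^sup>2 + (norm (w t))\<^sup>2) \<partial>Xi T) + (norm (w c))\<^sup>2 * (\<integral>t. indicator {a<..b} t * 1 \<partial>Xi T)"
  proof -
    have "integrable (Xi T) (\<lambda>t. indicator {a<..b} t * (2 * (norm (g t))\<^sup>2 + (norm (w t))\<^sup>2))"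
      using L2_integrable[OF g] L2_integrable[OF w] by (intro integrable_indicator_Xi) auto
    moreover have "integrable (Xi T) (\<lambda>t. indicator {a<..b} t * (1::real))"
      by (rule integrable_indicator_Xi) simp
    ultimately show ?thesis by (subst Bochner_Integration.integral_add) simp_all
  qed
  also have "(\<integral>t. indicator {a<..b} t * 1 \<partial>Xi T) = b - a"
    using pos ab by (intro measure_interval_Xi) auto
  finally show ?thesis by (simp add: mult.commute)
qed

text \<open>Between two good points \<open>a < b\<close> there is a good point \<open>c\<close> at which \<open>\<parallel>w c\<parallel>\<^sup>2\<close> does not exceed its
average over \<open>(a, b]\<close>. Passing from \<open>a\<close> to \<open>b\<close> through \<open>c\<close> and expanding about \<open>c\<close> both times bounds the
squared oscillation of \<open>j \<circ> w\<close> by a multiple of the integral of \<open>\<parallel>g\<parallel>\<^sup>2 + \<parallel>w\<parallel>\<^sup>2\<close> over \<open>(a, b]\<close>. Hence \<open>j \<circ> w\<close> is uniformly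
continuous on the good points, which are dense; it extends to \<open>[0, T]\<close>, and so does the energy
identity.
\<close>

lemma continuous_representative:
  fixes j :: "'v::{real_inner,complete_space} \<Rightarrow> 'h::{real_inner,complete_space}"
  assumes T: "T > 0" and j: "bounded_linear j" and w: "w \<in> X_space j T"
  shows "\<exists>c. continuous_on {0..T} c \<and> (AE s in Xi T. c s = j (w s)) \<and>
    (norm (c T))\<^sup>2 - (norm (c 0))\<^sup>2 = 2 * dt j T w w"
proof -
  define g where "g = weak_derivative j T w"
  have wL: "w \<in> L2 T" and g: "g \<in> L2 T" and wg: "has_weak_derivative j T w g"
    using X_space_L2[OF w] weak_derivative_L2[OF w] weak_derivative_X[OF w] by (auto simp: g_def)
  obtain E where E: "AE t in Xi T. t \<in> E" "E \<subseteq> {0<..<T}"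
    and inc: "\<And>a b s. a \<in> E \<Longrightarrow> b \<in> E \<Longrightarrow> s \<in> E \<Longrightarrow> a < b \<Longrightarrow>
       (j (w b) - j (w a)) \<bullet> j (w s) = (\<integral>t. indicator {a<..b} t * blinfun_apply (g t) (w s) \<partial>Xi T)"
    using weak_derivative_increment_at_values[OF j wL wg] by blast
  have energy: "(norm (j (w b)))\<^sup>2 - (norm (j (w a)))\<^sup>2 = 2 * (\<integral>t. indicator {a<..b} t * blinfun_apply (g t) (w t) \<partial>Xi T)"
    if "a \<in> E" "b \<in> E" "a < b" for a b
    by (rule energy_increment[OF j wL g E _ that]) (rule inc)
  note gw = L2_duality(1)[OF g wL]
  define m where "m t = 2 * (norm (g t))\<^sup>2 + 2 * (norm (w t))\<^sup>2" for t
  have mI: "integrable (Xi T) m" unfolding m_def using L2_integrable[OF g] L2_integrable[OF wL] by simp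
  define M where "M x = (\<integral>t. indicator {0<..x} t * m t \<partial>Xi T)" for x
  have Epos: "0 < x" "x < T" if "x \<in> E" for x using E(2) that by auto
  have osc: "norm (j (w b) - j (w a)) \<le> 2 * sqrt (M b - M a)" if ab: "a \<in> E" "b \<in> E" "a < b" for a b
  proof -
    have Mab: "M b - M a = (\<integral>t. indicator {a<..b} t * m t \<partial>Xi T)"
      using integral_interval_split[OF mI, of 0 a b] ab Epos[OF ab(1)] by (simp add: M_def)
    obtain c where c: "a < c" "c < b" "c \<in> E" "(b - a) * (norm (w c))\<^sup>2 \<le> (\<integral>t. indicator {a<..b} t * (norm (w t))\<^sup>2 \<partial>Xi T)"
      using point_below_average[OF E(1) L2_integrable[OF wL], of a b] ab Epos[OF ab(1)] Epos[OF ab(2)] by auto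
    have half: "norm (j (w q) - j (w p)) \<le> sqrt (M b - M a)"
      if pq: "p \<in> E" "q \<in> E" "p < q" "a \<le> p" "q \<le> b" "c \<in> {p, q}" for p q
    proof (rule real_le_rsqrt)
      have "(norm (j (w q) - j (w p)))\<^sup>2 \<le>
        (\<integral>t. indicator {p<..q} t * (2 * (norm (g t))\<^sup>2 + (norm (w t))\<^sup>2) \<partial>Xi T) + (q - p) * (norm (w c))\<^sup>2"
        by (rule square_increment_bound[OF wL g E(2) inc energy pq(1-3,6)])
      also have "\<dots> \<le> (\<integral>t. indicator {a<..b} t * (2 * (norm (g t))\<^sup>2 + (norm (w t))\<^sup>2) \<partial>Xi T) + (b - a) * (norm (w c))\<^sup>2"
        using pq L2_integrable[OF g] L2_integrable[OF wL]
        by (intro add_mono mult_right_mono integral_mono integrable_indicator_Xi) (auto simp: indicator_def)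
      also have "\<dots> \<le> (\<integral>t. indicator {a<..b} t * (2 * (norm (g t))\<^sup>2 + (norm (w t))\<^sup>2) \<partial>Xi T) + (\<integral>t. indicator {a<..b} t * (norm (w t))\<^sup>2 \<partial>Xi T)"
        using c(4) by simp
      also have "\<dots> = (\<integral>t. indicator {a<..b} t * (2 * (norm (g t))\<^sup>2 + (norm (w t))\<^sup>2) + indicator {a<..b} t * (norm (w t))\<^sup>2 \<partial>Xi T)"
        using L2_integrable[OF g] L2_integrable[OF wL]
        by (intro Bochner_Integration.integral_add[symmetric] integrable_indicator_Xi) auto
      also have "\<dots> = M b - M a"
        unfolding Mab m_def by (intro Bochner_Integration.integral_cong) (auto simp: algebra_simps)
      finally show "(norm (j (w q) - j (w p)))\<^sup>2 \<le> M b - M a" .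
    qed
    have "norm (j (w b) - j (w a)) \<le> norm (j (w b) - j (w c)) + norm (j (w c) - j (w a))"
      using norm_triangle_ineq[of "j (w b) - j (w c)" "j (w c) - j (w a)"] by simp
    then show ?thesis using half[of a c] half[of c b] ab c by simp
  qed
  have Mcont: "continuous_on {0..T} M"
    unfolding M_def by (rule continuous_on_subset[OF continuous_indefinite_integral[OF mI]]) simp
  have "uniformly_continuous_on E (\<lambda>t. j (w t))"
    unfolding uniformly_continuous_on_def
  proof (intro allI impI)
    fix e :: real assume e: "e > 0"
    have "uniformly_continuous_on {0..T} M"
      using Mcont by (rule compact_uniformly_continuous) simp
    then obtain d where d: "d > 0" "\<And>x y. x \<in> {0..T} \<Longrightarrow> y \<in> {0..T} \<Longrightarrow> dist y x < d \<Longrightarrow> dist (M y) (M x) < (e / 2)\<^sup>2"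
      using e unfolding uniformly_continuous_on_def by (metis half_gt_zero zero_less_power)
    have lt: "norm (j (w b) - j (w a)) < e" if "a \<in> E" "b \<in> E" "a < b" "b - a < d" for a b
    proof -
      have "dist (M b) (M a) < (e / 2)\<^sup>2"
        using that Epos[of a] Epos[of b] by (intro d(2)) (auto simp: dist_real_def)
      then have "M b - M a < (e / 2)\<^sup>2" by (simp add: dist_real_def)
      from real_sqrt_less_mono[OF this] have "sqrt (M b - M a) < e / 2" using e by simp
      then show ?thesis using osc[OF that(1-3)] by linarith
    qed
    show "\<exists>d>0. \<forall>x\<in>E. \<forall>x'\<in>E. dist x' x < d \<longrightarrow> dist (j (w x')) (j (w x)) < e"
    proof (intro exI[of _ d] conjI ballI impI d(1))
      fix x x' assume "x \<in> E" "x' \<in> E" "dist x' x < d"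
      then show "dist (j (w x')) (j (w x)) < e"
        using lt[of x x'] lt[of x' x] e
        by (cases x x' rule: linorder_cases) (auto simp: dist_norm dist_real_def norm_minus_commute)
    qed
  qed
  then obtain c where c: "uniformly_continuous_on (closure E) c" "\<And>x. x \<in> E \<Longrightarrow> j (w x) = c x"
    using uniformly_continuous_on_extension_on_closure by metis
  have dense: "{0..T} \<subseteq> closure E"
  proof
    fix x assume x: "x \<in> {0..T}"
    show "x \<in> closure E"
    proof (rule closure_approachable[THEN iffD2], intro allI impI)
      fix e :: real assume e: "e > 0"
      have "\<exists>p q. 0 \<le> p \<and> p < q \<and> q \<le> T \<and> x - e \<le> p \<and> q \<le> x + e"
        using x e T by (intro exI[of _ "max 0 (x - e)"] exI[of _ "min T (x + e)"]) auto
      then obtain p q where pq: "0 \<le> p" "p < q" "q \<le> T" "x - e \<le> p" "q \<le> x + e" by blast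
      obtain t where "p < t" "t < q" "t \<in> E" by (rule AE_Xi_dense[OF E(1) pq(1-3)])
      then show "\<exists>y\<in>E. dist y x < e" using pq by (intro bexI[of _ t]) (auto simp: dist_real_def)
    qed
  qed
  have c_cont: "continuous_on {0..T} c"
    using uniformly_continuous_imp_continuous[OF c(1)] dense by (rule continuous_on_subset)
  have c_AE: "AE s in Xi T. c s = j (w s)" using E(1) by eventually_elim (simp add: c(2))
  define G where "G x = (\<integral>t. indicator {0<..x} t * blinfun_apply (g t) (w t) \<partial>Xi T)" for x
  have G_cont: "continuous_on {0..T} G"
    unfolding G_def by (rule continuous_on_subset[OF continuous_indefinite_integral[OF gw]]) simp
  \<comment> \<open>The energy identity says that \<open>\<Psi>\<close> is constant on \<open>E\<close>; by continuity it is constant on \<open>[0, T]\<close>.\<close>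
  define \<Psi> where "\<Psi> x = (norm (c x))\<^sup>2 - 2 * G x" for x
  have \<Psi>_cont: "continuous_on {0..T} \<Psi>" unfolding \<Psi>_def by (intro continuous_intros c_cont G_cont)
  obtain e where e: "e \<in> E" using AE_Xi_dense[OF E(1), of 0 T] T by auto
  have lt: "\<Psi> y = \<Psi> x" if "x \<in> E" "y \<in> E" "x < y" for x y
    using energy[OF that] integral_interval_split[OF gw, of 0 x y] that Epos[OF that(1)] c(2)
    by (simp add: \<Psi>_def G_def)
  have const: "\<Psi> x = \<Psi> e" if "x \<in> E" for x
    using lt[of x e] lt[of e x] that e by (cases x e rule: linorder_cases) auto
  have closed: "closed {x \<in> {0..T}. \<Psi> x = \<Psi> e}"
    using \<Psi>_cont by (intro continuous_closed_preimage_constant) auto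
  have "closure E \<subseteq> {x \<in> {0..T}. \<Psi> x = \<Psi> e}"
    using const E(2) by (intro closure_minimal closed) auto
  moreover have "T \<in> closure E" "0 \<in> closure E" using subsetD[OF dense, of T] subsetD[OF dense, of 0] T by auto
  ultimately have "\<Psi> T = \<Psi> e" "\<Psi> 0 = \<Psi> e" by blast+
  moreover have "G 0 = 0" by (simp add: G_def)
  moreover have "G T = dt j T w w"
    unfolding G_def dt_def g_def by (intro Bochner_Integration.integral_cong) auto
  ultimately have "(norm (c T))\<^sup>2 - (norm (c 0))\<^sup>2 = 2 * dt j T w w" by (simp add: \<Psi>_def)
  with c_cont c_AE show ?thesis by blast
qed

text \<open>Continuous representatives agree on a dense set and thus everywhere on \<open>[0, T]\<close>, so the choice made
in \<^const>\<open>time_trace\<close> is immaterial.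
\<close>

lemma time_trace_eq:
  assumes T: "T > 0" and c: "continuous_on {0..T} c" "AE s in Xi T. c s = j (w s)" and t: "t \<in> {0..T}"
  shows "time_trace j T t w = c t"
proof -
  define b where "b = (SOME c. continuous_on {0..T} c \<and> (AE s in Xi T. c s = j (w s)))"
  have b: "continuous_on {0..T} b" "AE s in Xi T. b s = j (w s)"
    unfolding b_def using someI[where P="\<lambda>c. continuous_on {0..T} c \<and> (AE s in Xi T. c s = j (w s))", of c] c by auto
  have eq: "AE s in Xi T. b s = c s" using b(2) c(2) by eventually_elim simp
  define E where "E = {s \<in> {0..T}. b s - c s = 0}"
  have "closed E"
    unfolding E_def using b(1) c(1) by (intro continuous_closed_preimage_constant continuous_on_diff) auto
  have "t \<in> closure E"
  proof (rule closure_approachable[THEN iffD2], intro allI impI)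
    fix e :: real assume e: "e > 0"
    have "\<exists>p q. 0 \<le> p \<and> p < q \<and> q \<le> T \<and> t - e \<le> p \<and> q \<le> t + e"
      using t e T by (intro exI[of _ "max 0 (t - e)"] exI[of _ "min T (t + e)"]) auto
    then obtain p q where pq: "0 \<le> p" "p < q" "q \<le> T" "t - e \<le> p" "q \<le> t + e" by blast
    obtain s where "p < s" "s < q" "b s = c s" by (rule AE_Xi_dense[OF eq pq(1-3)])
    then show "\<exists>y\<in>E. dist y t < e" using pq by (intro bexI[of _ s]) (auto simp: dist_real_def E_def)
  qed
  then have "b t = c t" using \<open>closed E\<close> by (simp add: E_def)
  then show ?thesis by (simp add: time_trace_def b_def)
qed

lemma time_trace_lincomb:
  fixes j :: "'v::{real_inner,complete_space} \<Rightarrow> 'h::{real_inner,complete_space}"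
  assumes T: "T > 0" and j: "bounded_linear j" and "w \<in> X_space j T" "v \<in> X_space j T" and t: "t \<in> {0..T}"
  shows "time_trace j T t (\<lambda>s. a *\<^sub>R w s + b *\<^sub>R v s) = a *\<^sub>R time_trace j T t w + b *\<^sub>R time_trace j T t v"
proof -
  obtain c where c: "continuous_on {0..T} c" "AE s in Xi T. c s = j (w s)"
    using continuous_representative[OF T j assms(3)] by blast
  obtain d where d: "continuous_on {0..T} d" "AE s in Xi T. d s = j (v s)"
    using continuous_representative[OF T j assms(4)] by blast
  have "AE s in Xi T. a *\<^sub>R c s + b *\<^sub>R d s = j (a *\<^sub>R w s + b *\<^sub>R v s)"
    using c(2) d(2) by eventually_elim (simp add: linear_simps[OF j])
  then have "time_trace j T t (\<lambda>s. a *\<^sub>R w s + b *\<^sub>R v s) = a *\<^sub>R c t + b *\<^sub>R d t"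
    by (intro time_trace_eq[OF T _ _ t] continuous_intros c(1) d(1))
  then show ?thesis by (simp add: time_trace_eq[where w=w, OF T c t] time_trace_eq[where w=v, OF T d t])
qed

lemma dt_self:
  fixes j :: "'v::{real_inner,complete_space} \<Rightarrow> 'h::{real_inner,complete_space}"
  assumes T: "T > 0" and j: "bounded_linear j" and w: "w \<in> X_space j T"
  shows "2 * dt j T w w = (norm (time_trace j T T w))\<^sup>2 - (norm (time_trace j T 0 w))\<^sup>2"
proof -
  obtain c where c: "continuous_on {0..T} c" "AE s in Xi T. c s = j (w s)"
    "(norm (c T))\<^sup>2 - (norm (c 0))\<^sup>2 = 2 * dt j T w w"
    using continuous_representative[OF assms] by blast
  show ?thesis using c(3) T by (simp add: time_trace_eq[where w=w, OF T c(1,2)])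
qed

lemma dt_integration_by_parts:
  fixes j :: "'v::{real_inner,complete_space} \<Rightarrow> 'h::{real_inner,complete_space}"
  assumes T: "T > 0" and j: "bounded_linear j" and w: "w \<in> X_space j T" and v: "v \<in> X_space j T"
  shows "dt j T w v + dt j T v w =
    time_trace j T T w \<bullet> time_trace j T T v - time_trace j T 0 w \<bullet> time_trace j T 0 v"
proof -
  let ?s = "\<lambda>t. 1 *\<^sub>R w t + 1 *\<^sub>R v t"
  have sX: "?s \<in> X_space j T" by (rule X_space_lincomb[OF j w v])
  have "dt j T ?s ?s = dt j T w ?s + dt j T v ?s"
    using dt_lincomb[OF j w v X_space_L2[OF sX], of 1 1] by simp
  also have "\<dots> = (dt j T w w + dt j T w v) + (dt j T v w + dt j T v v)"
    using dt_dual[OF w] dt_dual[OF v] X_space_L2[OF w] X_space_L2[OF v]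
    by (simp add: dual_def linear_functional_on_def)
  finally have "2 * dt j T ?s ?s = 2 * dt j T w w + 2 * dt j T v v + 2 * (dt j T w v + dt j T v w)" by simp
  then have "2 * (dt j T w v + dt j T v w) = (norm (time_trace j T T ?s))\<^sup>2 - (norm (time_trace j T 0 ?s))\<^sup>2
     - ((norm (time_trace j T T w))\<^sup>2 - (norm (time_trace j T 0 w))\<^sup>2) - ((norm (time_trace j T T v))\<^sup>2 - (norm (time_trace j T 0 v))\<^sup>2)"
    using dt_self[OF T j sX] dt_self[OF T j w] dt_self[OF T j v] by simp
  also have "time_trace j T T ?s = time_trace j T T w + time_trace j T T v"
    using time_trace_lincomb[OF T j w v, of T 1 1] T by simp
  also have "time_trace j T 0 ?s = time_trace j T 0 w + time_trace j T 0 v"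
    using time_trace_lincomb[OF T j w v, of 0 1 1] T by simp
  finally show ?thesis
    by (simp add: power2_norm_eq_inner inner_add_left inner_add_right inner_commute)
qed

section \<open>Dual norms and the constants\<close>

lemma bdd_above_dual:
  fixes f :: "(real \<Rightarrow> 'b::real_normed_vector) \<Rightarrow> real"
  assumes "f \<in> dual (L2 T) (L2_norm T)"
  shows "bdd_above ((\<lambda>v. \<bar>f v\<bar>) ` {v \<in> L2 T. L2_norm T v \<le> 1})"
proof -
  obtain C where C: "\<And>v. v \<in> L2 T \<Longrightarrow> \<bar>f v\<bar> \<le> C * L2_norm T v" using assms by (auto simp: dual_def)
  show ?thesis
  proof (rule bdd_aboveI2)
    fix v :: "real \<Rightarrow> 'b" assume "v \<in> {v \<in> L2 T. L2_norm T v \<le> 1}"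
    then have v: "v \<in> L2 T" "L2_norm T v \<le> 1" by auto
    have "\<bar>f v\<bar> \<le> C * L2_norm T v" by (rule C[OF v(1)])
    also have "\<dots> \<le> \<bar>C\<bar> * L2_norm T v" by (intro mult_right_mono) auto
    also have "\<dots> \<le> \<bar>C\<bar>" using v(2) by (simp add: mult_left_le)
    finally show "\<bar>f v\<bar> \<le> \<bar>C\<bar>" .
  qed
qed

lemma dual_norm_bound:
  fixes f :: "(real \<Rightarrow> 'b::real_normed_vector) \<Rightarrow> real"
  assumes f: "f \<in> dual (L2 T) (L2_norm T)" and v: "v \<in> L2 T"
  shows "\<bar>f v\<bar> \<le> dual_norm (L2 T) (L2_norm T) f * L2_norm T v"
proof -
  obtain C where C: "\<And>v. v \<in> L2 T \<Longrightarrow> \<bar>f v\<bar> \<le> C * L2_norm T v" using f by (auto simp: dual_def)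
  have scale: "f (\<lambda>t. c *\<^sub>R v t) = c * f v" for c
    using f v by (auto simp: dual_def linear_functional_on_def)
  show ?thesis
  proof (cases "L2_norm T v = 0")
    case True then show ?thesis using C[OF v] by simp
  next
    case False
    then have n: "L2_norm T v > 0" using L2_norm_nonneg[of T v] by linarith
    have "L2_norm T (\<lambda>t. (1 / L2_norm T v) *\<^sub>R v t) \<le> 1" using n by (subst L2_norm_scale) simp
    then have "\<bar>f (\<lambda>t. (1 / L2_norm T v) *\<^sub>R v t)\<bar> \<le> dual_norm (L2 T) (L2_norm T) f"
      unfolding dual_norm_def by (intro cSUP_upper bdd_above_dual[OF f]) (simp add: L2_scale[OF v])
    then show ?thesis using n unfolding scale by (simp add: field_simps abs_mult)
  qed
qed

lemma dual_norm_le: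
  fixes f :: "(real \<Rightarrow> 'b::real_normed_vector) \<Rightarrow> real"
  assumes "\<And>v. v \<in> L2 T \<Longrightarrow> \<bar>f v\<bar> \<le> C * L2_norm T v" "C \<ge> 0"
  shows "dual_norm (L2 T) (L2_norm T) f \<le> C"
  unfolding dual_norm_def
proof (rule cSUP_least)
  have "(\<lambda>_. 0) \<in> {v \<in> L2 T. L2_norm T (v :: real \<Rightarrow> 'b) \<le> 1}" by (simp add: L2_const) (simp add: L2_norm_def)
  then show "{v \<in> L2 T. L2_norm T (v :: real \<Rightarrow> 'b) \<le> 1} \<noteq> {}" by blast
  fix v :: "real \<Rightarrow> 'b" assume "v \<in> {v \<in> L2 T. L2_norm T v \<le> 1}"
  then have "\<bar>f v\<bar> \<le> C * L2_norm T v" "C * L2_norm T v \<le> C" using assms by (auto simp: mult_left_le)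
  then show "\<bar>f v\<bar> \<le> C" by linarith
qed

lemma dual_norm_nonneg:
  fixes f :: "(real \<Rightarrow> 'b::real_normed_vector) \<Rightarrow> real"
  assumes "f \<in> dual (L2 T) (L2_norm T)"
  shows "dual_norm (L2 T) (L2_norm T) f \<ge> 0"
proof -
  have "\<bar>f (\<lambda>_. 0)\<bar> \<le> dual_norm (L2 T) (L2_norm T) f"
    unfolding dual_norm_def
    by (rule cSUP_upper[OF _ bdd_above_dual[OF assms]]) (simp add: L2_const, simp add: L2_norm_def)
  then show ?thesis by linarith
qed

lemma weighted_Cauchy_Schwarz:
  fixes a b p q u v :: real
  assumes "a > 0" "b > 0"
  shows "(u * p + v * q)\<^sup>2 \<le> (u\<^sup>2 / a + v\<^sup>2 / b) * (a * p\<^sup>2 + b * q\<^sup>2)"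
proof -
  have "0 \<le> (u * b * q - v * a * p)\<^sup>2 / (a * b)" using assms by simp
  also have "\<dots> = (u\<^sup>2 / a + v\<^sup>2 / b) * (a * p\<^sup>2 + b * q\<^sup>2) - (u * p + v * q)\<^sup>2"
    using assms by (simp add: power2_eq_square field_simps)
  finally show ?thesis by simp
qed

lemma Cauchy_Schwarz_3:
  fixes a b c a' b' c' :: real
  shows "a * a' + b * b' + c * c' \<le> sqrt (a\<^sup>2 + b\<^sup>2 + c\<^sup>2) * sqrt (a'\<^sup>2 + b'\<^sup>2 + c'\<^sup>2)"
proof -
  have "0 \<le> (a * b' - b * a')\<^sup>2 + (a * c' - c * a')\<^sup>2 + (b * c' - c * b')\<^sup>2" by simp
  also have "\<dots> = (a\<^sup>2 + b\<^sup>2 + c\<^sup>2) * (a'\<^sup>2 + b'\<^sup>2 + c'\<^sup>2) - (a * a' + b * b' + c * c')\<^sup>2"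
    by (simp add: power2_eq_square algebra_simps)
  finally show ?thesis by (simp add: real_sqrt_mult[symmetric] real_le_rsqrt)
qed

lemma m_S_facts:
  assumes "m > 0" "L > 0"
  shows "m_S L m > 0" "m_S L m \<le> 1" "m_S L m \<le> m" "m_S L m \<le> m / L\<^sup>2"
  using assms by (auto simp: m_S_def)

lemma L_S_facts: "1 \<le> L_S L m" "L \<le> L_S L m" "1 / m \<le> L_S L m"
  by (auto simp: L_S_def)

text \<open>The left-hand side is the square of the constant that the weighted energy argument of
\<open>estimator_stability\<close> produces. Put \<open>M = 1 / m_S L m\<close> and \<open>X\<close> for the root in \<^const>\<open>C_1\<close>, so that
\<open>2 C_1 - 1 = 1 + 2 M (1 + X)\<close>; expanding both sides, the four terms on the left are matched by means of
\<open>M \<ge> 1\<close>, \<open>X \<ge> 2\<close>, \<open>L / m \<le> min M X\<close> and \<open>L \<le> M m\<close>.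
\<close>

lemma stability_constant_bound:
  fixes m L :: real
  assumes m: "m > 0" "m \<le> L"
  shows "(4 * m / (1 + L\<^sup>2) + 2 * L / m) * (4 * (1 + L\<^sup>2) / m + 2 * L / m) \<le> (2 * C_1 L m - 1)\<^sup>2"
proof -
  have L: "L > 0" using m by simp
  define M where "M = 1 / m_S L m"
  define X where "X = sqrt ((1 + L\<^sup>2) * (1 + 1 / m\<^sup>2))"
  note S = m_S_facts[OF m(1) L]
  have M: "M \<ge> 1" "M * m \<ge> 1" "M * m \<ge> L\<^sup>2"
    using S L by (auto simp: M_def field_simps)
  have M0: "M > 0" using M by simp
  have X2: "X\<^sup>2 = (1 + L\<^sup>2) * (1 + 1 / m\<^sup>2)" by (simp add: X_def)
  have X0: "X \<ge> 0" by (simp add: X_def)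
  have Lm: "m\<^sup>2 \<le> L\<^sup>2" using m by (intro power_mono) auto
  have "2\<^sup>2 \<le> X\<^sup>2"
  proof -
    have "(4::real) \<le> (1 + m\<^sup>2) * (1 + 1 / m\<^sup>2)"
    proof -
      have "0 \<le> (m\<^sup>2 - 1)\<^sup>2 / m\<^sup>2" by simp
      also have "\<dots> = (1 + m\<^sup>2) * (1 + 1 / m\<^sup>2) - 4" using m by (simp add: power2_eq_square field_simps)
      finally show ?thesis by simp
    qed
    also have "\<dots> \<le> X\<^sup>2" unfolding X2 using Lm by (intro mult_right_mono) auto
    finally show ?thesis by simp
  qed
  then have Xge: "X \<ge> 2" using X0 by (rule power2_le_imp_le)
  have "(L / m)\<^sup>2 \<le> X\<^sup>2"
  proof -
    have "(L / m)\<^sup>2 = L\<^sup>2 * (1 / m\<^sup>2)" by (simp add: power_divide)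
    also have "\<dots> \<le> (1 + L\<^sup>2) * (1 + 1 / m\<^sup>2)" by (intro mult_mono) auto
    finally show ?thesis by (simp add: X2)
  qed
  then have XL: "L / m \<le> X" using X0 by (rule power2_le_imp_le)
  have mML: "L \<le> M * m"
  proof (rule power2_le_imp_le)
    have "L\<^sup>2 * 1 \<le> (M * m) * (M * m)" using M by (intro mult_mono) auto
    then show "L\<^sup>2 \<le> (M * m)\<^sup>2" by (simp add: power2_eq_square)
  qed (use M0 m in simp)
  then have LM: "L / m \<le> M" using m by (simp add: field_simps)
  have i: "8 * L / (1 + L\<^sup>2) \<le> 4"
    using sum_squares_bound[of 1 L] by (simp add: field_simps add_pos_nonneg)
  have ii: "4 * L\<^sup>2 / m\<^sup>2 \<le> 4 * M * X"
  proof -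
    have "(L / m) * (L / m) \<le> M * X" using LM XL L m M0 by (intro mult_mono) auto
    then show ?thesis by (simp add: power2_eq_square)
  qed
  have iii: "8 * (1 + L\<^sup>2) * L / m\<^sup>2 \<le> 4 * M\<^sup>2 * X\<^sup>2"
  proof -
    have "2 * L \<le> 2 * (M * m)" using mML by simp
    also have "\<dots> \<le> 2 * m * M\<^sup>2" using M(1) M0 m by (simp add: power2_eq_square)
    also have "\<dots> \<le> (1 + m\<^sup>2) * M\<^sup>2" using sum_squares_bound[of 1 m] by (intro mult_right_mono) auto
    finally have "4 * (1 + L\<^sup>2) / m\<^sup>2 * (2 * L) \<le> 4 * (1 + L\<^sup>2) / m\<^sup>2 * ((1 + m\<^sup>2) * M\<^sup>2)"
      by (intro mult_left_mono) auto
    also have "\<dots> = 4 * M\<^sup>2 * X\<^sup>2" using m by (simp add: X2 field_simps)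
    finally show ?thesis by (simp add: mult_ac)
  qed
  have iv: "20 \<le> 4 * M\<^sup>2 * (1 + 2 * X)"
  proof -
    have "1 * 5 \<le> M\<^sup>2 * (1 + 2 * X)" using M(1) Xge by (intro mult_mono) (auto simp: one_le_power)
    then show ?thesis by simp
  qed
  have L20: "1 + L\<^sup>2 \<noteq> 0" by (metis add_pos_nonneg less_irrefl zero_le_power2 zero_less_one)
  have "(4 * m / (1 + L\<^sup>2) + 2 * L / m) * (4 * (1 + L\<^sup>2) / m + 2 * L / m)
     = 16 + 8 * L / (1 + L\<^sup>2) + 8 * (1 + L\<^sup>2) * L / m\<^sup>2 + 4 * L\<^sup>2 / m\<^sup>2"
  proof -
    define r where "r = 1 + L\<^sup>2"
    have "r \<noteq> 0" using L20 by (simp add: r_def)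
    then have "(4 * m / r + 2 * L / m) * (4 * r / m + 2 * L / m) = 16 + 8 * L / r + 8 * r * L / m\<^sup>2 + 4 * L\<^sup>2 / m\<^sup>2"
      using m by (simp add: field_simps power2_eq_square)
    then show ?thesis by (simp add: r_def)
  qed
  also have "\<dots> \<le> 4 * M\<^sup>2 * (1 + 2 * X) + 4 * M\<^sup>2 * X\<^sup>2 + 4 * M * X" using i ii iii iv by linarith
  also have "\<dots> \<le> (1 + 2 * M * (1 + X))\<^sup>2" using M0 by (simp add: power2_eq_square algebra_simps)
  also have "1 + 2 * M * (1 + X) = 2 * C_1 L m - 1" by (simp add: C_1_def M_def X_def)
  finally show ?thesis .
qed

text \<open>\<open>E\<close> is the energy inequality for the discrete system and \<open>G\<close> expresses the initial trace through the
terminal one. The residual term \<open>r\<close> enters them with opposite signs. Adding \<open>m / (2 L)\<close> times \<open>G\<close> to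
\<open>E\<close> turns the mixed term into \<open>m s \<zeta>\<close>, which the coercive terms absorb, and leaves
\<open>r\<close> with a factor in \<open>[0, 1]\<close>. The result is a quadratic form in \<open>s + \<zeta>\<close> and \<open>g\<close> bounded by a linear
one.
\<close>

lemma estimator_stability:
  fixes m L D s \<zeta> \<tau> g r :: real
  assumes m: "m > 0" "m \<le> L" and nn: "D \<ge> 0" "s \<ge> 0" "\<zeta> \<ge> 0" "g \<ge> 0"
    and R: "R = sqrt (1 + L\<^sup>2)"
    and E: "m * s\<^sup>2 + m * \<zeta>\<^sup>2 + \<tau>\<^sup>2 \<le> R * D * s + r + D * g"
    and r: "r \<le> R * D * \<zeta>"
    and G: "g\<^sup>2 \<le> \<tau>\<^sup>2 + 2 * (L * s * \<zeta>) - 2 * r"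
  shows "s + \<zeta> + R / m * (D + g) \<le> 2 * C_1 L m * R / m * D"
proof -
  have L: "L > 0" using m by simp
  have R0: "R > 0" "R\<^sup>2 = 1 + L\<^sup>2" using R by (auto simp: add_pos_nonneg)
  \<comment> \<open>\<open>\<kappa> / 2\<close> is the weight of \<open>G\<close>\<close>
  define \<kappa> where "\<kappa> = m / L"
  have \<kappa>: "0 < \<kappa>" "\<kappa> \<le> 1" using m L by (auto simp: \<kappa>_def)
  define p where "p = s + \<zeta>"
  define Q where "Q = m / 4 * p\<^sup>2 + \<kappa> / 2 * g\<^sup>2"
  have Q0: "Q \<ge> 0" using m \<kappa> by (simp add: Q_def)
  have Q: "Q \<le> D * (R * p + g)"
  proof -
    have "\<kappa> / 2 * g\<^sup>2 \<le> \<kappa> / 2 * (\<tau>\<^sup>2 + 2 * (L * s * \<zeta>) - 2 * r)" using G \<kappa> by (intro mult_left_mono) auto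
    also have "\<dots> = \<kappa> / 2 * \<tau>\<^sup>2 + m * (s * \<zeta>) - \<kappa> * r" using L by (simp add: \<kappa>_def field_simps)
    also have "\<kappa> / 2 * \<tau>\<^sup>2 \<le> 1 * \<tau>\<^sup>2" using \<kappa> by (intro mult_right_mono) auto
    finally have "m * s\<^sup>2 + m * \<zeta>\<^sup>2 + \<kappa> / 2 * g\<^sup>2 \<le> R * D * s + (1 - \<kappa>) * r + D * g + m * (s * \<zeta>)"
      using E by (simp add: algebra_simps)
    moreover have "(1 - \<kappa>) * r \<le> 1 * (R * D * \<zeta>)"
    proof -
      have "(1 - \<kappa>) * r \<le> (1 - \<kappa>) * (R * D * \<zeta>)" using r \<kappa> by (intro mult_left_mono) auto
      also have "\<dots> \<le> 1 * (R * D * \<zeta>)" using \<kappa> R0 nn by (intro mult_right_mono) auto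
      finally show ?thesis .
    qed
    moreover have "m / 4 * p\<^sup>2 + m * (s * \<zeta>) \<le> m * s\<^sup>2 + m * \<zeta>\<^sup>2"
    proof -
      have "m * (s * \<zeta>) \<le> m * ((s\<^sup>2 + \<zeta>\<^sup>2) / 2)" using sum_squares_bound[of s \<zeta>] m by (intro mult_left_mono) auto
      then have "m * (s * \<zeta>) \<le> (m * s\<^sup>2 + m * \<zeta>\<^sup>2) / 2" by (simp add: distrib_left)
      moreover have eq: "m / 4 * p\<^sup>2 = (m * s\<^sup>2 + m * \<zeta>\<^sup>2) / 4 + m * (s * \<zeta>) / 2"
        by (simp add: p_def power2_sum distrib_left add_divide_distrib)
      ultimately show ?thesis unfolding eq by argo
    qed
    ultimately show ?thesis by (simp add: Q_def p_def algebra_simps)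
  qed
  \<comment> \<open>the squared norms, dual to \<open>Q\<close>, of the linear forms \<open>R * p + g\<close> and \<open>m / R * p + g\<close>\<close>
  define \<alpha> where "\<alpha> = 4 * (1 + L\<^sup>2) / m + 2 * L / m"
  define \<beta> where "\<beta> = 4 * m / (1 + L\<^sup>2) + 2 * L / m"
  have \<alpha>0: "\<alpha> \<ge> 0" "\<beta> \<ge> 0" using m L by (auto simp: \<alpha>_def \<beta>_def add_nonneg_nonneg)
  have "(R * p + g)\<^sup>2 \<le> \<alpha> * Q"
    using weighted_Cauchy_Schwarz[of "m/4" "\<kappa>/2" R p 1 g] m \<kappa> R0 L by (simp add: \<alpha>_def Q_def \<kappa>_def mult.commute)
  have "Q\<^sup>2 \<le> D\<^sup>2 * (\<alpha> * Q)"
  proof -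
    have "Q\<^sup>2 \<le> (D * (R * p + g))\<^sup>2" using Q Q0 by (intro power_mono)
    also have "\<dots> = D\<^sup>2 * (R * p + g)\<^sup>2" by (simp add: power_mult_distrib)
    also have "\<dots> \<le> D\<^sup>2 * (\<alpha> * Q)" using \<open>(R * p + g)\<^sup>2 \<le> \<alpha> * Q\<close> by (intro mult_left_mono) auto
    finally show ?thesis .
  qed
  then have Qle: "Q \<le> D\<^sup>2 * \<alpha>"
  proof (cases "Q = 0")
    case False
    then have "Q > 0" using Q0 by simp
    then show ?thesis using \<open>Q\<^sup>2 \<le> _\<close> by (simp add: power2_eq_square mult.assoc[symmetric])
  qed (use \<alpha>0 in simp)
  have "(m / R * p + g)\<^sup>2 \<le> \<beta> * Q"
    using weighted_Cauchy_Schwarz[of "m/4" "\<kappa>/2" "m/R" p 1 g] m \<kappa> R0 L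
    by (simp add: \<beta>_def Q_def \<kappa>_def mult.commute power_divide power2_eq_square[of m])
  also have "\<dots> \<le> \<beta> * (D\<^sup>2 * \<alpha>)" using Qle \<alpha>0 by (intro mult_left_mono)
  also have "\<dots> = D\<^sup>2 * (\<beta> * \<alpha>)" by (simp add: mult_ac)
  also have "\<dots> \<le> D\<^sup>2 * (2 * C_1 L m - 1)\<^sup>2"
    unfolding \<alpha>_def \<beta>_def by (intro mult_left_mono stability_constant_bound m) auto
  also have "\<dots> = (D * (2 * C_1 L m - 1))\<^sup>2" by (simp add: power_mult_distrib)
  finally have \<Phi>: "m / R * p + g \<le> D * (2 * C_1 L m - 1)"
  proof (rule power2_le_imp_le)
    have "0 < m_S L m" using m_S_facts[OF m(1) L] by simp
    then have "C_1 L m \<ge> 1" by (simp add: C_1_def)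
    then show "0 \<le> D * (2 * C_1 L m - 1)" using nn by simp
  qed
  have "s + \<zeta> + R / m * (D + g) = R / m * (m / R * p + g + D)" using m R0 by (simp add: p_def field_simps)
  also have "\<dots> \<le> R / m * (D * (2 * C_1 L m - 1) + D)" using \<Phi> m R0 by (intro mult_left_mono) auto
  also have "\<dots> = 2 * C_1 L m * R / m * D" by (simp add: algebra_simps)
  finally show ?thesis .
qed

text \<open>With \<open>a = m_S L m\<close> and \<open>b = L_S L m\<close> the quadratic inequality forces \<open>x \<le> b / a D + \<eta> (1 / a + 1 / b)\<close>:
beyond this bound the product of \<open>x > b / a D\<close> and \<open>a x - b D - \<eta> > \<eta> a / b\<close> would exceed \<open>\<eta> D\<close>,
contrary to the hypothesis. As \<open>L / m \<ge> 1\<close>, the factor \<open>1 / a + 1 / b\<close> is at most \<open>L_Ninv L m * L\<close>.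
\<close>

lemma quadratic_error_bound:
  fixes m L x D \<eta> K :: real
  assumes m: "m > 0" "m \<le> L" and nn: "x \<ge> 0" "D \<ge> 0" "\<eta> \<ge> 0"
    and q: "m_S L m * x\<^sup>2 \<le> L_S L m * x * D + \<eta> * (x + D)"
    and \<eta>: "\<eta> \<le> K * D"
  shows "x \<le> (L_S L m / m_S L m + L_Ninv L m * L * K) * D"
proof -
  have L: "L > 0" using m by simp
  define a b where "a = m_S L m" and "b = L_S L m"
  have a: "a > 0" using m_S_facts[OF m(1) L] by (simp add: a_def)
  have b: "b \<ge> 1" using L_S_facts by (simp add: b_def)
  have "x \<le> b / a * D + \<eta> * (1 / a + 1 / b)"
  proof (rule ccontr)
    assume "\<not> ?thesis"
    then have x: "x > b / a * D + \<eta> * (1 / a + 1 / b)" by simp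
    have "0 \<le> b / a * D" "0 \<le> \<eta> * (1 / a + 1 / b)" using a b nn by auto
    then have x1: "x > b / a * D" "x > 0" using x nn(3) a b
      by (smt (verit) q a_def b_def mult_nonneg_nonneg)+
    have "a * x > b * D + \<eta> + \<eta> * a / b"
    proof -
      have "a * x > a * (b / a * D + \<eta> * (1 / a + 1 / b))" using x a by (rule mult_strict_left_mono)
      also have "a * (b / a * D + \<eta> * (1 / a + 1 / b)) = b * D + \<eta> + \<eta> * a / b" using a b by (simp add: field_simps)
      finally show ?thesis .
    qed
    then have "(a * x - b * D - \<eta>) > \<eta> * a / b" by simp
    moreover have "\<eta> * a / b \<ge> 0" using nn a b by simp
    ultimately have "(\<eta> * a / b) * (b / a * D) < (a * x - b * D - \<eta>) * x"
      using x1 a b nn by (intro mult_strict_mono') auto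
    also have "\<dots> \<le> \<eta> * D" using q by (simp add: a_def b_def power2_eq_square algebra_simps)
    finally show False using a b by simp
  qed
  also have "\<eta> * (1 / a + 1 / b) \<le> \<eta> * (L_Ninv L m * L)"
  proof (intro mult_left_mono nn)
    have "1 / b \<le> 1" using b by simp
    moreover have "1 \<le> L / m" using m by simp
    moreover have "1 / a \<le> max 1 (1 / m) * (1 / a) * (1 + 1 / m) * L"
    proof -
      have "1 \<le> (1 + 1 / m) * L" using \<open>1 \<le> L / m\<close> L by (simp add: distrib_right)
      then have "1 * (1 / a) * 1 \<le> max 1 (1 / m) * (1 / a) * ((1 + 1 / m) * L)"
        using a m L by (intro mult_mono mult_nonneg_nonneg) auto
      then show ?thesis by (simp add: mult_ac)
    qed
    ultimately show "1 / a + 1 / b \<le> L_Ninv L m * L"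
      by (simp add: L_Ninv_def a_def[symmetric] distrib_right)
  qed
  also have "\<eta> * (L_Ninv L m * L) \<le> (K * D) * (L_Ninv L m * L)"
    using \<eta> m L a by (intro mult_right_mono) (auto simp: L_Ninv_def a_def[symmetric] intro!: mult_nonneg_nonneg add_nonneg_nonneg)
  finally show ?thesis by (simp add: a_def b_def algebra_simps)
qed

section \<open>The error estimate\<close>

locale monotone_evolution =
  fixes j :: "'v::{real_inner,complete_space} \<Rightarrow> 'h::{real_inner,complete_space}"
    and A :: "real \<Rightarrow> 'v \<Rightarrow> 'v \<Rightarrow>\<^sub>L real"
    and T L m :: real
  assumes gelfand: "gelfand_triple j" and T_pos: "T > 0"
    and L_pos: "L > 0" and m_pos: "m > 0"
    and into_dual: "maps_into_dual T A"
    and lipschitz: "lipschitz_into_dual T A L"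
    and monotone: "strongly_monotone T A m"
begin

abbreviation "N \<equiv> L2_norm T"
abbreviation "DN \<equiv> dual_norm (L2 T) (L2_norm T)"
abbreviation "a \<equiv> A_op T A"
abbreviation "d \<equiv> dt j T"
abbreviation "X \<equiv> X_space j T"
abbreviation "trT \<equiv> time_trace j T T"
abbreviation "tr0 \<equiv> time_trace j T 0"

lemma bounded_linear_j: "bounded_linear j" using gelfand by (simp add: gelfand_triple_def)

lemma X_diff: "w \<in> X \<Longrightarrow> v \<in> X \<Longrightarrow> (\<lambda>t. w t - v t) \<in> X"
  using X_space_lincomb[OF bounded_linear_j, of w T v 1 "-1"] by simp

lemma d_diff: "w \<in> X \<Longrightarrow> v \<in> X \<Longrightarrow> z \<in> L2 T \<Longrightarrow> d (\<lambda>t. w t - v t) z = d w z - d v z"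
  using dt_lincomb[OF bounded_linear_j, of w T v z 1 "-1"] by simp

lemma tr_diff:
  assumes "w \<in> X" "v \<in> X" "t \<in> {0..T}"
  shows "time_trace j T t (\<lambda>s. w s - v s) = time_trace j T t w - time_trace j T t v"
  using time_trace_lincomb[OF T_pos bounded_linear_j assms, of 1 "-1"] by simp

lemma dual_diff_right:
  assumes "f \<in> dual (L2 T) N" "w \<in> L2 T" "v \<in> L2 T"
  shows "f (\<lambda>t. w t - v t) = f w - f v"
proof -
  have "f (\<lambda>t. w t + (-1) *\<^sub>R v t) = f w + (-1) * f v"
    using assms L2_scale[OF assms(3), of "-1"] by (simp only: dual_def linear_functional_on_def mem_Collect_eq)
  then show ?thesis by simp
qed

lemma dual_diff:
  assumes f: "f \<in> dual (L2 T) N" and g: "g \<in> dual (L2 T) N"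
  shows "(\<lambda>v. f v - g v) \<in> dual (L2 T) N"
proof -
  obtain C D where "\<And>v. v \<in> L2 T \<Longrightarrow> \<bar>f v\<bar> \<le> C * N v" "\<And>v. v \<in> L2 T \<Longrightarrow> \<bar>g v\<bar> \<le> D * N v"
    using f g by (auto simp: dual_def)
  then have "\<bar>f v - g v\<bar> \<le> (C + D) * N v" if "v \<in> L2 T" for v
    using that by (smt (verit) distrib_right)
  then show ?thesis
    using f g by (auto simp: dual_def linear_functional_on_def right_diff_distrib)
qed

lemma d_dual: "w \<in> X \<Longrightarrow> d w \<in> dual (L2 T) N" by (rule dt_dual)

lemma a_dual: "w \<in> L2 T \<Longrightarrow> a w \<in> dual (L2 T) N"
  using into_dual by (simp add: maps_into_dual_def)

lemma a_lipschitz: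
  assumes "w \<in> L2 T" "v \<in> L2 T" "z \<in> L2 T"
  shows "\<bar>a w z - a v z\<bar> \<le> L * N (\<lambda>t. w t - v t) * N z"
proof -
  have "\<bar>a w z - a v z\<bar> \<le> DN (\<lambda>z. a w z - a v z) * N z"
    using dual_norm_bound[OF dual_diff[OF a_dual[OF assms(1)] a_dual[OF assms(2)]] assms(3)] .
  also have "\<dots> \<le> L * N (\<lambda>t. w t - v t) * N z"
    using lipschitz assms by (intro mult_right_mono) (auto simp: lipschitz_into_dual_def)
  finally show ?thesis .
qed

lemma a_monotone:
  assumes "w \<in> L2 T" "v \<in> L2 T"
  shows "m * (N (\<lambda>t. w t - v t))\<^sup>2 \<le> a w (\<lambda>t. w t - v t) - a v (\<lambda>t. w t - v t)"
  using monotone assms by (simp add: strongly_monotone_def)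

text \<open>Testing monotonicity and Lipschitz continuity with a single nonzero function compares the two
constants.
\<close>

lemma m_le_L:
  fixes S :: "(real \<Rightarrow> 'v) set"
  assumes "nontrivial T S" "S \<subseteq> L2 T"
  shows "m \<le> L"
proof -
  obtain w :: "real \<Rightarrow> 'v" where w: "w \<in> L2 T" "\<not> (AE t in Xi T. w t = 0)"
    using assms unfolding nontrivial_def by blast
  have "N w \<noteq> 0"
  proof
    assume "N w = 0"
    then have "(\<integral>t. (norm (w t))\<^sup>2 \<partial>Xi T) = 0" using L2_norm_sq[of T w] by simp
    then have "AE t in Xi T. (norm (w t))\<^sup>2 = 0"
      using L2_integrable[OF w(1)] by (simp add: integral_nonneg_eq_0_iff_AE)
    then show False using w(2) by simp
  qed
  then have Nw: "N w > 0" using L2_norm_nonneg[of T w] by linarith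
  have "m * (N w)\<^sup>2 \<le> L * N w * N w"
    using a_monotone[OF w(1) L2_const[of 0]] a_lipschitz[OF w(1) L2_const[of 0] w(1)] by simp
  then show ?thesis using Nw by (simp add: power2_eq_square mult.assoc)
qed

lemma X_norm_sq: "(X_norm j T w)\<^sup>2 = (N w)\<^sup>2 + (DN (d w))\<^sup>2 + (norm (trT w))\<^sup>2"
  by (simp add: X_norm_def add_nonneg_nonneg)

lemma X_norm_nonneg: "X_norm j T w \<ge> 0" by (simp add: X_norm_def)

text \<open>The \<open>X\<close>-norm contains the terminal trace only; the energy identity shows that it dominates the
initial trace with constant one.
\<close>

lemma tr0_le_X_norm:
  assumes w: "w \<in> X" shows "norm (tr0 w) \<le> X_norm j T w"
proof (rule power2_le_imp_le[OF _ X_norm_nonneg])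
  have "(norm (tr0 w))\<^sup>2 = (norm (trT w))\<^sup>2 - 2 * d w w"
    using dt_self[OF T_pos bounded_linear_j w] by simp
  also have "\<dots> \<le> (norm (trT w))\<^sup>2 + 2 * (DN (d w) * N w)"
    using dual_norm_bound[OF d_dual[OF w] X_space_L2[OF w]] by linarith
  also have "\<dots> \<le> (norm (trT w))\<^sup>2 + ((DN (d w))\<^sup>2 + (N w)\<^sup>2)"
    using sum_squares_bound[of "DN (d w)" "N w"] by simp
  finally show "(norm (tr0 w))\<^sup>2 \<le> (X_norm j T w)\<^sup>2" by (simp add: X_norm_sq)
qed

text \<open>The functional on the left is the residual of \<open>w\<close> in the equation solved by \<open>u\<close>.
\<close>

lemma residual_bound:
  assumes u: "u \<in> X" and w: "w \<in> X" and v: "v \<in> L2 T"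
  defines "D \<equiv> X_norm j T (\<lambda>t. u t - w t)"
  shows "\<bar>a u v - a w v + d (\<lambda>t. u t - w t) v\<bar> \<le> sqrt (1 + L\<^sup>2) * D * N v"
proof -
  let ?e = "\<lambda>t. u t - w t"
  have e: "?e \<in> X" by (rule X_diff[OF u w])
  have "\<bar>a u v - a w v + d ?e v\<bar> \<le> L * N ?e * N v + DN (d ?e) * N v"
    using a_lipschitz[OF X_space_L2[OF u] X_space_L2[OF w] v] dual_norm_bound[OF d_dual[OF e] v] by linarith
  also have "\<dots> = (L * N ?e + 1 * DN (d ?e)) * N v" by (simp add: distrib_right)
  also have "\<dots> \<le> (sqrt (1 + L\<^sup>2) * D) * N v"
  proof (rule mult_right_mono)
    have "L * N ?e + 1 * DN (d ?e) + 0 * norm (trT ?e) \<le> sqrt (L\<^sup>2 + 1\<^sup>2 + 0\<^sup>2) * sqrt ((N ?e)\<^sup>2 + (DN (d ?e))\<^sup>2 + (norm (trT ?e))\<^sup>2)"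
      by (rule Cauchy_Schwarz_3)
    then show "L * N ?e + 1 * DN (d ?e) \<le> sqrt (1 + L\<^sup>2) * D" by (simp add: D_def X_norm_def add.commute)
  qed simp
  finally show ?thesis by (simp add: mult.assoc)
qed

end

text \<open>The condition \<open>m \<le> L\<close> is a consequence of \<open>m_le_L\<close> as soon as there is a nontrivial subspace.
\<close>

locale discrete_solution = monotone_evolution j A T L m
  for j :: "'v::{real_inner,complete_space} \<Rightarrow> 'h::{real_inner,complete_space}" and A T L m +
  fixes Xd Yd :: "(real \<Rightarrow> 'v) set"
    and l :: "(real \<Rightarrow> 'v) \<Rightarrow> real" and u0 :: 'h
    and u ud \<theta>d :: "real \<Rightarrow> 'v"
  assumes Xd: "closed_subspace (X_space j T) (X_norm j T) Xd"
    and Yd: "closed_subspace (L2 T) (L2_norm T) Yd"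
    and Xd_Yd: "Xd \<subseteq> Yd" and m_L: "m \<le> L"
    and u: "u \<in> X_space j T" "\<And>v. v \<in> L2 T \<Longrightarrow> dt j T u v + A_op T A u v = l v" "time_trace j T 0 u = u0"
    and \<theta>d: "\<theta>d \<in> Yd" and ud: "ud \<in> Xd"
    and first_equation: "\<And>v. v \<in> Yd \<Longrightarrow> A_op T A \<theta>d v + dt j T ud v = l v"
    and second_equation: "\<And>w. w \<in> Xd \<Longrightarrow>
      dt j T w \<theta>d - (A_op T A ud w + time_trace j T T ud \<bullet> time_trace j T T w) = - (l w + u0 \<bullet> time_trace j T 0 w)"
begin

lemma Xd_X: "w \<in> Xd \<Longrightarrow> w \<in> X" using Xd by (auto simp: closed_subspace_def)
lemma Yd_L2: "w \<in> Yd \<Longrightarrow> w \<in> L2 T" using Yd by (auto simp: closed_subspace_def)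

lemma closed_subspace_diff:
  assumes S: "closed_subspace Z n S" and "w \<in> S" "v \<in> S"
  shows "(\<lambda>t. w t - v t) \<in> S"
proof -
  have add: "\<forall>v\<in>S. \<forall>w\<in>S. (\<lambda>t. v t + w t) \<in> S" and scale: "\<forall>c. \<forall>v\<in>S. (\<lambda>t. c *\<^sub>R v t) \<in> S"
    using S unfolding closed_subspace_def by simp_all
  have "(\<lambda>t. (-1) *\<^sub>R v t) \<in> S" by (rule bspec[OF spec[OF scale] assms(3)])
  then have "(\<lambda>t. w t + (-1) *\<^sub>R v t) \<in> S" by (rule bspec[OF bspec[OF add assms(2)]])
  then show ?thesis by simp
qed

lemma tr_diffs:
  assumes "w \<in> X" "v \<in> X"
  shows "trT (\<lambda>s. w s - v s) = trT w - trT v" "tr0 (\<lambda>s. w s - v s) = tr0 w - tr0 v"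
  using assms T_pos by (auto intro!: tr_diff)

text \<open>Integration by parts trades the initial trace in the second discrete equation for the terminal one.
The outcome says that \<open>u\<close> and \<open>(\<theta>d, ud)\<close> satisfy the same second equation on \<open>Xd\<close>.
\<close>

lemma galerkin_orthogonality:
  assumes z: "z \<in> Xd"
  shows "d z \<theta>d - d z u + (a u z - a ud z) + (trT u - trT ud) \<bullet> trT z = 0"
proof -
  have zL: "z \<in> L2 T" by (rule X_space_L2[OF Xd_X[OF z]])
  show ?thesis
    using second_equation[OF z] u(2)[OF zL] dt_integration_by_parts[OF T_pos bounded_linear_j u(1) Xd_X[OF z]]
    by (simp add: u(3) inner_diff_left)
qed

text \<open>Adding the two discrete equations for the differences to \<open>w\<close> cancels the coupling terms
\<open>d z \<theta>d\<close>, as the system is of saddle point type; what remains on the right is the residual of \<open>w\<close> and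
the initial trace of \<open>u - w\<close>.
\<close>

lemma estimator_bound:
  assumes w: "w \<in> Xd"
  shows "N (\<lambda>t. \<theta>d t - ud t) + sqrt (1 + L\<^sup>2) / m * norm (u0 - tr0 ud)
    \<le> 2 * C_1 L m * sqrt (1 + L\<^sup>2) / m * X_norm j T (\<lambda>t. u t - w t)"
proof -
  define R where "R = sqrt (1 + L\<^sup>2)"
  define D where "D = X_norm j T (\<lambda>t. u t - w t)"
  define e where "e = (\<lambda>t. u t - w t)"
  define z where "z = (\<lambda>t. ud t - w t)"
  define y where "y = (\<lambda>t. \<theta>d t - w t)"
  define r where "r v = a u v - a w v + d e v" for v
  have R0: "R \<ge> 0" and D0: "D \<ge> 0" by (simp_all add: R_def D_def X_norm_nonneg)
  have wX: "w \<in> X" and udX: "ud \<in> X" using Xd_X w ud by auto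
  have wL: "w \<in> L2 T" and udL: "ud \<in> L2 T" and uL: "u \<in> L2 T" and \<theta>L: "\<theta>d \<in> L2 T"
    using X_space_L2 wX udX u(1) Yd_L2 \<theta>d by auto
  have zXd: "z \<in> Xd" unfolding z_def by (rule closed_subspace_diff[OF Xd ud w])
  have zX: "z \<in> X" and zYd: "z \<in> Yd" using Xd_X zXd Xd_Yd by auto
  have yYd: "y \<in> Yd" unfolding y_def by (rule closed_subspace_diff[OF Yd \<theta>d]) (use w Xd_Yd in auto)
  have zL: "z \<in> L2 T" and yL: "y \<in> L2 T" using Yd_L2 zYd yYd by auto
  have eX: "e \<in> X" unfolding e_def by (rule X_diff[OF u(1) wX])
  have rb: "\<bar>r v\<bar> \<le> R * D * N v" if "v \<in> L2 T" for v
    using residual_bound[OF u(1) wX that] by (simp add: r_def R_def D_def e_def)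
  have dz: "d z v = d ud v - d w v" if "v \<in> L2 T" for v
    unfolding z_def by (rule d_diff[OF udX wX that])
  have de: "d e v = d u v - d w v" if "v \<in> L2 T" for v
    unfolding e_def by (rule d_diff[OF u(1) wX that])
  have first: "a \<theta>d v - a w v + d z v = r v" if "v \<in> Yd" for v
    using first_equation[OF that] u(2)[OF Yd_L2[OF that]] dz[OF Yd_L2[OF that]] de[OF Yd_L2[OF that]]
    by (simp add: r_def)
  have dzy: "d z y = d z \<theta>d - d z w"
    unfolding y_def by (rule dual_diff_right[OF d_dual[OF zX] \<theta>L wL])
  have trz: "trT z = trT ud - trT w" "tr0 z = tr0 ud - tr0 w" unfolding z_def by (rule tr_diffs[OF udX wX])+
  have tre: "tr0 e = u0 - tr0 w" unfolding e_def u(3)[symmetric] by (rule tr_diffs[OF u(1) wX])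
  have parts: "d w z + d z w = trT w \<bullet> trT z - tr0 w \<bullet> tr0 z"
    by (rule dt_integration_by_parts[OF T_pos bounded_linear_j wX zX])
  have energy: "(a \<theta>d y - a w y) + (a ud z - a w z) + (norm (trT z))\<^sup>2 = r y + r z + tr0 e \<bullet> tr0 z"
  proof -
    have "a ud z = d z \<theta>d - trT ud \<bullet> trT z + (a u z + d u z) + u0 \<bullet> tr0 z"
      using second_equation[OF zXd] u(2)[OF zL] by simp
    moreover have "trT ud \<bullet> trT z = (norm (trT z))\<^sup>2 + trT w \<bullet> trT z"
      by (simp add: trz power2_norm_eq_inner inner_diff_left)
    moreover have "a \<theta>d y - a w y = r y - (d z \<theta>d - d z w)" using first[OF yYd] dzy by simp
    moreover have "r z = a u z - a w z + d u z - d w z" using de[OF zL] by (simp add: r_def)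
    moreover have "tr0 e \<bullet> tr0 z = u0 \<bullet> tr0 z - tr0 w \<bullet> tr0 z" by (simp add: tre inner_diff_left)
    ultimately show ?thesis using parts by linarith
  qed
  have E: "m * (N y)\<^sup>2 + m * (N z)\<^sup>2 + (norm (trT z))\<^sup>2 \<le> R * D * N y + r z + D * norm (tr0 z)"
  proof -
    have "tr0 e \<bullet> tr0 z \<le> norm (tr0 e) * norm (tr0 z)" by (rule norm_cauchy_schwarz)
    also have "\<dots> \<le> D * norm (tr0 z)"
      using tr0_le_X_norm[OF eX] by (intro mult_right_mono) (auto simp: D_def e_def)
    finally have "tr0 e \<bullet> tr0 z \<le> D * norm (tr0 z)" .
    moreover have "m * (N y)\<^sup>2 \<le> a \<theta>d y - a w y" unfolding y_def by (rule a_monotone[OF \<theta>L wL])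
    moreover have "m * (N z)\<^sup>2 \<le> a ud z - a w z" unfolding z_def by (rule a_monotone[OF udL wL])
    moreover have "r y \<le> R * D * N y" using rb[OF yL] by simp
    ultimately show ?thesis using energy by linarith
  qed
  have G: "(norm (tr0 z))\<^sup>2 \<le> (norm (trT z))\<^sup>2 + 2 * (L * N y * N z) - 2 * r z"
  proof -
    have "2 * d z z = (norm (trT z))\<^sup>2 - (norm (tr0 z))\<^sup>2" by (rule dt_self[OF T_pos bounded_linear_j zX])
    moreover have "d z z = r z - (a \<theta>d z - a w z)" using first[OF zYd] by simp
    moreover have "a \<theta>d z - a w z \<le> L * N y * N z" using a_lipschitz[OF \<theta>L wL zL] by (simp add: y_def)
    ultimately show ?thesis by linarith
  qed
  have "N y + N z + R / m * (D + norm (tr0 z)) \<le> 2 * C_1 L m * R / m * D"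
    by (rule estimator_stability[OF m_pos m_L D0 _ _ _ R_def E _ G]) (use rb[OF zL] in auto)
  moreover have "N (\<lambda>t. \<theta>d t - ud t) \<le> N y + N z"
  proof -
    have "N (\<lambda>t. y t + (-1) *\<^sub>R z t) \<le> N y + N (\<lambda>t. (-1) *\<^sub>R z t)" by (rule L2_norm_triangle[OF yL L2_scale[OF zL]])
    then show ?thesis unfolding L2_norm_scale by (simp add: y_def z_def)
  qed
  moreover have "R / m * norm (u0 - tr0 ud) \<le> R / m * (D + norm (tr0 z))"
  proof (rule mult_left_mono)
    have "u0 - tr0 ud = tr0 e - tr0 z" by (simp add: tre trz)
    then show "norm (u0 - tr0 ud) \<le> D + norm (tr0 z)"
      using norm_triangle_ineq4[of "tr0 e" "tr0 z"] tr0_le_X_norm[OF eX] by (simp add: D_def e_def)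
  qed (use R0 m_pos in simp)
  ultimately show ?thesis unfolding R_def[symmetric] D_def[symmetric] by linarith
qed

text \<open>The Cea-type argument for the form \<open>B\<close>: coercive at \<open>e = u - ud\<close>, bounded at \<open>h = u - w\<close>, and small at
\<open>z = h - e \<in> Xd\<close> because the discrete solution satisfies the second equation with \<open>\<theta>d\<close> in place of
\<open>\<theta>\<close>.
\<close>

lemma error_inequality:
  assumes w: "w \<in> Xd" and \<theta>: "\<theta> \<in> L2 T" "\<And>v. v \<in> L2 T \<Longrightarrow> a \<theta> v = l v - d ud v"
  defines "x \<equiv> X_norm j T (\<lambda>t. u t - ud t)" and "D \<equiv> X_norm j T (\<lambda>t. u t - w t)"
    and "\<eta> \<equiv> N (\<lambda>t. \<theta> t - \<theta>d t)"
  shows "m_S L m * x\<^sup>2 \<le> L_S L m * x * D + \<eta> * (x + D)"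
proof -
  define e where "e = (\<lambda>t. u t - ud t)"
  define h where "h = (\<lambda>t. u t - w t)"
  define z where "z = (\<lambda>t. ud t - w t)"
  define q where "q = (\<lambda>t. \<theta> t - u t)"
  have wX: "w \<in> X" and udX: "ud \<in> X" using Xd_X w ud by auto
  have wL: "w \<in> L2 T" and udL: "ud \<in> L2 T" and uL: "u \<in> L2 T" and \<theta>L: "\<theta>d \<in> L2 T"
    using X_space_L2 wX udX u(1) Yd_L2 \<theta>d by auto
  have zXd: "z \<in> Xd" unfolding z_def by (rule closed_subspace_diff[OF Xd ud w])
  have zX: "z \<in> X" using Xd_X zXd by auto
  have eX: "e \<in> X" unfolding e_def by (rule X_diff[OF u(1) udX])
  have hX: "h \<in> X" unfolding h_def by (rule X_diff[OF u(1) wX])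
  note eL = X_space_L2[OF eX] and hL = X_space_L2[OF hX] and zL = X_space_L2[OF zX]
  have qL: "q \<in> L2 T" unfolding q_def by (rule L2_diff[OF \<theta>(1) uL])
  have z_eq: "z = (\<lambda>t. h t - e t)" by (simp add: z_def h_def e_def)
  have de: "d e v = a \<theta> v - a u v" if "v \<in> L2 T" for v
    using d_diff[OF u(1) udX that] u(2)[OF that] \<theta>(2)[OF that] by (simp add: e_def)
  have de_q: "m * (N q)\<^sup>2 \<le> d e q"
    using a_monotone[OF \<theta>(1) uL] de[OF qL] by (simp add: q_def)
  have DNe0: "DN (d e) \<ge> 0" and DNh0: "DN (d h) \<ge> 0" by (intro dual_norm_nonneg d_dual eX hX)+
  have DNe: "DN (d e) \<le> L * N q"
    by (rule dual_norm_le) (use de a_lipschitz[OF \<theta>(1) uL] L_pos in \<open>auto simp: q_def\<close>)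
  have Nq: "m * N q \<le> DN (d e)"
  proof (cases "N q = 0")
    case False
    then have "N q > 0" using L2_norm_nonneg[of T q] by linarith
    moreover have "m * N q * N q \<le> DN (d e) * N q"
      using de_q dual_norm_bound[OF d_dual[OF eX] qL] by (simp add: power2_eq_square)
    ultimately show ?thesis by simp
  qed (use DNe0 in simp)
  define B where "B v = d v \<theta> - d v u + (a u v - a ud v) + trT e \<bullet> trT v" for v
  have tre: "trT e = trT u - trT ud" unfolding e_def by (rule tr_diffs[OF u(1) udX])
  have B_diff: "B z = B h - B e"
  proof -
    have "d z v = d h v - d e v" if "v \<in> L2 T" for v unfolding z_eq by (rule d_diff[OF hX eX that])
    moreover have "a v z = a v h - a v e" if "v \<in> L2 T" for v
      unfolding z_eq by (rule dual_diff_right[OF a_dual[OF that] hL eL])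
    moreover have "trT z = trT h - trT e" unfolding z_eq by (rule tr_diffs[OF hX eX])
    ultimately show ?thesis using \<theta>(1) uL udL by (simp add: B_def inner_diff_right)
  qed
  have Be: "m_S L m * x\<^sup>2 \<le> B e"
  proof -
    note S = m_S_facts[OF m_pos L_pos]
    have "m_S L m * (DN (d e))\<^sup>2 \<le> m / L\<^sup>2 * (L * N q)\<^sup>2"
      using S DNe DNe0 by (intro mult_mono power_mono) auto
    also have "\<dots> = m * (N q)\<^sup>2" using L_pos by (simp add: power_mult_distrib)
    also have "\<dots> \<le> d e \<theta> - d e u"
      using de_q dual_diff_right[OF d_dual[OF eX] \<theta>(1) uL] by (simp add: q_def)
    finally have "m_S L m * (DN (d e))\<^sup>2 \<le> d e \<theta> - d e u" .
    moreover have "m_S L m * (N e)\<^sup>2 \<le> a u e - a ud e"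
    proof -
      have "m_S L m * (N e)\<^sup>2 \<le> m * (N e)\<^sup>2" using S by (intro mult_right_mono) auto
      also have "\<dots> \<le> a u e - a ud e" unfolding e_def by (rule a_monotone[OF uL udL])
      finally show ?thesis .
    qed
    moreover have "m_S L m * (norm (trT e))\<^sup>2 \<le> 1 * (norm (trT e))\<^sup>2" using S by (intro mult_right_mono) auto
    ultimately show ?thesis
      unfolding x_def X_norm_sq e_def[symmetric] by (simp add: B_def distrib_left power2_norm_eq_inner)
  qed
  have Bh: "B h \<le> L_S L m * x * D"
  proof -
    have S: "1 \<le> L_S L m" "L \<le> L_S L m" "1 / m \<le> L_S L m" by (rule L_S_facts)+
    have "d h \<theta> - d h u \<le> DN (d h) * N q"
      using dual_diff_right[OF d_dual[OF hX] \<theta>(1) uL] dual_norm_bound[OF d_dual[OF hX] qL] by (simp add: q_def)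
    also have "\<dots> \<le> DN (d h) * (L_S L m * DN (d e))"
    proof (intro mult_left_mono DNh0)
      have "N q \<le> 1 / m * DN (d e)" using Nq m_pos by (simp add: field_simps)
      also have "\<dots> \<le> L_S L m * DN (d e)" using S DNe0 by (intro mult_right_mono)
      finally show "N q \<le> L_S L m * DN (d e)" .
    qed
    finally have 1: "d h \<theta> - d h u \<le> L_S L m * (DN (d e) * DN (d h))" by (simp add: mult_ac)
    have "a u h - a ud h \<le> L * (N e * N h)"
      using a_lipschitz[OF uL udL hL] by (simp add: e_def mult.assoc)
    also have "\<dots> \<le> L_S L m * (N e * N h)" using S by (intro mult_right_mono) auto
    finally have 2: "a u h - a ud h \<le> L_S L m * (N e * N h)" .
    have "trT e \<bullet> trT h \<le> 1 * (norm (trT e) * norm (trT h))" using norm_cauchy_schwarz by simp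
    also have "\<dots> \<le> L_S L m * (norm (trT e) * norm (trT h))" using S by (intro mult_right_mono) auto
    finally have "B h \<le> L_S L m * (N e * N h + DN (d e) * DN (d h) + norm (trT e) * norm (trT h))"
      using 1 2 by (simp add: B_def distrib_left)
    also have "\<dots> \<le> L_S L m * (x * D)"
      unfolding x_def D_def X_norm_def e_def[symmetric] h_def[symmetric]
      using S by (intro mult_left_mono Cauchy_Schwarz_3) auto
    finally show ?thesis by (simp add: mult.assoc)
  qed
  have Bz: "- B z \<le> \<eta> * (x + D)"
  proof -
    have "B z = d z \<theta> - d z \<theta>d"
      using galerkin_orthogonality[OF zXd] by (simp add: B_def tre)
    also have "\<dots> = d z (\<lambda>t. \<theta> t - \<theta>d t)" by (rule dual_diff_right[OF d_dual[OF zX] \<theta>(1) \<theta>L, symmetric])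
    finally have "- B z \<le> DN (d z) * \<eta>"
      using dual_norm_bound[OF d_dual[OF zX] L2_diff[OF \<theta>(1) \<theta>L]] by (simp add: \<eta>_def)
    also have "\<dots> \<le> (x + D) * \<eta>"
    proof (rule mult_right_mono)
      have le: "DN (d e) \<le> x" "DN (d h) \<le> D"
        unfolding x_def D_def X_norm_def e_def[symmetric] h_def[symmetric] by (rule real_le_rsqrt, simp add: add_nonneg_nonneg)+
      show "DN (d z) \<le> x + D"
      proof (rule dual_norm_le)
        fix v :: "real \<Rightarrow> 'v" assume v: "v \<in> L2 T"
        have "d z v = d h v - d e v" unfolding z_eq by (rule d_diff[OF hX eX v])
        then have "\<bar>d z v\<bar> \<le> (DN (d e) + DN (d h)) * N v"
          using dual_norm_bound[OF d_dual[OF eX] v] dual_norm_bound[OF d_dual[OF hX] v] by (simp add: distrib_right)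
        also have "\<dots> \<le> (x + D) * N v" using le by (intro mult_right_mono) auto
        finally show "\<bar>d z v\<bar> \<le> (x + D) * N v" .
      qed (use le DNe0 DNh0 in linarith)
    qed (simp add: \<eta>_def)
    finally show ?thesis by (simp add: mult.commute)
  qed
  show ?thesis using Be Bh Bz B_diff by linarith
qed

end

theorem theorem6p4:
  fixes j :: "'v::{real_inner,complete_space} \<Rightarrow> 'h::{real_inner,complete_space}"
    and A :: "real \<Rightarrow> 'v \<Rightarrow> 'v \<Rightarrow>\<^sub>L real"
    and T L_A m_A \<rho> :: real
    and Xd Yd :: "(real \<Rightarrow> 'v) set"
    and l :: "(real \<Rightarrow> 'v) \<Rightarrow> real" and u0 :: 'h
    and u ud \<theta>d \<theta>_exact :: "real \<Rightarrow> 'v"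
  assumes "gelfand_triple j" and "T > 0"
    and "L_A > 0" and "m_A > 0"
    and "maps_into_dual T A"
    and "lipschitz_into_dual T A L_A"
    and "strongly_monotone T A m_A"
    and "closed_subspace (X_space j T) (X_norm j T) Xd" and "nontrivial T Xd"
    and "closed_subspace (L2 T) (L2_norm T) Yd" and "nontrivial T Yd"
    and "(finite_dimensional T Xd \<and> finite_dimensional T Yd) \<or> (Xd = X_space j T \<and> Yd = L2 T)"
    and "Xd \<subseteq> Yd"
    and "l \<in> dual (L2 T) (L2_norm T)"
    and "u \<in> X_space j T"
    and "\<forall>v\<in>L2 T. dt j T u v + A_op T A u v = l v"
    and "time_trace j T 0 u = u0"
    and "\<theta>d \<in> Yd" and "ud \<in> Xd"
    and "N_op j T A Yd Xd (\<theta>d, ud) =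
           (restrict l Yd, restrict (\<lambda>w. - (l w + u0 \<bullet> time_trace j T 0 w)) Xd)"
    and "\<rho> > 0"
    and "\<theta>_exact \<in> L2 T"
    and "\<forall>v\<in>L2 T. A_op T A \<theta>_exact v = l v - dt j T ud v"
    and "L2_norm T (\<lambda>t. \<theta>_exact t - \<theta>d t) \<le>
           \<rho> * (L2_norm T (\<lambda>t. \<theta>d t - ud t) + sqrt (1 + L_A\<^sup>2) / m_A * norm (u0 - time_trace j T 0 ud))"
  shows "X_norm j T (\<lambda>t. u t - ud t) \<le>
           (L_S L_A m_A / m_S L_A m_A
             + L_Ninv L_A m_A * L_A * \<rho> * (2 * C_1 L_A m_A * sqrt (1 + L_A\<^sup>2) / m_A))
           * (INF w\<in>Xd. X_norm j T (\<lambda>t. u t - w t))"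
proof -
  interpret monotone_evolution j A T L_A m_A
    using assms(1-7) by unfold_locales
  have mL: "m_A \<le> L_A"
    by (rule m_le_L[OF assms(11)]) (use assms(10) in \<open>simp add: closed_subspace_def\<close>)
  have N: "restrict (\<lambda>v. A_op T A \<theta>d v + dt j T ud v) Yd = restrict l Yd"
    "restrict (\<lambda>w. dt j T w \<theta>d - (A_op T A ud w + time_trace j T T ud \<bullet> time_trace j T T w)) Xd
      = restrict (\<lambda>w. - (l w + u0 \<bullet> time_trace j T 0 w)) Xd"
    using assms(20) by (auto simp: N_op_def)
  interpret discrete_solution j A T L_A m_A Xd Yd l u0 u ud \<theta>d
  proof unfold_locales
    show "A_op T A \<theta>d v + dt j T ud v = l v" if "v \<in> Yd" for v
      using fun_cong[OF N(1), of v] that by simp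
    show "dt j T w \<theta>d - (A_op T A ud w + time_trace j T T ud \<bullet> time_trace j T T w) = - (l w + u0 \<bullet> time_trace j T 0 w)"
      if "w \<in> Xd" for w
      using fun_cong[OF N(2), of w] that by simp
  qed (use assms mL in auto)
  define K where "K = \<rho> * (2 * C_1 L_A m_A * sqrt (1 + L_A\<^sup>2) / m_A)"
  define c where "c = L_S L_A m_A / m_S L_A m_A + L_Ninv L_A m_A * L_A * K"
  let ?x = "X_norm j T (\<lambda>t. u t - ud t)"
  have bound: "?x \<le> c * X_norm j T (\<lambda>t. u t - w t)" if w: "w \<in> Xd" for w
  proof -
    define D where "D = X_norm j T (\<lambda>t. u t - w t)"
    define \<eta> where "\<eta> = L2_norm T (\<lambda>t. \<theta>_exact t - \<theta>d t)"
    have "\<eta> \<le> K * D"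
    proof -
      have "\<eta> \<le> \<rho> * (L2_norm T (\<lambda>t. \<theta>d t - ud t) + sqrt (1 + L_A\<^sup>2) / m_A * norm (u0 - time_trace j T 0 ud))"
        unfolding \<eta>_def by (rule assms(24))
      also have "\<dots> \<le> \<rho> * (2 * C_1 L_A m_A * sqrt (1 + L_A\<^sup>2) / m_A * D)"
        using estimator_bound[OF w] assms(21) by (intro mult_left_mono) (auto simp: D_def)
      finally show ?thesis by (simp add: K_def mult.assoc)
    qed
    moreover have "m_S L_A m_A * ?x\<^sup>2 \<le> L_S L_A m_A * ?x * D + \<eta> * (?x + D)"
      unfolding D_def \<eta>_def using assms(23) by (intro error_inequality w assms(22)) auto
    ultimately show ?thesis
      unfolding c_def D_def[symmetric]
      by (intro quadratic_error_bound[OF m_pos mL]) (auto simp: D_def \<eta>_def X_norm_nonneg)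
  qed
  have c: "c > 0"
  proof -
    have "m_S L_A m_A > 0" using m_S_facts[OF m_pos L_pos] by simp
    moreover from this have "K \<ge> 0" using assms(3,4,21) by (auto simp: K_def C_1_def intro!: mult_nonneg_nonneg divide_nonneg_nonneg add_nonneg_nonneg)
    moreover have "L_S L_A m_A > 0" using L_S_facts(1)[of L_A m_A] by simp
    ultimately show ?thesis
      unfolding c_def L_Ninv_def using m_pos L_pos
      by (intro add_pos_nonneg mult_nonneg_nonneg add_nonneg_nonneg divide_pos_pos) auto
  qed
  have "?x / c \<le> (INF w\<in>Xd. X_norm j T (\<lambda>t. u t - w t))"
    using ud bound c by (intro cINF_greatest) (auto simp: field_simps)
  then have "?x \<le> c * (INF w\<in>Xd. X_norm j T (\<lambda>t. u t - w t))" using c by (simp add: field_simps)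
  then show ?thesis by (simp add: c_def K_def mult.assoc)
qed

end
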